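(* (Spanning Tree Model) Let $G$ be a balanced transverse plane graph with root $r$ the head of an edge adjacent to the unbounded region, and let $X$ be the set of lattice points $\vec{x}$ that represent spanning trees of $G$ rooted at $r$. Then $$\Delta_G(t)\doteq\sum_{\vec{x}\in X}t^{|\vec{x}|}.$$
   Context: **Setting.** A balanced transverse plane graph $G$ is a finite connected directed graph (loops and multiple edges allowed) embedded in $\mathbb{R}^2$ such that at every vertex the in-degree equals the out-degree, and in the cyclic order of edge-ends around each vertex the incoming ends are consecutive and the outgoing ends are consecutive. Fix an edge $e_0$ adjacent to the unbounded region of $\mathbb{R}^2\setminus G$ and let $r=v_0$ be its head. The other vertices are $v_1,\dots,v_k$ (in arbitrary order); $v_i$ has $d_i$ incoming edges. Order the incoming edges at $v_i$ counter-clockwise around $v_i$ (starting with the "leftmost" one, i.e. the one preceded by an outgoing edge in counter-clockwise cyclic order), and let $e_{i,j}$ be the $j$-th one. **Lattice points and spanning trees.** A lattice point $\vec{x}=(x_1,\dots,x_k)$ with integers $1\le x_i\le d_i$ represents the spanning subgraph of $G$ with edge set $\bigcup_{i=1}^k\{e_{i,x_i}\}$. Its norm is $|\vec{x}|=x_1+\cdots+x_k$. An oriented spanning tree rooted at $r$ is a spanning subgraph in which every vertex $v\ne r$ has in-degree $1$, $r$ has in-degree $0$, and there is no oriented cycle. **Crossings, regions, corners.** Draw a small circle around each vertex. For each edge $e$, let $cr(e)$ (a crossing) be the point where $e$, entering its head $v$, meets the circle around $v$; $\operatorname{Cr}(G)$ is the set of crossings. $\operatorname{Re}(G)$ is the set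 of regions: the regular regions (faces of $G$ in $\mathbb{R}^2$) and one circle region for each vertex (the disk around it). Around $cr(e)$ there are three corners: the north corner (inside the circle region of the head of $e$), and the west and east corners, lying in the regular regions on the left and on the right of $e$ respectively, when facing in the direction of $e$. **Alexander polynomial.** Put a base point $\delta$ on $e_0$; it is adjacent to two distinct regular regions $R_u,R_v$. A Kauffman state is a bijection $s:\operatorname{Cr}(G)\to\operatorname{Re}(G)\setminus\{R_u,R_v\}$ sending each crossing to (the region of) one of its corners; $S(G,\delta)$ is the set of them. For a crossing generated by $e\ne e_0$ the local contribution is $1$ for the north corner, $t^{-1/2}$ for the west corner and $t^{1/2}$ for the east corner; for $cr(e_0)$ (always assigned to its north corner) it is $t^{1/2}$. $P_s(t)$ is the product over all crossings of the local contributions of the corners chosen by $s$, and $\Delta_G(t)=\sum_{s\in S(G,\delta)}P_s(t)$, well defined up to a power of $t$. **Notation.** $\doteq$ denotes equality up to multiplication by a power $t^{r}$ of $t$ ($r\in\frac12\mathbb{Z}$). *)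

theory Defs
  imports
    "Graph_Theory.Graph_Theory"
    "HOL-Analysis.Analysis"
    "HOL-Computational_Algebra.Formal_Laurent_Series"
begin

text \<open>
  The plane is identified with the complex numbers.  Vertices are points of the plane, the arc
  \<open>e\<close> is drawn as the path \<open>\<gamma> e\<close> on \<open>[0,1]\<close>, and \<open>\<rho> v\<close> is the radius of the small circle drawn
  around the vertex \<open>v\<close>.
\<close>

datatype 'e edge_end = Incoming 'e | Outgoing 'e

datatype corner = North | West | East

datatype region = Regular "complex set" | Circle complex

locale drawing = pre_digraph G for G :: "(complex, 'e) pre_digraph" (structure) +
  fixes \<gamma> :: "'e \<Rightarrow> real \<Rightarrow> complex" and \<rho> :: "complex \<Rightarrow> real"
begin

definition edge_interior :: "'e \<Rightarrow> complex set" where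
  "edge_interior e = \<gamma> e ` {0<..<1}"

definition support :: "complex set" where
  "support = verts G \<union> (\<Union>e\<in>arcs G. path_image (\<gamma> e))"

definition regular_regions :: "complex set set" where
  "regular_regions = components (- support)"

definition adjacent_regions :: "complex \<Rightarrow> complex set set" where
  "adjacent_regions \<delta> = {R \<in> regular_regions. \<delta> \<in> frontier R}"

definition regions :: "region set" where
  "regions = Regular ` regular_regions \<union> Circle ` verts G"

text \<open>
  \<open>cr e\<close> is the point where \<open>e\<close> enters the disk around its head for good, and \<open>exit_point e\<close> is
  the point where it first leaves the disk around its tail.  For a loop, these are two points on
  the same circle.
\<close>

definition cr :: "'e \<Rightarrow> complex" where
  "cr e = \<gamma> e (THE b. 0 < b \<and> b < 1 \<and> \<gamma> e b \<in> sphere (head G e) (\<rho> (head G e)) \<and>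
                 (\<forall>s\<in>{b<..1}. \<gamma> e s \<in> ball (head G e) (\<rho> (head G e))))"

definition exit_point :: "'e \<Rightarrow> complex" where
  "exit_point e = \<gamma> e (THE a. 0 < a \<and> a < 1 \<and> \<gamma> e a \<in> sphere (tail G e) (\<rho> (tail G e)) \<and>
                 (\<forall>s\<in>{0..<a}. \<gamma> e s \<in> ball (tail G e) (\<rho> (tail G e))))"

definition edge_ends :: "complex \<Rightarrow> 'e edge_end set" where
  "edge_ends v = Incoming ` in_arcs G v \<union> Outgoing ` out_arcs G v"

fun end_point :: "'e edge_end \<Rightarrow> complex" where
  "end_point (Incoming e) = cr e"
| "end_point (Outgoing e) = exit_point e"

text \<open>
  The counter-clockwise angle in \<open>[0, 2\<pi>)\<close> from the end \<open>p\<close> to the end \<open>q\<close>, seen from \<open>v\<close>.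
\<close>

definition ccw_angle :: "complex \<Rightarrow> 'e edge_end \<Rightarrow> 'e edge_end \<Rightarrow> real" where
  "ccw_angle v p q = Arg2pi ((end_point q - v) / (end_point p - v))"

definition ccw_next :: "complex \<Rightarrow> 'e edge_end \<Rightarrow> 'e edge_end \<Rightarrow> bool" where
  "ccw_next v p q \<longleftrightarrow> q \<in> edge_ends v - {p} \<and>
     (\<forall>q'\<in>edge_ends v - {p}. ccw_angle v p q \<le> ccw_angle v p q')"

text \<open>
  A set of edge-ends at \<open>v\<close> is consecutive in the cyclic order if, going counter-clockwise from
  one of its members, all of its members are met before any other end.
\<close>

definition consecutive_ends :: "complex \<Rightarrow> 'e edge_end set \<Rightarrow> bool" where
  "consecutive_ends v S \<longleftrightarrow> S = {} \<or>
     (\<exists>p\<in>S. \<forall>q\<in>S. \<forall>q'\<in>edge_ends v - S. ccw_angle v p q < ccw_angle v p q')"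

definition leftmost_in :: "complex \<Rightarrow> 'e" where
  "leftmost_in v = (THE e. e \<in> in_arcs G v \<and>
     (\<exists>f\<in>out_arcs G v. ccw_next v (Outgoing f) (Incoming e)))"

definition in_position :: "complex \<Rightarrow> 'e \<Rightarrow> nat" where
  "in_position v e = card {f \<in> in_arcs G v.
     ccw_angle v (Incoming (leftmost_in v)) (Incoming f)
       \<le> ccw_angle v (Incoming (leftmost_in v)) (Incoming e)}"

text \<open>\<open>in_edge (v\<^sub>i) j\<close> is the edge $e_{i,j}$; \<open>j\<close> starts from 1.\<close>

definition in_edge :: "complex \<Rightarrow> nat \<Rightarrow> 'e" where
  "in_edge v j = (THE e. e \<in> in_arcs G v \<and> in_position v e = j)"

text \<open>
  The list \<open>vs\<close> enumerates the non-root vertices, and \<open>x ! i\<close> (with \<open>i\<close> starting from 0) is the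
  coordinate belonging to \<open>vs ! i\<close>.  The norm of \<open>x\<close> is \<open>sum_list x\<close>.
\<close>

definition lattice_point :: "complex list \<Rightarrow> nat list \<Rightarrow> bool" where
  "lattice_point vs x \<longleftrightarrow> length x = length vs \<and>
     (\<forall>i<length vs. 1 \<le> x ! i \<and> x ! i \<le> in_degree G (vs ! i))"

definition represented_subgraph :: "complex list \<Rightarrow> nat list \<Rightarrow> (complex, 'e) pre_digraph" where
  "represented_subgraph vs x = G\<lparr>arcs := {in_edge (vs ! i) (x ! i) | i. i < length vs}\<rparr>"

definition oriented_spanning_tree :: "complex \<Rightarrow> (complex, 'e) pre_digraph \<Rightarrow> bool" where
  "oriented_spanning_tree r H \<longleftrightarrow> spanning H G \<and>
     (\<forall>v\<in>verts G - {r}. in_degree H v = 1) \<and> in_degree H r = 0 \<and>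
     (\<nexists>p. pre_digraph.cycle H p)"

definition tree_points :: "complex \<Rightarrow> complex list \<Rightarrow> nat list set" where
  "tree_points r vs =
     {x. lattice_point vs x \<and> oriented_spanning_tree r (represented_subgraph vs x)}"

text \<open>
  The crossing \<open>cr e\<close> is indexed by the edge \<open>e\<close>.  Facing along \<open>e\<close> at \<open>cr e\<close>, that is, towards
  the head of \<open>e\<close>, the points of the circle slightly clockwise of \<open>cr e\<close> are on the left and
  those slightly counter-clockwise of it are on the right.
\<close>

definition west_region :: "'e \<Rightarrow> complex set" where
  "west_region e = (THE R. R \<in> regular_regions \<and>
     (\<forall>\<^sub>F \<eta> in at_right 0. head G e + cis (- \<eta>) * (cr e - head G e) \<in> R))"

definition east_region :: "'e \<Rightarrow> complex set" where
  "east_region e = (THE R. R \<in> regular_regions \<and>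
     (\<forall>\<^sub>F \<eta> in at_right 0. head G e + cis \<eta> * (cr e - head G e) \<in> R))"

fun corner_region :: "'e \<Rightarrow> corner \<Rightarrow> region" where
  "corner_region e North = Circle (head G e)"
| "corner_region e West = Regular (west_region e)"
| "corner_region e East = Regular (east_region e)"

text \<open>
  A Kauffman state is given by the corners it chooses; the bijection from crossings to regions
  is the induced map to the regions of these corners.
\<close>

definition kauffman_states :: "complex \<Rightarrow> ('e \<Rightarrow> corner) set" where
  "kauffman_states \<delta> = {s \<in> extensional (arcs G).
     bij_betw (\<lambda>e. corner_region e (s e)) (arcs G) (regions - Regular ` adjacent_regions \<delta>)}"

text \<open>
  Laurent polynomials in $t^{1/2}$ are represented as formal Laurent series whose
  indeterminate stands for $t^{1/2}$, so \<open>t_half_pow n\<close> is $t^{n/2}$.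
\<close>

abbreviation t_half_pow :: "int \<Rightarrow> int fls" where
  "t_half_pow n \<equiv> fls_X_intpow n"

fun corner_weight :: "corner \<Rightarrow> int fls" where
  "corner_weight North = 1"
| "corner_weight West = t_half_pow (-1)"
| "corner_weight East = t_half_pow 1"

definition state_weight :: "'e \<Rightarrow> ('e \<Rightarrow> corner) \<Rightarrow> int fls" where
  "state_weight e\<^sub>0 s = (\<Prod>e\<in>arcs G. if e = e\<^sub>0 then t_half_pow 1 else corner_weight (s e))"

definition alexander_polynomial :: "'e \<Rightarrow> complex \<Rightarrow> int fls" where
  "alexander_polynomial e\<^sub>0 \<delta> = (\<Sum>s\<in>kauffman_states \<delta>. state_weight e\<^sub>0 s)"

definition tree_polynomial :: "complex \<Rightarrow> complex list \<Rightarrow> int fls" where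
  "tree_polynomial r vs = (\<Sum>x\<in>tree_points r vs. t_half_pow (2 * int (sum_list x)))"

end

definition eq_up_to_t_power :: "int fls \<Rightarrow> int fls \<Rightarrow> bool" (infix \<open>\<doteq>\<close> 50) where
  "p \<doteq> q \<longleftrightarrow> (\<exists>n. p = fls_X_intpow n * q)"

text \<open>
  Embeddings in the plane are read as tame at the vertices, as is implicit in drawing a small
  circle around each vertex: each edge crosses the circles only at its two ends, once each.
\<close>

locale plane_graph = drawing G \<gamma> \<rho> + fin_digraph G
  for G :: "(complex, 'e) pre_digraph" (structure) and \<gamma> \<rho> +
  assumes simple: "e \<in> arcs G \<Longrightarrow> simple_path (\<gamma> e)"
    and start: "e \<in> arcs G \<Longrightarrow> pathstart (\<gamma> e) = tail G e"
    and finish: "e \<in> arcs G \<Longrightarrow> pathfinish (\<gamma> e) = head G e"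
    and avoids_verts: "e \<in> arcs G \<Longrightarrow> edge_interior e \<inter> verts G = {}"
    and disjoint_edges:
      "e \<in> arcs G \<Longrightarrow> f \<in> arcs G \<Longrightarrow> e \<noteq> f \<Longrightarrow> edge_interior e \<inter> edge_interior f = {}"
    and radius_pos: "v \<in> verts G \<Longrightarrow> 0 < \<rho> v"
    and disjoint_disks: "pairwise (\<lambda>u v. disjnt (cball u (\<rho> u)) (cball v (\<rho> v))) (verts G)"
    and circle_crossings: "e \<in> arcs G \<Longrightarrow> \<exists>a b. 0 < a \<and> a < b \<and> b < 1 \<and>
      (\<forall>s\<in>{0..<a}. \<gamma> e s \<in> ball (tail G e) (\<rho> (tail G e))) \<and>
      \<gamma> e a \<in> sphere (tail G e) (\<rho> (tail G e)) \<and>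
      (\<forall>s\<in>{a<..<b}. \<forall>v\<in>verts G. \<gamma> e s \<notin> cball v (\<rho> v)) \<and>
      \<gamma> e b \<in> sphere (head G e) (\<rho> (head G e)) \<and>
      (\<forall>s\<in>{b<..1}. \<gamma> e s \<in> ball (head G e) (\<rho> (head G e)))"

locale balanced_transverse_plane_graph = plane_graph +
  assumes connected: "Digraph_Component.connected G"
    and balanced: "v \<in> verts G \<Longrightarrow> in_degree G v = out_degree G v"
    and transverse_in: "v \<in> verts G \<Longrightarrow> consecutive_ends v (Incoming ` in_arcs G v)"
    and transverse_out: "v \<in> verts G \<Longrightarrow> consecutive_ends v (Outgoing ` out_arcs G v)"

end

theory Submission
  imports Defs "HOL-Complex_Analysis.Riemann_Mapping"
begin

text \<open>
  A Kauffman state has to use the circle region of every vertex, so it assigns the north corner to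
  exactly one incoming edge of each vertex. At the root this edge is \<open>e\<^sub>0\<close>, because both regions
  beside \<open>e\<^sub>0\<close> are excluded. The other north edges form a set \<open>T\<close> with one edge into each non-root
  vertex, that is, a lattice point \<open>x\<close>. The state is completed by a bijection from the edges outside
  \<open>T \<union> {e\<^sub>0}\<close> to the regular regions not beside \<open>e\<^sub>0\<close> which sends each edge to one of its two sides;
  call this a matching. Two facts give the theorem.

  \<^emph>\<open>The exponent depends only on \<open>x\<close>.\<close> Since in-degrees equal out-degrees, the sum of the winding
  numbers of all edges is constant on each regular region. This is the Alexander numbering \<open>I\<close>; it
  satisfies \<open>I(west e) = I(east e) + 1\<close>. Therefore a matched edge \<open>e\<close> contributes
  \<open>I(west e) + I(east e) - 2 I(chosen region)\<close> to the exponent of $t^{1/2}$. The chosen regions run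
  once through all regular regions not beside \<open>e\<^sub>0\<close>, so the exponent is a constant minus the sum of
  \<open>I(west e) + I(east e) = 2 I(west e) - 1\<close> over \<open>T\<close> (lemma \<open>sum_corners\<close>). As the incoming edges of a
  vertex are consecutive, the region east of one of them is the region west of the next, so that \<open>I\<close>
  drops by one from each incoming edge to the next, and the exponent is a constant plus \<open>2 |x|\<close>.

  \<^emph>\<open>There is one matching if \<open>T\<close> has no oriented cycle, and none otherwise.\<close> The winding number
  argument gives a potential for every flow \<open>g\<close>: a function on the regions whose value on the left of
  an edge \<open>e\<close> exceeds the one on the right by \<open>g(e)\<close>. Conversely, turning once around a vertex shows
  that the jumps of any function on the regions form a flow. If \<open>T\<close> has no oriented cycle, it carries
  no nonzero flow, hence the edges outside \<open>T\<close> connect all regions. By a dimension count there are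
  at most one less of them than regions, so they form a tree in the dual graph, and the only
  matching sends each edge to its end farther from \<open>e\<^sub>0\<close> (\<open>matching_exists\<close>, \<open>matching_unique\<close>).
  If \<open>T\<close> contains an oriented cycle \<open>C\<close>, consider the side of \<open>C\<close> away from \<open>e\<^sub>0\<close>. A matching would supply for every
  region there an edge outside \<open>T\<close> on the same side, while \<open>T\<close> already takes one edge for every vertex
  there; the dimension of the space of flows on that side and \<open>C\<close> shows that there are not enough
  edges (\<open>no_matching\<close>).

  Topology enters through the jump of the winding number across an edge (\<open>winding_number_jump\<close>) and
  through the fact that an edge has no more than two regions beside it (\<open>at_most_two_sides\<close>), which
  rests on Janiszewski's theorem.
\<close>

text \<open>
  From here on, \<open>connected\<close> refers to sets in a topological space.
\<close>

hide_const (open) Digraph_Component.connected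

section \<open>How winding numbers jump across a path\<close>

lemma winding_number_continuous_log:
  assumes "path h" and "\<And>t. 0 \<le> t \<Longrightarrow> t \<le> 1 \<Longrightarrow> p t - z = exp (h t)"
  shows "winding_number p z = (pathfinish h - pathstart h) / (2 * of_real pi * \<i>)"
proof -
  have "winding_number p z = winding_number (\<lambda>t. p t - z) 0"
    by (rule winding_number_offset)
  also have "\<dots> = winding_number (exp \<circ> h) 0"
    by (rule winding_number_cong) (simp add: assms)
  finally show ?thesis
    using winding_number_compose_exp [OF \<open>path h\<close>] by simp
qed

text \<open>
  On the path, the quotient of \<open>p - z'\<close> by \<open>p - z\<close> is never a nonpositive real number, because a
  value \<open>- c\<close> with \<open>c \<ge> 0\<close> would put the point of the path on the segment. So its principal logarithm
  is continuous along the path and turns a logarithm of \<open>p - z\<close> into one of \<open>p - z'\<close>. The change of the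
  winding number thus depends only on the two end points of \<open>p\<close>.
\<close>

lemma winding_number_shift:
  assumes "path p" and seg: "closed_segment z z' \<inter> path_image p = {}"
  shows "winding_number p z' - winding_number p z =
    (Ln ((pathfinish p - z') / (pathfinish p - z)) - Ln ((pathstart p - z') / (pathstart p - z)))
      / (2 * of_real pi * \<i>)"
proof -
  have z: "z \<notin> path_image p" and z': "z' \<notin> path_image p"
    using seg by auto
  obtain h where h: "path h" "pathfinish h - pathstart h = 2 * of_real pi * \<i> * winding_number p z"
      "\<And>t. t \<in> {0..1} \<Longrightarrow> p t = z + exp (h t)"
    using winding_number_as_continuous_log [OF \<open>path p\<close> z] by metis
  define k where "k = (\<lambda>t. h t + Ln ((p t - z') / (p t - z)))"
  have slit: "(q - z') / (q - z) \<notin> \<real>\<^sub>\<le>\<^sub>0" if "q \<in> path_image p" for q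
  proof
    assume "(q - z') / (q - z) \<in> \<real>\<^sub>\<le>\<^sub>0"
    then obtain c where c: "(q - z') / (q - z) = of_real c" "c \<le> 0"
      by (auto elim!: nonpos_Reals_cases)
    have "q \<noteq> z" using that z by auto
    then have eq: "q - z' = of_real c * (q - z)"
      using c by (simp add: field_simps)
    have "q = (1 - 1 / (1 - c)) *\<^sub>R z + (1 / (1 - c)) *\<^sub>R z'"
    proof -
      have "(1 - c) *\<^sub>R q = (- c) *\<^sub>R z + z'"
        using eq by (simp add: scaleR_conv_of_real algebra_simps)
      then have "(1 / (1 - c)) *\<^sub>R ((1 - c) *\<^sub>R q) = (1 / (1 - c)) *\<^sub>R ((- c) *\<^sub>R z + z')"
        by simp
      moreover have "1 - 1 / (1 - c) = (1 / (1 - c)) * (- c)" "(1 / (1 - c)) * (1 - c) = 1"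
        using c by (auto simp: field_simps)
      ultimately show ?thesis
        by (simp only: scaleR_add_right scaleR_scaleR scaleR_one)
    qed
    moreover have "0 \<le> 1 / (1 - c)" "1 / (1 - c) \<le> 1"
      using c by auto
    ultimately have "q \<in> closed_segment z z'"
      unfolding in_segment by blast
    with seg that show False by blast
  qed
  have pc: "continuous_on {0..1} p" and hc: "continuous_on {0..1} h"
    using \<open>path p\<close> \<open>path h\<close> by (auto simp: path_def)
  have ne: "p t \<noteq> z" "p t \<noteq> z'" if "t \<in> {0..1}" for t
    using that z z' by (auto simp: path_image_def)
  have "path k"
    unfolding path_def k_def
    using ne slit by (intro continuous_intros hc pc continuous_on_Ln) (auto simp: path_image_def)
  moreover have "p t - z' = exp (k t)" if "0 \<le> t" "t \<le> 1" for t
    using h(3)[of t] ne[of t] that by (simp add: k_def exp_add)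
  ultimately have "winding_number p z' = (pathfinish k - pathstart k) / (2 * of_real pi * \<i>)"
    by (rule winding_number_continuous_log)
  moreover have "winding_number p z = (pathfinish h - pathstart h) / (2 * of_real pi * \<i>)"
    using h(2) by simp
  ultimately show ?thesis
    by (simp add: k_def pathfinish_def pathstart_def diff_divide_distrib add_divide_distrib)
qed

lemma one_minus_cis: "1 - cis \<eta> = of_real (2 * sin (\<eta> / 2)) * cis (\<eta> / 2 - pi / 2)"
proof -
  have "cos (2 * (\<eta> / 2)) = 1 - 2 * (sin (\<eta> / 2))\<^sup>2" "sin (2 * (\<eta> / 2)) = 2 * sin (\<eta> / 2) * cos (\<eta> / 2)"
    by (rule cos_double_sin, rule sin_double)
  then show ?thesis
    by (auto simp: complex_eq_iff cos_diff sin_diff power2_eq_square)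
qed

lemma Ln_one_minus_cis:
  assumes "0 < \<eta>" "\<eta> < pi"
  shows "Ln (1 - cis \<eta>) = of_real (ln (2 * sin (\<eta> / 2))) + \<i> * of_real (\<eta> / 2 - pi / 2)"
    and "Ln (1 - cis (- \<eta>)) = of_real (ln (2 * sin (\<eta> / 2))) - \<i> * of_real (\<eta> / 2 - pi / 2)"
proof -
  have pos: "0 < 2 * sin (\<eta> / 2)"
    using assms by (simp add: sin_gt_zero)
  have ex: "exp (of_real (ln (2 * sin (\<eta> / 2))) :: complex) = of_real (2 * sin (\<eta> / 2))"
    using pos by (metis exp_ln exp_of_real)
  have eq: "exp (of_real (ln (2 * sin (\<eta> / 2))) + \<i> * of_real (\<eta> / 2 - pi / 2)) = 1 - cis \<eta>"
    by (simp only: exp_add ex cis_conv_exp [symmetric] one_minus_cis)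
  show "Ln (1 - cis \<eta>) = of_real (ln (2 * sin (\<eta> / 2))) + \<i> * of_real (\<eta> / 2 - pi / 2)"
    by (rule Ln_unique [OF eq]) (use assms in auto)
  have eqc: "of_real (ln (2 * sin (\<eta> / 2))) - \<i> * of_real (\<eta> / 2 - pi / 2) =
      cnj (of_real (ln (2 * sin (\<eta> / 2))) + \<i> * of_real (\<eta> / 2 - pi / 2))"
    by simp
  have eq': "exp (of_real (ln (2 * sin (\<eta> / 2))) - \<i> * of_real (\<eta> / 2 - pi / 2)) = 1 - cis (- \<eta>)"
    unfolding eqc exp_cnj [symmetric] eq by (simp add: cis_cnj)
  show "Ln (1 - cis (- \<eta>)) = of_real (ln (2 * sin (\<eta> / 2))) - \<i> * of_real (\<eta> / 2 - pi / 2)"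
    by (rule Ln_unique [OF eq']) (use assms in auto)
qed

text \<open>
  Seen from a point \<open>z\<close> of the circle, the disk lies in the half-plane of directions towards the
  centre, where the principal logarithm can be used.
\<close>

lemma winding_number_into_ball:
  assumes "path p" "path_image p \<subseteq> cball (pathfinish p) \<rho>"
    and z: "z \<in> sphere (pathfinish p) \<rho>" "z \<notin> path_image p"
  shows "winding_number p z = - Ln ((pathstart p - z) / (pathfinish p - z)) / (2 * of_real pi * \<i>)"
proof -
  define v where "v = pathfinish p"
  have vz: "v \<noteq> z"
    using z(2) by (auto simp: v_def)
  have pos: "0 < Re ((p t - z) / (v - z))" if "t \<in> {0..1}" for t
  proof -
    define w where "w = (p t - v) / (z - v)"
    have "(p t - z) / (v - z) = 1 - w"
      using vz by (simp add: w_def field_simps)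
    have ptz: "p t \<noteq> z" "p t \<in> cball v \<rho>"
      using that assms(2) z(2) by (auto simp: path_image_def v_def simp del: mem_cball)
    then have "norm w \<le> 1" "w \<noteq> 1"
      using z(1) vz by (auto simp: w_def v_def norm_divide dist_norm norm_minus_commute divide_le_eq)
    then have "Re w < 1"
      using abs_Re_le_cmod[of w] cmod_power2[of w] power_mono[of "norm w" 1 2]
      by (cases "Re w = 1") (auto simp: complex_eq_iff)
    with \<open>(p t - z) / (v - z) = 1 - w\<close> show ?thesis
      by simp
  qed
  define h where "h = (\<lambda>t. Ln ((p t - z) / (v - z)) + Ln (v - z))"
  have pc: "continuous_on {0..1} p"
    using \<open>path p\<close> by (simp add: path_def)
  have "path h"
    unfolding path_def h_def
    using vz pos by (intro continuous_intros pc continuous_on_Ln') (force simp: complex_nonpos_Reals_iff)+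
  moreover have "p t - z = exp (h t)" if "0 \<le> t" "t \<le> 1" for t
  proof -
    have "(p t - z) / (v - z) \<noteq> 0"
      using pos[of t] that by auto
    then show ?thesis
      using vz by (simp add: h_def exp_add)
  qed
  ultimately have "winding_number p z = (pathfinish h - pathstart h) / (2 * of_real pi * \<i>)"
    by (rule winding_number_continuous_log)
  moreover have "pathfinish h = Ln (v - z)" "pathstart h = Ln ((pathstart p - z) / (v - z)) + Ln (v - z)"
    using vz by (auto simp: h_def v_def pathfinish_def pathstart_def)
  ultimately show ?thesis
    by (simp add: v_def)
qed

text \<open>
  The path may be wild on both sides of the point \<open>p b\<close>, but the circle separates its last part,
  which is inside the disk, from the part before it, which is outside. Each of the two accounts for
  half of the jump: the part inside by \<open>winding_number_into_ball\<close>, and the part outside by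
  \<open>winding_number_shift\<close>, because the chord between the two points of the circle runs inside the disk.
  What precedes the time \<open>a\<close> stays away from \<open>p b\<close> and contributes nothing in the limit.
\<close>

lemma winding_number_jump:
  fixes p :: "real \<Rightarrow> complex"
  assumes p: "path p" "pathfinish p = v" and ab: "0 \<le> a" "a < b" "b < 1"
    and on: "p b \<in> sphere v \<rho>" and inner: "\<And>s. s \<in> {b<..1} \<Longrightarrow> p s \<in> ball v \<rho>"
    and outer: "\<And>s. s \<in> {a..b} \<Longrightarrow> p s \<notin> ball v \<rho>"
    and once: "\<And>s. s \<in> {0..a} \<Longrightarrow> p s \<noteq> p b"
    and off: "\<forall>\<^sub>F \<eta> in at_right 0. v + cis (- \<eta>) * (p b - v) \<notin> path_image p"
      "\<forall>\<^sub>F \<eta> in at_right 0. v + cis \<eta> * (p b - v) \<notin> path_image p"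
  shows "((\<lambda>\<eta>. winding_number p (v + cis (- \<eta>) * (p b - v)) - winding_number p (v + cis \<eta> * (p b - v)))
           \<longlongrightarrow> 1) (at_right 0)"
proof -
  define c where "c = p b - v"
  define W where "W = (\<lambda>\<eta>. v + cis (- \<eta>) * c)"
  define E where "E = (\<lambda>\<eta>. v + cis \<eta> * c)"
  have \<rho>: "0 < \<rho>" "norm c = \<rho>" "c \<noteq> 0"
    using on inner[of 1] \<open>b < 1\<close> by (auto simp: c_def dist_norm norm_minus_commute)
  define p1 p2 p3 where "p1 = subpath 0 a p" and "p2 = subpath a b p" and "p3 = subpath b 1 p"
  have paths: "path p1" "path p2" "path p3"
    using p ab by (auto simp: p1_def p2_def p3_def)
  have im: "path_image p1 = p ` {0..a}" "path_image p2 = p ` {a..b}" "path_image p3 = p ` {b..1}"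
    using ab by (auto simp: p1_def p2_def p3_def path_image_subpath)
  have im_sub: "p ` {0..a} \<subseteq> path_image p" "p ` {a..b} \<subseteq> path_image p" "p ` {b..1} \<subseteq> path_image p"
    using ab by (auto simp: path_image_def)
  have split: "winding_number p z = winding_number p1 z + winding_number p2 z + winding_number p3 z"
    if "z \<notin> path_image p" for z
    using winding_number_subpath_combine[OF p(1) that, of 0 a b]
      winding_number_subpath_combine[OF p(1) that, of 0 b 1] ab
    by (simp add: p1_def p2_def p3_def)
  have limW: "(W \<longlongrightarrow> p b) (at_right 0)" and limE: "(E \<longlongrightarrow> p b) (at_right 0)"
    unfolding W_def E_def by (auto intro!: tendsto_eq_intros simp: c_def)
  have sphW: "W \<eta> \<in> sphere v \<rho>" and sphE: "E \<eta> \<in> sphere v \<rho>" for \<eta>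
    using \<rho> by (auto simp: W_def E_def dist_norm norm_mult)
  have "p b \<notin> path_image p1"
    using once im by force
  then have cont: "continuous (at (p b)) (winding_number p1)"
    by (rule continuous_at_winding_number [OF paths(1)])
  have lim1: "((\<lambda>\<eta>. winding_number p1 (W \<eta>) - winding_number p1 (E \<eta>)) \<longlongrightarrow> 0) (at_right 0)"
    using tendsto_diff [OF isCont_tendsto_compose [OF cont limW] isCont_tendsto_compose [OF cont limE]]
    by simp
  have "p a \<noteq> p b"
    using once[of a] ab by auto
  then have "((\<lambda>\<eta>. (p a - W \<eta>) / (p a - E \<eta>)) \<longlongrightarrow> 1) (at_right 0)"
    by (auto intro!: tendsto_eq_intros limW limE)
  then have lim2: "((\<lambda>\<eta>. Ln ((p a - W \<eta>) / (p a - E \<eta>))) \<longlongrightarrow> 0) (at_right 0)"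
    using tendsto_Ln[of _ 1] by fastforce
  have lim3: "((\<lambda>\<eta>. \<i> * of_real (pi - \<eta>)) \<longlongrightarrow> \<i> * of_real pi) (at_right 0)"
    by (auto intro!: tendsto_eq_intros)
  have offWE: "\<forall>\<^sub>F \<eta> in at_right 0. W \<eta> \<notin> path_image p" "\<forall>\<^sub>F \<eta> in at_right 0. E \<eta> \<notin> path_image p"
    using off by (simp_all add: W_def E_def c_def)
  have "\<forall>\<^sub>F \<eta> in at_right 0. winding_number p (W \<eta>) - winding_number p (E \<eta>) =
      (winding_number p1 (W \<eta>) - winding_number p1 (E \<eta>))
      + (\<i> * of_real (pi - \<eta>) - Ln ((p a - W \<eta>) / (p a - E \<eta>))) / (2 * of_real pi * \<i>)
      + \<i> * of_real (pi - \<eta>) / (2 * of_real pi * \<i>)"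
    using offWE eventually_at_right_real[OF pi_gt_zero]
  proof eventually_elim
    case (elim \<eta>)
    then have \<eta>: "0 < \<eta>" "\<eta> < pi" by auto
    have cis1: "cis \<eta> \<noteq> 1"
      using sin_gt_zero[OF \<eta>] by (auto simp: complex_eq_iff)
    have "winding_number p2 (W \<eta>) - winding_number p2 (E \<eta>) =
        (Ln ((p b - W \<eta>) / (p b - E \<eta>)) - Ln ((p a - W \<eta>) / (p a - E \<eta>))) / (2 * of_real pi * \<i>)"
    proof -
      have "x \<notin> path_image p2" if "x \<in> closed_segment (E \<eta>) (W \<eta>)" for x
      proof (cases "x \<in> {E \<eta>, W \<eta>}")
        case True
        then show ?thesis using elim im im_sub by auto
      next
        case False
        then have "x \<in> open_segment (E \<eta>) (W \<eta>)"
          using that by (auto simp: open_segment_def)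
        then have "x \<in> ball v \<rho>"
          using dist_decreases_open_segment[of x "E \<eta>" "W \<eta>" v] sphW[of \<eta>] sphE[of \<eta>] by auto
        then show ?thesis using outer im by auto
      qed
      then show ?thesis
        using winding_number_shift [OF paths(2), of "E \<eta>" "W \<eta>"]
        by (auto simp: p2_def)
    qed
    moreover have "Ln ((p b - W \<eta>) / (p b - E \<eta>)) = \<i> * of_real (pi - \<eta>)"
    proof -
      have "(p b - W \<eta>) / (p b - E \<eta>) = (c * (1 - cis (- \<eta>))) / (c * (1 - cis \<eta>))"
        by (simp add: W_def E_def c_def algebra_simps)
      also have "\<dots> = (1 - cis (- \<eta>)) / (1 - cis \<eta>)"
        using \<rho> by simp
      also have "1 - cis (- \<eta>) = - cis (- \<eta>) * (1 - cis \<eta>)"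
        by (simp add: algebra_simps cis_mult)
      also have "- cis (- \<eta>) * (1 - cis \<eta>) / (1 - cis \<eta>) = - cis (- \<eta>)"
        using cis1 by simp
      also have "- cis (- \<eta>) = exp (\<i> * of_real (pi - \<eta>))"
        unfolding cis_conv_exp [symmetric] by (simp add: complex_eq_iff)
      finally have eq: "(p b - W \<eta>) / (p b - E \<eta>) = exp (\<i> * of_real (pi - \<eta>))" .
      show ?thesis
        unfolding eq by (rule Ln_exp) (use \<eta> in auto)
    qed
    moreover have "winding_number p3 (W \<eta>) - winding_number p3 (E \<eta>) =
        \<i> * of_real (pi - \<eta>) / (2 * of_real pi * \<i>)"
    proof -
      have fin: "pathfinish p3 = v" "pathstart p3 = p b"
        using p unfolding p3_def pathstart_subpath pathfinish_subpath by (auto simp: pathfinish_def)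
      have sub: "path_image p3 \<subseteq> cball v \<rho>"
      proof
        fix x assume "x \<in> path_image p3"
        then obtain s where "s \<in> {b..1}" "x = p s" using im by auto
        then show "x \<in> cball v \<rho>"
          using inner[of s] on by (cases "s = b") auto
      qed
      have notin: "W \<eta> \<notin> path_image p3" "E \<eta> \<notin> path_image p3"
        using elim im im_sub by auto
      have "(p b - W \<eta>) / (v - W \<eta>) = (c * (1 - cis (- \<eta>))) / (c * (- cis (- \<eta>)))"
        "(p b - E \<eta>) / (v - E \<eta>) = (c * (1 - cis \<eta>)) / (c * (- cis \<eta>))"
        by (auto simp: W_def E_def c_def algebra_simps)
      then have rat: "(p b - W \<eta>) / (v - W \<eta>) = 1 - cis \<eta>" "(p b - E \<eta>) / (v - E \<eta>) = 1 - cis (- \<eta>)"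
        using \<rho> by (simp_all only: mult_divide_mult_cancel_left, simp_all add: field_simps cis_mult)
      show ?thesis
        using winding_number_into_ball[OF paths(3), of \<rho> "W \<eta>"] winding_number_into_ball[OF paths(3), of \<rho> "E \<eta>"]
          sub notin sphW[of \<eta>] sphE[of \<eta>]
        unfolding fin rat Ln_one_minus_cis[OF \<eta>] by (simp add: diff_divide_distrib [symmetric] algebra_simps)
    qed
    ultimately show ?case
      using split[of "W \<eta>"] split[of "E \<eta>"] elim by (simp add: algebra_simps)
  qed
  moreover have "((\<lambda>\<eta>. (winding_number p1 (W \<eta>) - winding_number p1 (E \<eta>))
      + (\<i> * of_real (pi - \<eta>) - Ln ((p a - W \<eta>) / (p a - E \<eta>))) / (2 * of_real pi * \<i>)
      + \<i> * of_real (pi - \<eta>) / (2 * of_real pi * \<i>)) \<longlongrightarrow> 1) (at_right 0)"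
    by (rule tendsto_eq_rhs [OF tendsto_add [OF tendsto_add [OF lim1
          tendsto_divide [OF tendsto_diff [OF lim3 lim2] tendsto_const]] tendsto_divide [OF lim3 tendsto_const]]])
      auto
  ultimately have "((\<lambda>\<eta>. winding_number p (W \<eta>) - winding_number p (E \<eta>)) \<longlongrightarrow> 1) (at_right 0)"
    by (subst tendsto_cong)
  then show ?thesis
    by (simp add: W_def E_def c_def)
qed

section \<open>The two sides of an arc in a plane graph\<close>

lemma simple_path_eqD:
  assumes "simple_path p" "x \<in> {0..1}" "y \<in> {0..1}" "p x = p y" "x < y"
  shows "x = 0 \<and> y = 1"
proof -
  have "x = y \<or> x = 0 \<and> y = 1 \<or> x = 1 \<and> y = 0"
    using assms(1-4) unfolding simple_path_def loop_free_def by blast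
  then show ?thesis
    using assms(2,3,5) by auto
qed

lemma simple_path_interior_inj:
  assumes "simple_path p" "x \<in> {0<..<1}" "y \<in> {0..1}" "p x = p y"
  shows "x = y"
proof (rule ccontr)
  assume "x \<noteq> y"
  then consider "x < y" | "y < x" by linarith
  then show False
  proof cases
    case 1
    then have "x = 0 \<and> y = 1"
      using assms by (intro simple_path_eqD [OF assms(1)]) auto
    then show False using assms(2) by simp
  next
    case 2
    then have "y = 0 \<and> x = 1"
      using assms by (intro simple_path_eqD [OF assms(1)]) auto
    then show False using assms(2) by simp
  qed
qed

lemma component_meets_frontier:
  fixes W R K :: "complex set"
  assumes "open W" "connected W" "R \<in> components (- K)" "W \<inter> K \<noteq> {}" "R \<inter> W \<noteq> {}"
    and "closed K"
  shows "frontier R \<inter> (W \<inter> K) \<noteq> {}"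
proof -
  have "R \<subseteq> - K"
    by (rule in_components_subset [OF assms(3)])
  with assms(4) have "W - R \<noteq> {}"
    by blast
  with assms(5) have "W \<inter> frontier R \<noteq> {}"
    by (intro connected_Int_frontier [OF \<open>connected W\<close>]) auto
  moreover have "frontier R \<subseteq> K"
    by (rule frontier_of_components_closed_complement [OF \<open>closed K\<close> assms(3)])
  ultimately show ?thesis
    by blast
qed

text \<open>
  Removing a small piece of the arc \<open>p\<close> around one of its points from the graph leaves \<open>X\<close> with two
  arcs attached at one end each. By Janiszewski's theorem, adding them to \<open>X\<close> one after the other does
  not separate points that \<open>X\<close> leaves joined, so the region \<open>R\<close> can be joined to the chosen point of \<open>p\<close>; on the way out of
  \<open>R\<close> one has to cross the removed piece.
\<close>

lemma frontier_contains_open_arc: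
  fixes X :: "complex set"
  assumes "closed X" and p: "simple_path p" and ends: "pathstart p \<in> X" "pathfinish p \<in> X"
    and avoid: "p ` {0<..<1} \<inter> X = {}"
    and R: "R \<in> components (- (X \<union> path_image p))" "frontier R \<inter> p ` {0<..<1} \<noteq> {}"
  shows "p ` {0<..<1} \<subseteq> frontier R"
proof
  fix \<delta> assume "\<delta> \<in> p ` {0<..<1}"
  then obtain t where t: "0 < t" "t < 1" "\<delta> = p t" by auto
  define K where "K = X \<union> path_image p"
  have "path p" using p by (rule simple_path_imp_path)
  then have pc: "continuous_on {0..1} p" by (simp add: path_def)
  have "closed K"
    unfolding K_def using \<open>closed X\<close> \<open>path p\<close> by (simp add: closed_Un closed_path_image)
  have R': "R \<in> components (- K)"
    using R(1) by (simp only: K_def)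
  have "open (- K)" using \<open>closed K\<close> by (rule open_Compl)
  then have RK: "R \<inter> K = {}" "connected R" "R \<noteq> {}" "open R"
    using in_components_subset [OF R'] in_components_connected [OF R'] in_components_nonempty [OF R']
      open_components [OF _ R'] by blast+
  have frR: "frontier R \<subseteq> K"
    by (rule frontier_of_components_closed_complement [OF \<open>closed K\<close> R'])
  have "\<exists>y\<in>R. dist y \<delta> < \<epsilon>" if "0 < \<epsilon>" for \<epsilon>
  proof -
    obtain d where d: "d > 0" "\<And>s. s \<in> {0..1} \<Longrightarrow> dist s t < d \<Longrightarrow> dist (p s) (p t) < \<epsilon>"
      using pc t \<open>0 < \<epsilon>\<close> unfolding continuous_on_iff by (metis atLeastAtMost_iff less_eq_real_def)
    define s1 s2 where "s1 = max (t / 2) (t - d / 2)" and "s2 = min ((1 + t) / 2) (t + d / 2)"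
    have s: "0 < s1" "s1 < t" "t < s2" "s2 < 1"
      using t d(1) by (auto simp: s1_def s2_def min_def max_def)
    have near: "dist (p s) (p t) < \<epsilon>" if "s \<in> {s1<..<s2}" for s
      using that t d(1) by (intro d(2)) (auto simp: s1_def s2_def dist_real_def)
    define P1 P2 where "P1 = p ` {0..s1}" and "P2 = p ` {s2..1}"
    have arcs: "arc (subpath 0 s1 p)" "arc (subpath s2 1 p)"
      using s t simple_path_interior_inj[OF p, of s1 0] simple_path_interior_inj[OF p, of s2 1]
      by (intro arc_simple_path_subpath p; force)+
    have im: "path_image (subpath 0 s1 p) = P1" "path_image (subpath s2 1 p) = P2"
      using s by (auto simp: P1_def P2_def path_image_subpath)
    have "compact P1" "compact P2" "connected (- P1)" "connected (- P2)"
      using arcs im connected_arc_complement [OF arcs(1)] connected_arc_complement [OF arcs(2)]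
        compact_arc_image by auto
    have ends': "pathstart p = p 0" "pathfinish p = p 1"
      by (auto simp: pathstart_def pathfinish_def)
    have avoid': "p x \<notin> X" if "0 < x" "x < 1" for x
      using avoid that by (metis IntI emptyE greaterThanLessThan_iff imageI)
    have P1X: "P1 \<inter> X = {p 0}"
    proof -
      have "x = 0" if "x \<in> {0..s1}" "p x \<in> X" for x
        using that avoid'[of x] s by (cases "x = 0") auto
      moreover have "p 0 \<in> P1"
        using s unfolding P1_def by (intro imageI) auto
      ultimately show ?thesis
        using ends(1) unfolding P1_def ends' by blast
    qed
    have P2X: "P2 \<inter> (P1 \<union> X) = {p 1}"
    proof -
      have "p x = p 1" if "x \<in> {s2..1}" "p x \<in> X" for x
        using that avoid'[of x] s by (cases "x = 1") auto
      moreover have "p 1 \<in> P2"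
        using s unfolding P2_def by (intro imageI) auto
      moreover have "p x = p 1" if "x \<in> {s2..1}" "y \<in> {0..s1}" "p x = p y" for x y
      proof -
        have "x = 1 \<and> y = 0"
          using that s simple_path_eqD[OF p, of y x] by auto
        then show ?thesis by simp
      qed
      ultimately show ?thesis
        using ends(2) unfolding P1_def P2_def ends' by blast
    qed
    obtain \<delta>' where \<delta>': "\<delta>' \<in> frontier R" "\<delta>' \<in> p ` {0<..<1}" using R(2) by auto
    have I: "connected (p ` {0<..<1})"
      by (intro connected_continuous_image continuous_on_subset [OF pc]) auto
    have "open (- X)" using \<open>closed X\<close> by auto
    then obtain \<epsilon>' where \<epsilon>': "\<epsilon>' > 0" "ball \<delta>' \<epsilon>' \<subseteq> - X"
      using \<delta>' avoid by (meson ComplI IntI openE disjoint_iff)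
    then obtain x where x: "x \<in> R" "x \<in> ball \<delta>' \<epsilon>'"
      using \<delta>'(1) by (auto simp: frontier_def closure_approachable dist_commute)
    have "connected_component (- X) x \<delta>'"
      unfolding connected_component_def using \<epsilon>' x by (intro exI[of _ "ball \<delta>' \<epsilon>'"]) auto
    moreover have "connected_component (- X) \<delta>' \<delta>"
      unfolding connected_component_def using I \<delta>' avoid t by (intro exI[of _ "p ` {0<..<1}"]) auto
    ultimately have "connected_component (- X) x \<delta>"
      by (rule connected_component_trans)
    have xK: "x \<notin> K" using x RK by auto
    have P12: "P1 \<subseteq> K" "P2 \<subseteq> K"
      using s unfolding P1_def P2_def K_def by (auto simp: path_image_def)
    have \<delta>P: "\<delta> \<notin> P1" "\<delta> \<notin> P2"
    proof -
      have "t = x" if "x \<in> {0..1}" "\<delta> = p x" for x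
        using simple_path_interior_inj[OF p, of t x] that t by auto
      moreover have "t \<notin> {0..s1}" "t \<notin> {s2..1}" "{0..s1} \<subseteq> {0..1}" "{s2..1} \<subseteq> {0..1}"
        using s t by auto
      ultimately show "\<delta> \<notin> P1" "\<delta> \<notin> P2"
        unfolding P1_def P2_def by blast+
    qed
    have "connected_component (- P1) x \<delta>" "connected_component (- P2) x \<delta>"
      using \<open>connected (- P1)\<close> \<open>connected (- P2)\<close> xK P12 \<delta>P
      by (auto simp: connected_component_def)
    then have "connected_component (- (P1 \<union> X)) x \<delta>"
      using Janiszewski [OF \<open>compact P1\<close> \<open>closed X\<close>] P1X \<open>connected_component (- X) x \<delta>\<close> by auto
    then have "connected_component (- (P2 \<union> (P1 \<union> X))) x \<delta>"
      using Janiszewski [OF \<open>compact P2\<close>, of "P1 \<union> X"] P2X \<open>connected_component (- P2) x \<delta>\<close>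
        \<open>closed X\<close> \<open>compact P1\<close> by (auto simp: compact_imp_closed closed_Un)
    then obtain M where M: "connected M" "M \<inter> (P2 \<union> (P1 \<union> X)) = {}" "x \<in> M" "\<delta> \<in> M"
      by (auto simp: connected_component_def)
    have "\<delta> \<in> K"
      using t by (auto simp: K_def path_image_def)
    then have "M \<inter> frontier R \<noteq> {}"
      using connected_Int_frontier[OF M(1), of R] M x RK by blast
    then obtain y where y: "y \<in> M" "y \<in> frontier R" by auto
    then have "y \<in> path_image p"
      using frR M by (auto simp: K_def)
    then obtain u where u: "u \<in> {0..1}" "y = p u" by (auto simp: path_image_def)
    with y M have "u \<in> {s1<..<s2}"
      by (force simp: P1_def P2_def)
    then have "dist y \<delta> < \<epsilon>" using near u t by auto
    then have "0 < \<epsilon> - dist y \<delta>" by simp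
    moreover have "\<forall>e>0. \<exists>z\<in>R. dist z y < e"
      using y(2) unfolding frontier_def by (simp add: closure_approachable)
    ultimately obtain z where "z \<in> R" "dist z y < \<epsilon> - dist y \<delta>"
      by blast
    then have "dist z \<delta> < \<epsilon>"
      using dist_triangle[of z \<delta> y] by linarith
    then show ?thesis using \<open>z \<in> R\<close> by blast
  qed
  then have "\<delta> \<in> closure R"
    by (simp add: closure_approachable)
  moreover have "\<delta> \<notin> R"
    using t RK(1) by (force simp: K_def path_image_def)
  ultimately show "\<delta> \<in> frontier R"
    using \<open>open R\<close> by (simp add: frontier_def interior_open)
qed

text \<open>
  Suppose that \<open>A\<close>, \<open>B\<close> and \<open>D\<close> all lie along \<open>p\<close>, with \<open>A\<close> different from the others. Take a crosscut
  \<open>c\<close> through \<open>A\<close> which joins two interior points \<open>p s\<close> and \<open>p t\<close> of the arc. The set \<open>S\<close> consists of \<open>c\<close>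
  and everything but the piece of \<open>p\<close> between these points, and \<open>T\<close> of \<open>c\<close> and this piece. Neither
  separates \<open>B\<close> from \<open>D\<close>, since both regions have a common frontier point outside \<open>S\<close> and one outside \<open>T\<close>.
  As \<open>S \<inter> T = c\<close> is connected, Janiszewski's theorem says that \<open>S \<union> T\<close> does not separate them either.
\<close>

lemma at_most_two_sides:
  fixes X :: "complex set"
  assumes "compact X" and p: "simple_path p" and ends: "pathstart p \<in> X" "pathfinish p \<in> X"
    and avoid: "p ` {0<..<1} \<inter> X = {}"
    and A: "A \<in> components (- (X \<union> path_image p))" "p ` {0<..<1} \<subseteq> frontier A"
    and B: "B \<in> components (- (X \<union> path_image p))" "p ` {0<..<1} \<subseteq> frontier B"
    and D: "D \<in> components (- (X \<union> path_image p))" "p ` {0<..<1} \<subseteq> frontier D"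
    and AB: "A \<noteq> B" "A \<noteq> D"
  shows "B = D"
proof -
  define K where "K = X \<union> path_image p"
  have "path p" using p by (rule simple_path_imp_path)
  then have pc: "continuous_on {0..1} p" by (simp add: path_def)
  have "closed X" using \<open>compact X\<close> by (rule compact_imp_closed)
  have "closed K"
    unfolding K_def using \<open>closed X\<close> \<open>path p\<close> by (simp add: closed_Un closed_path_image)
  have A': "A \<in> components (- K)"
    using A(1) by (simp only: K_def)
  have "open A" "connected A"
    using open_components [OF open_Compl [OF \<open>closed K\<close>] A'] in_components_connected [OF A'] by auto
  have frA: "frontier A \<subseteq> K"
    by (rule frontier_of_components_closed_complement [OF \<open>closed K\<close> A'])
  define p0 q0 where "p0 = p (1/3)" and "q0 = p (2/3)"
  have "p0 \<noteq> q0"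
    using simple_path_eqD[OF p, of "1/3" "2/3"] by (auto simp: p0_def q0_def)
  have in_I: "p0 \<in> p ` {0<..<1}" "q0 \<in> p ` {0<..<1}" by (auto simp: p0_def q0_def)
  define \<epsilon> where "\<epsilon> = dist p0 q0 / 2"
  have "\<epsilon> > 0" using \<open>p0 \<noteq> q0\<close> by (simp add: \<epsilon>_def)
  define U V where "U = frontier A \<inter> (ball p0 \<epsilon> - X)" and "V = frontier A \<inter> (ball q0 \<epsilon> - X)"
  have UV: "U \<inter> V = {}"
    using dist_triangle_half_l[of p0 _ "dist p0 q0" q0] by (auto simp: U_def V_def \<epsilon>_def dist_commute)
  have memU: "p0 \<in> U" "q0 \<in> V"
    using in_I A(2) avoid \<open>\<epsilon> > 0\<close> by (auto simp: U_def V_def)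
  have "openin (top_of_set (frontier A)) U" "openin (top_of_set (frontier A)) V"
    unfolding U_def V_def using \<open>closed X\<close> by (auto intro!: openin_open_Int open_Diff)
  then obtain g0 where g0: "arc g0" "pathstart g0 \<in> U" "pathfinish g0 \<in> V" "g0 ` {0<..<1} \<subseteq> A"
    using dense_accessible_frontier_point_pairs [OF \<open>open A\<close> \<open>connected A\<close>, of U V] memU UV by blast
  have on_arc: "\<exists>s. 0 < s \<and> s < 1 \<and> x = p s" if "x \<in> U \<union> V" for x
  proof -
    have "x \<in> K" "x \<notin> X" using that frA by (auto simp: U_def V_def)
    then obtain s where "s \<in> {0..1}" "x = p s" by (auto simp: K_def path_image_def)
    moreover have "s \<noteq> 0" "s \<noteq> 1"
      using ends \<open>x \<notin> X\<close> \<open>x = p s\<close> by (auto simp: pathstart_def pathfinish_def)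
    ultimately show ?thesis by (intro exI[of _ s]) auto
  qed
  have "\<exists>g s t. arc g \<and> 0 < s \<and> s < t \<and> t < 1 \<and> pathstart g = p s \<and> pathfinish g = p t \<and> g ` {0<..<1} \<subseteq> A"
  proof -
    obtain s where s: "0 < s" "s < 1" "pathstart g0 = p s" using on_arc g0 by blast
    obtain t where t: "0 < t" "t < 1" "pathfinish g0 = p t" using on_arc g0 by blast
    have "s \<noteq> t" using g0 UV s t by auto
    show ?thesis
    proof (cases "s < t")
      case True
      then show ?thesis using g0 s t by blast
    next
      case False
      have "reversepath g0 ` {0<..<1} \<subseteq> A"
        using g0(4) unfolding reversepath_def by fastforce
      then show ?thesis
        using g0 s t False \<open>s \<noteq> t\<close>
        by (intro exI[of _ "reversepath g0"] exI[of _ t] exI[of _ s]) (auto simp: arc_reversepath)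
    qed
  qed
  then obtain g s t where g: "arc g" "g ` {0<..<1} \<subseteq> A" "pathstart g = p s" "pathfinish g = p t"
    and st: "0 < s" "s < t" "t < 1" by blast
  define c where "c = path_image g"
  have c_sub: "c \<subseteq> A \<union> {p s, p t}"
  proof
    fix x assume "x \<in> c"
    then obtain u where "u \<in> {0..1}" "x = g u" by (auto simp: c_def path_image_def)
    then show "x \<in> A \<union> {p s, p t}"
      using g(2-4) by (cases "u = 0 \<or> u = 1") (auto simp: pathstart_def pathfinish_def image_subset_iff)
  qed
  have c: "p s \<in> c" "p t \<in> c" "compact c" "connected c"
    using g pathstart_in_path_image[of g] pathfinish_in_path_image[of g]
      compact_arc_image connected_arc_image by (auto simp: c_def)
  define S T where "S = X \<union> p ` {0..s} \<union> p ` {t..1} \<union> c" and "T = p ` {s..t} \<union> c"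
  have "compact (p ` {u..v})" if "0 \<le> u" "v \<le> 1" for u v
    using that by (intro compact_continuous_image continuous_on_subset [OF pc]) auto
  then have comp: "compact S" "compact T"
    using \<open>compact X\<close> c st unfolding S_def T_def by (auto intro!: compact_Un)
  have avoid': "p x \<notin> X" if "0 < x" "x < 1" for x
    using avoid that by (metis IntI emptyE greaterThanLessThan_iff imageI)
  have "S \<inter> T = c"
  proof -
    have "p x \<notin> X" if "x \<in> {s..t}" for x
      using avoid'[of x] st that by auto
    moreover have "p x \<in> c" if "x \<in> {s..t}" "y \<in> {0..s} \<union> {t..1}" "p x = p y" for x y
    proof -
      have "x = y"
        using that st by (intro simple_path_interior_inj[OF p]) auto
      then have "x = s \<or> x = t" using that by auto
      then show ?thesis using c by auto
    qed
    ultimately show ?thesis by (auto simp: S_def T_def)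
  qed
  have KST: "K \<subseteq> S \<union> T"
  proof -
    have "{0..1} \<subseteq> {0..s} \<union> {s..t} \<union> {t..1}" by auto
    then have "p ` {0..1} \<subseteq> p ` {0..s} \<union> p ` {s..t} \<union> p ` {t..1}" by blast
    then show ?thesis by (auto simp: K_def S_def T_def path_image_def)
  qed
  obtain b d where bd: "b \<in> B" "d \<in> D"
    using in_components_nonempty [OF B(1)] in_components_nonempty [OF D(1)] by blast
  have off_c: "R \<inter> K = {} \<and> R \<inter> c = {} \<and> connected R"
    if R: "R \<in> components (- K)" "A \<noteq> R" for R
  proof -
    have "R \<subseteq> - K" by (rule in_components_subset [OF R(1)])
    then have RK: "R \<inter> K = {}" by blast
    have "R \<inter> A = {}"
      using components_nonoverlap [OF R(1) A'] R(2) by simp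
    moreover have "{p s, p t} \<subseteq> K" using st by (auto simp: K_def path_image_def)
    ultimately have "R \<inter> c = {}"
      using c_sub RK by blast
    with RK show ?thesis
      using in_components_connected [OF R(1)] by simp
  qed
  have off: "B \<inter> K = {} \<and> B \<inter> c = {} \<and> connected B" "D \<inter> K = {} \<and> D \<inter> c = {} \<and> connected D"
    using off_c B D AB by (auto simp: K_def)
  have STK: "S \<subseteq> K \<union> c" "T \<subseteq> K \<union> c"
    using st by (auto simp: S_def T_def K_def path_image_def)
  have joined: "connected_component (- Y) b d"
    if Y: "Y \<subseteq> K \<union> c" and m: "m \<in> p ` {0<..<1}" "m \<notin> Y" for Y m
  proof -
    have "m \<in> closure B" "m \<in> closure D"
      using m(1) B(2) D(2) by (auto simp: frontier_def)
    then have "connected (insert m B)" "connected (insert m D)"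
      using connected_intermediate_closure[of B "insert m B"] connected_intermediate_closure[of D "insert m D"]
        off closure_subset by blast+
    then have "connected (insert m B \<union> insert m D)"
      by (intro connected_Un) auto
    moreover have "insert m B \<union> insert m D \<subseteq> - Y"
      using off Y m by blast
    ultimately show ?thesis
      unfolding connected_component_def using bd by blast
  qed
  have A_I: "A \<inter> p ` {0<..<1} = {}"
    using in_components_subset [OF A(1)] by (auto simp: path_image_def)
  have not_c: "p x \<notin> c" if "x \<in> {0<..<1}" "x \<noteq> s" "x \<noteq> t" for x
  proof -
    have "p x \<noteq> p s" "p x \<noteq> p t"
      using that st simple_path_interior_inj[OF p, of x s] simple_path_interior_inj[OF p, of x t] by auto
    then show ?thesis using c_sub A_I that by blast
  qed
  have not_seg: "p x \<notin> p ` {u..v}" if "x \<in> {0<..<1}" "x \<notin> {u..v}" "0 \<le> u" "v \<le> 1" for x u v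
  proof
    assume "p x \<in> p ` {u..v}"
    then obtain y where y: "y \<in> {u..v}" "p x = p y" by auto
    then have "x = y"
      using that by (intro simple_path_interior_inj[OF p]) auto
    then show False
      using y that by auto
  qed
  have "connected_component (- S) b d"
  proof (rule joined [OF STK(1)])
    show "p ((s + t) / 2) \<in> p ` {0<..<1}" using st by auto
    show "p ((s + t) / 2) \<notin> S"
      using not_c[of "(s + t) / 2"] not_seg[of "(s + t) / 2" 0 s] not_seg[of "(s + t) / 2" t 1] st avoid'[of "(s + t) / 2"]
      by (auto simp: S_def)
  qed
  moreover have "connected_component (- T) b d"
  proof (rule joined [OF STK(2)])
    show "p (s / 2) \<in> p ` {0<..<1}" using st by auto
    show "p (s / 2) \<notin> T"
      using not_c[of "s / 2"] not_seg[of "s / 2" s t] st by (auto simp: T_def)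
  qed
  ultimately have "connected_component (- (S \<union> T)) b d"
    using Janiszewski [OF comp(1) compact_imp_closed [OF comp(2)]] \<open>S \<inter> T = c\<close> c by auto
  then have "connected_component (- K) b d"
    using connected_component_of_subset KST by blast
  then show ?thesis
    using joinable_components_eq [of _ "- K" B D] bd B(1) D(1)
    unfolding connected_component_def K_def by blast
qed

section \<open>Flows, potentials and matchings on a plane map\<close>

text \<open>
  Gaussian elimination of one unknown at a time.
\<close>

lemma underdetermined_system:
  fixes A :: "'q \<Rightarrow> 'e \<Rightarrow> 'a::field"
  assumes "finite Q" "finite E" "card Q < card E"
  shows "\<exists>g. (\<exists>e\<in>E. g e \<noteq> 0) \<and> (\<forall>e. e \<notin> E \<longrightarrow> g e = 0) \<and> (\<forall>q\<in>Q. (\<Sum>e\<in>E. A q e * g e) = 0)"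
  using assms
proof (induction Q arbitrary: E A rule: finite_induct)
  case empty
  then obtain e where "e \<in> E" by (metis card.empty equals0I less_irrefl)
  then show ?case by (intro exI[of _ "\<lambda>x. if x = e then 1 else 0"]) auto
next
  case (insert q Q)
  show ?case
  proof (cases "\<forall>e\<in>E. A q e = 0")
    case True
    have "card Q < card E" using insert by simp
    then obtain g where "\<exists>e\<in>E. g e \<noteq> 0" "\<forall>e. e \<notin> E \<longrightarrow> g e = 0" "\<forall>q\<in>Q. (\<Sum>e\<in>E. A q e * g e) = 0"
      using insert.IH[OF \<open>finite E\<close>] by blast
    with True show ?thesis by (intro exI[of _ g]) auto
  next
    case False
    then obtain d where d: "d \<in> E" "A q d \<noteq> 0" by blast
    define B where "B = (\<lambda>p e. A p e - A p d * A q e / A q d)"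
    have "card Q < card (E - {d})" using insert d by simp
    then obtain g where g: "\<exists>e\<in>E - {d}. g e \<noteq> 0" "\<forall>e. e \<notin> E - {d} \<longrightarrow> g e = 0"
        "\<forall>p\<in>Q. (\<Sum>e\<in>E - {d}. B p e * g e) = 0"
      using insert.IH[of "E - {d}" B] \<open>finite E\<close> by blast
    define x where "x = - (\<Sum>e\<in>E - {d}. A q e * g e) / A q d"
    define h where "h = g(d := x)"
    have sum_h: "(\<Sum>e\<in>E. A p e * h e) = A p d * x + (\<Sum>e\<in>E - {d}. A p e * g e)" for p
      using d \<open>finite E\<close> by (subst sum.remove[of _ d]) (auto simp: h_def)
    have "(\<Sum>e\<in>E. A p e * h e) = 0" if "p \<in> insert q Q" for p
    proof (cases "p = q")
      case True
      then show ?thesis using d by (simp add: sum_h x_def)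
    next
      case False
      then have "(\<Sum>e\<in>E - {d}. B p e * g e) = 0" using g that by blast
      moreover have "(\<Sum>e\<in>E - {d}. B p e * g e) =
          (\<Sum>e\<in>E - {d}. A p e * g e) - A p d * (\<Sum>e\<in>E - {d}. A q e * g e) / A q d"
        by (simp add: B_def left_diff_distrib sum_subtractf sum_distrib_left sum_divide_distrib mult.assoc)
      ultimately show ?thesis by (simp add: sum_h x_def)
    qed
    moreover have "\<exists>e\<in>E. h e \<noteq> 0" using g by (auto simp: h_def)
    moreover have "\<forall>e. e \<notin> E \<longrightarrow> h e = 0" using g d by (auto simp: h_def)
    ultimately show ?thesis by (intro exI[of _ h]) blast
  qed
qed

text \<open>
  Grow \<open>Z\<close> by one vertex at a time along an edge leaving the set reached so far. A vertex is given
  the edge along which it was reached; this edge has both ends in the set from then on, so it is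
  not used again. In particular, no edge inside \<open>Z\<close> is used. For a single vertex \<open>Z\<close>, these are the
  parent edges of a spanning tree.
\<close>

lemma attaching_edges:
  assumes "finite F" "Z \<subseteq> F" and ends: "\<And>e. e \<in> D \<Longrightarrow> a e \<in> F \<and> b e \<in> F"
    and conn: "\<And>Y. Z \<subseteq> Y \<Longrightarrow> Y \<subset> F \<Longrightarrow> \<exists>e\<in>D. (a e \<in> Y) \<noteq> (b e \<in> Y)"
  shows "\<exists>p. inj_on p (F - Z) \<and> (\<forall>x\<in>F - Z. p x \<in> D \<and> (a (p x) = x \<or> b (p x) = x))"
  using assms(2) conn
proof (induction "card (F - Z)" arbitrary: Z)
  case 0
  then have none: "F - Z = {}" using \<open>finite F\<close> by auto
  show ?case unfolding none by simp
next
  case (Suc n)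
  then have "Z \<subset> F" by auto
  then obtain e where e: "e \<in> D" "(a e \<in> Z) \<noteq> (b e \<in> Z)" using Suc.prems(2)[of Z] by auto
  define x where "x = (if a e \<in> Z then b e else a e)"
  have x: "x \<in> F - Z" "a e = x \<or> b e = x" "a e \<in> insert x Z" "b e \<in> insert x Z"
    using e ends[OF e(1)] by (auto simp: x_def)
  have "F - insert x Z = (F - Z) - {x}" by auto
  then have "n = card (F - insert x Z)" using Suc.hyps x by simp
  then obtain p where p: "inj_on p (F - insert x Z)"
      "\<And>y. y \<in> F - insert x Z \<Longrightarrow> p y \<in> D \<and> (a (p y) = y \<or> b (p y) = y)"
    using Suc.hyps(1)[of "insert x Z"] Suc.prems x(1) by (metis DiffD1 insert_subset)
  have "p y \<noteq> e" if "y \<in> F - insert x Z" for y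
    using p(2)[OF that] x that by auto
  moreover have FZ: "F - Z = insert x (F - insert x Z)" using x by auto
  ultimately have "inj_on (p(x := e)) (F - Z)"
    using p(1) unfolding FZ by (auto simp: inj_on_def)
  moreover have "\<forall>y\<in>F - Z. (p(x := e)) y \<in> D \<and> (a ((p(x := e)) y) = y \<or> b ((p(x := e)) y) = y)"
    using p(2) e x unfolding FZ by auto
  ultimately show ?case by blast
qed

text \<open>
  The combinatorial content of a plane graph. A flow is a function on the edges whose sums over
  the incoming and over the outgoing edges of each vertex agree. The function \<open>pot\<close> provides the
  potentials of all flows linearly, with one function on the regions for every edge; that a potential
  depends linearly on its flow is what makes dimension counts possible.
\<close>

locale planar_map =
  fixes V :: "'v set" and E :: "'e set" and F :: "'f set"
    and src tgt :: "'e \<Rightarrow> 'v" and lf rt :: "'e \<Rightarrow> 'f" and pot :: "'e \<Rightarrow> 'f \<Rightarrow> real"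
  assumes finite_V: "finite V" and finite_E: "finite E" and finite_F: "finite F"
    and src_in: "e \<in> E \<Longrightarrow> src e \<in> V" and tgt_in: "e \<in> E \<Longrightarrow> tgt e \<in> V"
    and lf_in: "e \<in> E \<Longrightarrow> lf e \<in> F" and rt_in: "e \<in> E \<Longrightarrow> rt e \<in> F"
    and in_out: "v \<in> V \<Longrightarrow> card {e \<in> E. tgt e = v} = card {e \<in> E. src e = v}"
    and potential_jump:
      "(\<And>v. v \<in> V \<Longrightarrow> (\<Sum>e | e \<in> E \<and> tgt e = v. g e) = (\<Sum>e | e \<in> E \<and> src e = v. g e)) \<Longrightarrow> e \<in> E \<Longrightarrow>
        (\<Sum>d\<in>E. g d * pot d (lf e)) - (\<Sum>d\<in>E. g d * pot d (rt e)) = g e"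
    and rotation: "v \<in> V \<Longrightarrow>
      (\<Sum>e | e \<in> E \<and> tgt e = v. J (lf e) - J (rt e)) = (\<Sum>e | e \<in> E \<and> src e = v. J (lf e) - J (rt e) :: real)"
    and constant_around: "v \<in> V \<Longrightarrow> (\<And>e. e \<in> E \<Longrightarrow> tgt e = v \<or> src e = v \<Longrightarrow> J (lf e) = (J (rt e) :: real)) \<Longrightarrow>
      e \<in> E \<Longrightarrow> tgt e = v \<or> src e = v \<Longrightarrow> e' \<in> E \<Longrightarrow> tgt e' = v \<or> src e' = v \<Longrightarrow> J (lf e) = J (lf e')"
    and dual_connected: "Y \<noteq> {} \<Longrightarrow> Y \<subset> F \<Longrightarrow> \<exists>e\<in>E. (lf e \<in> Y) \<noteq> (rt e \<in> Y)"
begin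

definition excess :: "('e \<Rightarrow> real) \<Rightarrow> 'v \<Rightarrow> real" where
  "excess g v = (\<Sum>e | e \<in> E \<and> tgt e = v. g e) - (\<Sum>e | e \<in> E \<and> src e = v. g e)"

definition potential :: "('e \<Rightarrow> real) \<Rightarrow> 'f \<Rightarrow> real" where
  "potential g f = (\<Sum>d\<in>E. g d * pot d f)"

lemma potential_diff:
  assumes "\<And>v. v \<in> V \<Longrightarrow> excess g v = 0" "e \<in> E"
  shows "potential g (lf e) - potential g (rt e) = g e"
  using potential_jump[of g e] assms by (simp add: potential_def excess_def)

lemma excess_eq: "excess g v = (\<Sum>e\<in>E. (of_bool (tgt e = v) - of_bool (src e = v)) * g e)"
proof -
  have "(\<Sum>e | e \<in> E \<and> tgt e = v. g e) = (\<Sum>e\<in>E. of_bool (tgt e = v) * g e)"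
    "(\<Sum>e | e \<in> E \<and> src e = v. g e) = (\<Sum>e\<in>E. of_bool (src e = v) * g e)"
    using finite_E by (auto intro!: sum.mono_neutral_cong_left)
  then show ?thesis
    by (simp add: excess_def left_diff_distrib sum_subtractf)
qed

lemma sum_excess: "(\<Sum>v\<in>V. excess g v) = 0"
proof -
  have "(\<Sum>v\<in>V. excess g v) = (\<Sum>e\<in>E. \<Sum>v\<in>V. (of_bool (tgt e = v) - of_bool (src e = v)) * g e)"
    unfolding excess_eq by (rule sum.swap)
  also have "\<dots> = 0"
  proof (rule sum.neutral, rule ballI)
    fix e assume "e \<in> E"
    then have "(\<Sum>v\<in>V. of_bool (tgt e = v) :: real) = 1" "(\<Sum>v\<in>V. of_bool (src e = v) :: real) = 1"
      using finite_V src_in tgt_in by (auto simp: of_bool_def)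
    then show "(\<Sum>v\<in>V. (of_bool (tgt e = v) - of_bool (src e = v)) * g e) = 0"
      by (simp add: left_diff_distrib sum_subtractf sum_distrib_right [symmetric])
  qed
  finally show ?thesis .
qed

lemma excess_all_but_one:
  assumes "v\<^sub>0 \<in> V" "\<And>v. v \<in> V - {v\<^sub>0} \<Longrightarrow> excess g v = 0" "v \<in> V"
  shows "excess g v = 0"
proof (cases "v = v\<^sub>0")
  case True
  have "(\<Sum>v\<in>V. excess g v) = excess g v\<^sub>0"
    using assms finite_V by (subst sum.remove[of _ v\<^sub>0]) auto
  with True show ?thesis by (simp add: sum_excess)
qed (use assms in auto)

definition numbering :: "'f \<Rightarrow> real" where
  "numbering = potential (\<lambda>_. 1)"

lemma numbering: "e \<in> E \<Longrightarrow> numbering (lf e) = numbering (rt e) + 1"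
  using potential_diff[of "\<lambda>_. 1" e] in_out by (simp add: numbering_def excess_def)

text \<open>
  One half of Euler's formula. If there were more edges, the equations for a flow with constant
  potential (one vertex equation and one region being redundant) would have a nonzero solution; but
  a flow is determined by the jumps of its potential.
\<close>

lemma edge_bound:
  assumes "E \<noteq> {}"
  shows "card E + 2 \<le> card V + card F"
proof (rule ccontr)
  assume less: "\<not> ?thesis"
  obtain e where e: "e \<in> E" using assms by auto
  define v\<^sub>0 f\<^sub>0 where "v\<^sub>0 = tgt e" and "f\<^sub>0 = lf e"
  have in0: "v\<^sub>0 \<in> V" "f\<^sub>0 \<in> F" using e tgt_in lf_in by (auto simp: v\<^sub>0_def f\<^sub>0_def)
  define Q where "Q = (V - {v\<^sub>0}) <+> (F - {f\<^sub>0})"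
  define A where "A = (\<lambda>q d. case q of Inl v \<Rightarrow> of_bool (tgt d = v) - of_bool (src d = v) | Inr f \<Rightarrow> pot d f - pot d f\<^sub>0)"
  have "card Q = card V - 1 + (card F - 1)"
    using in0 finite_V finite_F by (simp add: Q_def card_Plus)
  moreover have "0 < card V" "0 < card F"
    using in0 finite_V finite_F by (auto simp: card_gt_0_iff)
  ultimately have "card Q < card E"
    using less by linarith
  moreover have "finite Q" using finite_V finite_F by (auto simp: Q_def)
  ultimately obtain g where g: "\<exists>e\<in>E. g e \<noteq> 0" and eqs: "\<forall>q\<in>Q. (\<Sum>e\<in>E. A q e * g e) = 0"
    using underdetermined_system[OF _ finite_E, of Q A] by blast
  have "excess g v = 0" if "v \<in> V - {v\<^sub>0}" for v
  proof -
    have "Inl v \<in> Q" using that by (auto simp: Q_def)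
    from bspec[OF eqs this] show ?thesis by (simp add: A_def excess_eq)
  qed
  then have flow: "excess g v = 0" if "v \<in> V" for v
    using excess_all_but_one[OF in0(1)] that by blast
  have "potential g f = potential g f\<^sub>0" if "f \<in> F" for f
  proof (cases "f = f\<^sub>0")
    case False
    then have "Inr f \<in> Q" using that by (auto simp: Q_def)
    from bspec[OF eqs this] show ?thesis by (simp add: A_def potential_def algebra_simps sum_subtractf)
  qed simp
  then have "g d = 0" if "d \<in> E" for d
    using potential_diff[OF flow that] lf_in rt_in that by simp
  with g show False by blast
qed

end

text \<open>
  The set \<open>T\<close> is the choice of one incoming edge for each vertex except the head of \<open>e\<^sub>0\<close>.
\<close>

locale rooted_planar_map = planar_map +
  fixes e\<^sub>0 T
  assumes e\<^sub>0: "e\<^sub>0 \<in> E" and T: "T \<subseteq> E - {e\<^sub>0}"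
    and one_in: "v \<in> V - {tgt e\<^sub>0} \<Longrightarrow> \<exists>e\<in>T. tgt e = v" and inj_tgt: "inj_on tgt T"
    and no_root: "e \<in> T \<Longrightarrow> tgt e \<noteq> tgt e\<^sub>0"
begin

definition free_edges :: "'b set" where "free_edges = E - T - {e\<^sub>0}"

definition free_faces :: "'c set" where "free_faces = F - {lf e\<^sub>0, rt e\<^sub>0}"

definition matching :: "('b \<Rightarrow> 'c) \<Rightarrow> bool" where
  "matching m \<longleftrightarrow> bij_betw m free_edges free_faces \<and> (\<forall>e\<in>free_edges. m e = lf e \<or> m e = rt e)"

text \<open>
  Within \<open>T\<close>, a nonempty set of edges with the same heads as tails contains an oriented cycle, and
  the edges of an oriented cycle form such a set.
\<close>

definition cycle_free :: bool where
  "cycle_free \<longleftrightarrow> (\<nexists>C. C \<subseteq> T \<and> C \<noteq> {} \<and> src ` C = tgt ` C)"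

lemma finite_T: "finite T"
  using T finite_E finite_subset by blast

lemma card_T: "card V = card T + 1"
proof -
  have "tgt ` T = V - {tgt e\<^sub>0}"
  proof
    show "tgt ` T \<subseteq> V - {tgt e\<^sub>0}" using T no_root tgt_in by auto
    show "V - {tgt e\<^sub>0} \<subseteq> tgt ` T" using one_in by (metis imageI subsetI)
  qed
  then have "card T = card (V - {tgt e\<^sub>0})"
    using card_image[OF inj_tgt] by simp
  moreover have "0 < card V"
    using finite_V tgt_in[OF e\<^sub>0] by (auto simp: card_gt_0_iff)
  ultimately show ?thesis
    using finite_V tgt_in[OF e\<^sub>0] by simp
qed

text \<open>
  Otherwise the indicator function of \<open>Y\<close> jumps only across edges of \<open>T\<close>, and its jumps form a
  flow. At the head of an edge of \<open>T\<close> carrying a nonzero value nothing else flows in, so some edge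
  of \<open>T\<close> carries a nonzero value out of it. Hence every head is a tail, and by counting every tail is a
  head.
\<close>

lemma cotree_connected:
  assumes cycle_free "Y \<noteq> {}" "Y \<subset> F"
  shows "\<exists>e\<in>E - T. (lf e \<in> Y) \<noteq> (rt e \<in> Y)"
proof (rule ccontr)
  assume none: "\<not> ?thesis"
  define J :: "'c \<Rightarrow> real" where "J f = of_bool (f \<in> Y)" for f
  define C where "C = {e \<in> E. J (lf e) \<noteq> J (rt e)}"
  have "C \<subseteq> T" using none by (auto simp: C_def J_def)
  have "C \<noteq> {}" using dual_connected[OF assms(2,3)] by (auto simp: C_def J_def)
  have "tgt ` C \<subseteq> src ` C"
  proof
    fix v assume "v \<in> tgt ` C"
    then obtain e where e: "e \<in> C" "v = tgt e" by auto
    have eT: "e \<in> T" "e \<in> E" using e \<open>C \<subseteq> T\<close> T by auto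
    have "J (lf d) - J (rt d) = 0" if "d \<in> {d \<in> E. tgt d = v} - {e}" for d
      using that inj_onD[OF inj_tgt, of d e] e eT \<open>C \<subseteq> T\<close> by (auto simp: C_def)
    then have "(\<Sum>d | d \<in> E \<and> tgt d = v. J (lf d) - J (rt d)) = J (lf e) - J (rt e)"
      using finite_E eT e by (subst sum.remove[of _ e]) auto
    then have "(\<Sum>d | d \<in> E \<and> src d = v. J (lf d) - J (rt d)) \<noteq> 0"
      using rotation[of v J] e tgt_in eT by (auto simp: C_def)
    then obtain d where "d \<in> E" "src d = v" "J (lf d) \<noteq> J (rt d)"
      by (smt (verit, best) mem_Collect_eq sum.neutral)
    then show "v \<in> src ` C" by (auto simp: C_def)
  qed
  moreover have "finite C" using finite_E by (auto simp: C_def)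
  moreover have "card (src ` C) \<le> card (tgt ` C)"
    using card_image_le[OF \<open>finite C\<close>, of src] card_image[OF inj_on_subset[OF inj_tgt \<open>C \<subseteq> T\<close>]] by simp
  ultimately have "tgt ` C = src ` C"
    by (intro card_seteq) auto
  with \<open>C \<subseteq> T\<close> \<open>C \<noteq> {}\<close> assms(1) show False
    by (metis cycle_free_def)
qed

lemma faces_ne: "lf e\<^sub>0 \<noteq> rt e\<^sub>0"
  using numbering[OF e\<^sub>0] by auto

lemma card_cotree: "card free_edges + 2 \<le> card F" "card (E - T) = card free_edges + 1"
proof -
  have "card E + 2 \<le> card T + 1 + card F"
    using edge_bound e\<^sub>0 card_T by auto
  moreover have "card E = card (E - T) + card T"
    using T finite_E finite_T by (simp add: card_Diff_subset card_mono Diff_subset subset_Diff_insert)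
  moreover have "E - T = insert e\<^sub>0 free_edges" "e\<^sub>0 \<notin> free_edges"
    using e\<^sub>0 T by (auto simp: free_edges_def)
  moreover have "finite free_edges" using finite_E by (auto simp: free_edges_def)
  ultimately show "card free_edges + 2 \<le> card F" "card (E - T) = card free_edges + 1" by auto
qed

lemma matching_exists:
  assumes cycle_free
  shows "\<exists>m. matching m"
proof -
  let ?Z = "{lf e\<^sub>0, rt e\<^sub>0}"
  have "\<exists>e\<in>E - T. (lf e \<in> Y) \<noteq> (rt e \<in> Y)" if "?Z \<subseteq> Y" "Y \<subset> F" for Y
    using cotree_connected[OF assms, of Y] that by blast
  then obtain p where p: "inj_on p (F - ?Z)"
      "\<And>x. x \<in> F - ?Z \<Longrightarrow> p x \<in> E - T \<and> (lf (p x) = x \<or> rt (p x) = x)"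
    using attaching_edges[of F ?Z "E - T" lf rt] finite_F lf_in rt_in e\<^sub>0
    by (metis (no_types, lifting) DiffD1 insert_subset empty_subsetI)
  have sub: "p ` (F - ?Z) \<subseteq> free_edges"
    using p(2) by (force simp: free_edges_def)
  have "card (F - ?Z) = card F - 2"
    using finite_F lf_in rt_in e\<^sub>0 faces_ne by (subst card_Diff_subset) auto
  then have "card free_edges \<le> card (p ` (F - ?Z))"
    using card_cotree card_image[OF p(1)] by simp
  then have "p ` (F - ?Z) = free_edges"
    using sub finite_E by (intro card_seteq) (auto simp: free_edges_def)
  then have bij: "bij_betw p free_faces free_edges"
    using p(1) by (auto simp: bij_betw_def free_faces_def)
  define m where "m = the_inv_into free_faces p"
  have "bij_betw m free_edges free_faces"
    unfolding m_def by (rule bij_betw_the_inv_into[OF bij])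
  moreover have "m e = lf e \<or> m e = rt e" if "e \<in> free_edges" for e
  proof -
    have "m e \<in> free_faces" "p (m e) = e"
      using bij_betw_apply[OF calculation that] f_the_inv_into_f_bij_betw[OF bij] that by (auto simp: m_def)
    then show ?thesis using p(2)[of "m e"] by (auto simp: free_faces_def)
  qed
  ultimately show ?thesis unfolding matching_def by blast
qed

text \<open>
  Let \<open>Q\<close> be the set of edges matched differently. Both matchings send \<open>Q\<close> onto the same set \<open>Z\<close> of
  regions, which therefore contains both sides of every edge in \<open>Q\<close>. To attach the other regions to
  \<open>Z\<close> one needs as many edges outside \<open>T\<close> and \<open>Q\<close>, but there is one too few.
\<close>

lemma matching_unique:
  assumes cycle_free "matching m" "matching m'" "e \<in> free_edges"
  shows "m e = m' e"
proof (rule ccontr)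
  assume "m e \<noteq> m' e"
  define Q where "Q = {e \<in> free_edges. m e \<noteq> m' e}"
  define Z where "Z = m ` Q"
  have bij: "bij_betw m free_edges free_faces" "bij_betw m' free_edges free_faces"
    using assms by (auto simp: matching_def)
  have Q: "Q \<subseteq> free_edges" "Q \<subseteq> E - T" by (auto simp: Q_def free_edges_def)
  have "m' ` (free_edges - Q) = m ` (free_edges - Q)"
    by (rule image_cong) (auto simp: Q_def)
  moreover have "m ` (free_edges - Q) = free_faces - m ` Q" "m' ` (free_edges - Q) = free_faces - m' ` Q"
  proof -
    have "h ` (free_edges - Q) = free_faces - h ` Q" if "bij_betw h free_edges free_faces" for h
      using inj_on_image_set_diff[of h free_edges free_edges Q] that Q(1) by (simp add: bij_betw_def)
    then show "m ` (free_edges - Q) = free_faces - m ` Q" "m' ` (free_edges - Q) = free_faces - m' ` Q"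
      using bij by blast+
  qed
  moreover have sub: "m ` Q \<subseteq> free_faces" "m' ` Q \<subseteq> free_faces"
    using image_mono[OF Q(1), of m] image_mono[OF Q(1), of m'] bij by (simp_all add: bij_betw_def)
  ultimately have "free_faces - m' ` Q = free_faces - m ` Q" by simp
  then have "m' ` Q = Z" unfolding Z_def using sub by (intro subset_antisym; blast)
  have inside: "lf d \<in> Z \<and> rt d \<in> Z" if "d \<in> Q" for d
  proof -
    have "m d = lf d \<or> m d = rt d" "m' d = lf d \<or> m' d = rt d" "m d \<noteq> m' d"
      using assms that by (auto simp: matching_def Q_def)
    moreover have "m d \<in> Z" "m' d \<in> Z"
      using that \<open>m' ` Q = Z\<close> by (auto simp: Z_def)
    ultimately show ?thesis by auto
  qed
  have "finite Q" using finite_E finite_subset[OF Q(2)] by auto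
  have "Z \<subseteq> F" using sub by (auto simp: Z_def free_faces_def)
  have "Z \<noteq> {}" using assms(4) \<open>m e \<noteq> m' e\<close> by (auto simp: Z_def Q_def)
  have "\<exists>e\<in>E - T. (lf e \<in> Y) \<noteq> (rt e \<in> Y)" if "Z \<subseteq> Y" "Y \<subset> F" for Y
    using cotree_connected[OF assms(1), of Y] that \<open>Z \<noteq> {}\<close> by blast
  then obtain p where p: "inj_on p (F - Z)"
      "\<And>x. x \<in> F - Z \<Longrightarrow> p x \<in> E - T \<and> (lf (p x) = x \<or> rt (p x) = x)"
    using attaching_edges[of F Z "E - T" lf rt] finite_F lf_in rt_in \<open>Z \<subseteq> F\<close> by (metis (no_types, lifting) DiffD1)
  have "p ` (F - Z) \<subseteq> E - T - Q"
    using p(2) inside by fastforce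
  then have "card (F - Z) \<le> card (E - T - Q)"
    using card_inj_on_le[OF p(1)] finite_E by blast
  moreover have "card (E - T - Q) = card (E - T) - card Q" "card (F - Z) = card F - card Z"
    using Q \<open>finite Q\<close> \<open>Z \<subseteq> F\<close> finite_F by (auto intro!: card_Diff_subset finite_subset[OF \<open>Z \<subseteq> F\<close>])
  moreover have "card Z = card Q"
    unfolding Z_def using bij Q by (intro card_image) (auto simp: bij_betw_def intro: inj_on_subset)
  moreover have "card Z \<le> card F" "card Q \<le> card (E - T)"
    using \<open>Z \<subseteq> F\<close> finite_F Q finite_E by (auto intro!: card_mono)
  ultimately show False
    using card_cotree by linarith
qed

text \<open>
  The sign of a matched edge is the numbering of its two sides minus twice that of the chosen one,
  and the chosen regions run through \<open>free_faces\<close>.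
\<close>

lemma sum_corners:
  assumes "matching m"
  shows "(\<Sum>e\<in>free_edges. if m e = lf e then - 1 else 1) =
    (\<Sum>e\<in>E - {e\<^sub>0}. numbering (lf e) + numbering (rt e)) - 2 * (\<Sum>f\<in>free_faces. numbering f)
    - (\<Sum>e\<in>T. 2 * numbering (lf e) - 1)"
proof -
  have "(if m e = lf e then - 1 else 1) = numbering (lf e) + numbering (rt e) - 2 * numbering (m e)"
    if "e \<in> free_edges" for e
  proof -
    have "m e = lf e \<or> m e = rt e" using assms that by (auto simp: matching_def)
    moreover have "numbering (lf e) = numbering (rt e) + 1"
      using that by (intro numbering) (auto simp: free_edges_def)
    ultimately show ?thesis by auto
  qed
  then have "(\<Sum>e\<in>free_edges. if m e = lf e then - 1 else 1) =
      (\<Sum>e\<in>free_edges. numbering (lf e) + numbering (rt e)) - 2 * (\<Sum>e\<in>free_edges. numbering (m e))"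
    by (simp add: sum_subtractf sum_distrib_left)
  also have "(\<Sum>e\<in>free_edges. numbering (m e)) = (\<Sum>f\<in>free_faces. numbering f)"
    using assms by (intro sum.reindex_bij_betw) (auto simp: matching_def)
  also have "(\<Sum>e\<in>free_edges. numbering (lf e) + numbering (rt e)) =
      (\<Sum>e\<in>E - {e\<^sub>0}. numbering (lf e) + numbering (rt e)) - (\<Sum>e\<in>T. numbering (lf e) + numbering (rt e))"
  proof -
    have "free_edges = E - {e\<^sub>0} - T" by (auto simp: free_edges_def)
    then show ?thesis using sum_diff[of "E - {e\<^sub>0}" T] T finite_E by auto
  qed
  also have "(\<Sum>e\<in>T. numbering (lf e) + numbering (rt e)) = (\<Sum>e\<in>T. 2 * numbering (lf e) - 1)"
    using T numbering by (intro sum.cong) auto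
  finally show ?thesis by simp
qed

text \<open>
  Let \<open>C\<close> be a minimal cycle and \<open>J\<close> its potential, normalised to vanish beside \<open>e\<^sub>0\<close>. The region set
  \<open>Fin\<close>, the edge set \<open>Ein\<close> and the vertex set \<open>Vin\<close> are the parts of the map strictly on the side of
  \<open>C\<close> away from \<open>e\<^sub>0\<close>. A matching takes an edge of \<open>Ein\<close> outside \<open>T\<close> for every region of \<open>Fin\<close>, and \<open>T\<close>
  takes one for every vertex of \<open>Vin\<close>, so \<open>|Fin| + |Vin| \<le> |Ein|\<close>. But then there is a nonzero flow \<open>g\<close>
  supported on \<open>Ein \<union> C\<close> whose potential vanishes on \<open>Fin\<close>. It vanishes on \<open>Ein\<close>, whose edges have both
  sides in \<open>Fin\<close>; so it is a multiple of the flow along \<open>C\<close>, its potential is the same multiple of \<open>J\<close>,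
  and \<open>J\<close> is nonzero on \<open>Fin\<close>, which is not empty; so \<open>g\<close> is zero after all.
\<close>

lemma no_matching:
  assumes "\<not> cycle_free" "matching m"
  shows False
proof -
  have "\<exists>C. C \<subseteq> T \<and> C \<noteq> {} \<and> src ` C = tgt ` C"
    using assms(1) by (simp add: cycle_free_def)
  then obtain C where C: "C \<subseteq> T" "C \<noteq> {}" "src ` C = tgt ` C"
    and minimal: "\<And>C'. C' \<subseteq> T \<Longrightarrow> C' \<noteq> {} \<Longrightarrow> src ` C' = tgt ` C' \<Longrightarrow> card C \<le> card C'"
    using ex_has_least_nat[of "\<lambda>C. C \<subseteq> T \<and> C \<noteq> {} \<and> src ` C = tgt ` C" _ card] by metis
  have "finite C" using C(1) finite_T by (rule finite_subset)
  have CE: "C \<subseteq> E" "e\<^sub>0 \<notin> C" using C(1) T by auto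
  have inj: "inj_on tgt C" "inj_on src C"
  proof -
    show "inj_on tgt C" using inj_tgt C(1) by (rule inj_on_subset)
    then show "inj_on src C"
      using C(3) \<open>finite C\<close> by (intro eq_card_imp_inj_on) (simp_all add: card_image)
  qed
  \<comment> \<open>\<open>C\<close> has one edge into and one edge out of each of its vertices\<close>
  have at_vertex: "(\<Sum>e | e \<in> E \<and> tgt e = tgt d. g e) = g d" "(\<Sum>e | e \<in> E \<and> src e = src d. g e) = g d"
    if "d \<in> C" "\<And>e. e \<in> E - C \<Longrightarrow> g e = 0" for g :: "'b \<Rightarrow> real" and d
  proof -
    have "g e = 0" if "e \<in> E" "tgt e = tgt d" "e \<noteq> d" for e
      using that \<open>d \<in> C\<close> \<open>e \<in> E - C \<Longrightarrow> g e = 0\<close> inj_onD[OF inj(1), of e d] by blast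
    then show "(\<Sum>e | e \<in> E \<and> tgt e = tgt d. g e) = g d"
      using that CE finite_E by (subst sum.remove[of _ d]) (auto intro!: sum.neutral)
    have "g e = 0" if "e \<in> E" "src e = src d" "e \<noteq> d" for e
      using that \<open>d \<in> C\<close> \<open>e \<in> E - C \<Longrightarrow> g e = 0\<close> inj_onD[OF inj(2), of e d] by blast
    then show "(\<Sum>e | e \<in> E \<and> src e = src d. g e) = g d"
      using that CE finite_E by (subst sum.remove[of _ d]) (auto intro!: sum.neutral)
  qed
  define VC where "VC = tgt ` C"
  have VC: "VC \<subseteq> V" "card VC = card C" "VC = src ` C"
    using CE tgt_in C(3) card_image[OF inj(1)] by (auto simp: VC_def)
  have excess_C: "excess g v = g d - g d'"
    if "d \<in> C" "d' \<in> C" "tgt d = v" "src d' = v" "\<And>e. e \<in> E - C \<Longrightarrow> g e = 0" for g v d d'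
    using at_vertex(1)[of d g] at_vertex(2)[of d' g] that by (simp add: excess_def)
  have excess_off: "excess g v = 0"
    if "\<And>e. e \<in> E \<Longrightarrow> tgt e = v \<or> src e = v \<Longrightarrow> g e = 0" for g v
    using that by (simp add: excess_def)
  define one :: "'b \<Rightarrow> real" where "one e = of_bool (e \<in> C)" for e
  have flow_C: "excess one v = 0" for v
  proof (cases "v \<in> VC")
    case True
    then obtain d d' where "d \<in> C" "d' \<in> C" "tgt d = v" "src d' = v"
      using VC(3) unfolding VC_def by (metis imageE)
    then show ?thesis using excess_C[of d d' v one] by (auto simp: one_def)
  next
    case False
    then show ?thesis
      using VC(3) by (intro excess_off) (auto simp: one_def VC_def)
  qed
  define J where "J f = potential one f - potential one (lf e\<^sub>0)" for f
  have J: "J (lf e) - J (rt e) = of_bool (e \<in> C)" if "e \<in> E" for e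
    using potential_diff[OF flow_C that] by (simp add: J_def one_def)
  have J0: "J (lf e\<^sub>0) = 0" "J (rt e\<^sub>0) = 0"
    using J[OF e\<^sub>0] CE by (auto simp: J_def)
  define Ein where "Ein = {e \<in> E - C. J (lf e) \<noteq> 0}"
  define Vin where "Vin = {v \<in> V - VC. \<exists>e\<in>Ein. tgt e = v \<or> src e = v}"
  define Fin where "Fin = {f \<in> F. J f \<noteq> 0}"
  have fin: "finite Ein" "finite Vin" "finite Fin" "finite VC"
    using finite_E finite_V finite_F \<open>finite C\<close> by (auto simp: Ein_def Vin_def Fin_def VC_def)
  have inside: "e \<in> Ein" if "v \<in> Vin" "e \<in> E" "tgt e = v \<or> src e = v" for e v
  proof -
    have off: "d \<notin> C" if "tgt d = v \<or> src d = v" for d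
      using that \<open>v \<in> Vin\<close> VC(3) by (auto simp: Vin_def VC_def)
    obtain d where d: "d \<in> Ein" "tgt d = v \<or> src d = v" using \<open>v \<in> Vin\<close> by (auto simp: Vin_def)
    have "J (lf d') = J (rt d')" if "d' \<in> E" "tgt d' = v \<or> src d' = v" for d'
      using J[OF that(1)] off[OF that(2)] by simp
    then have "J (lf e) = J (lf d)"
      using constant_around[of v J e d] that d by (auto simp: Vin_def Ein_def)
    then show ?thesis using d that off by (auto simp: Ein_def)
  qed
  have "Fin \<subseteq> m ` (free_edges \<inter> Ein)"
  proof
    fix f assume "f \<in> Fin"
    then have f: "f \<in> F" "J f \<noteq> 0" "f \<in> free_faces" using J0 by (auto simp: Fin_def free_faces_def)
    then obtain e where e: "e \<in> free_edges" "f = m e"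
      using assms(2) by (auto simp: matching_def bij_betw_def)
    then have "e \<in> E - C" "f = lf e \<or> f = rt e"
      using assms(2) C(1) by (auto simp: matching_def free_edges_def)
    then have "e \<in> Ein" using J[of e] f by (auto simp: Ein_def)
    with e show "f \<in> m ` (free_edges \<inter> Ein)" by auto
  qed
  then have "card Fin \<le> card (free_edges \<inter> Ein)"
    using fin by (meson card_image_le card_mono finite_Int finite_imageI order_trans)
  moreover have "Vin \<subseteq> tgt ` (T \<inter> Ein)"
  proof
    fix v assume v: "v \<in> Vin"
    have "v \<noteq> tgt e\<^sub>0" using inside[OF v e\<^sub>0] J0 by (auto simp: Ein_def)
    then obtain e where "e \<in> T" "tgt e = v" using one_in[of v] v by (auto simp: Vin_def)
    then show "v \<in> tgt ` (T \<inter> Ein)" using inside[OF v, of e] T by auto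
  qed
  then have "card Vin \<le> card (T \<inter> Ein)"
    using fin by (meson card_image_le card_mono finite_Int finite_imageI order_trans)
  moreover have "card (free_edges \<inter> Ein) + card (T \<inter> Ein) \<le> card Ein"
    using fin by (subst card_Un_disjoint [symmetric]) (auto intro!: card_mono simp: free_edges_def)
  ultimately have counts: "card Fin + card Vin \<le> card Ein" by linarith
  \<comment> \<open>the vertex equation at \<open>v\<^sub>0\<close> follows from the others, which saves one equation\<close>
  obtain d\<^sub>0 where d\<^sub>0: "d\<^sub>0 \<in> C" using C(2) by auto
  define v\<^sub>0 where "v\<^sub>0 = tgt d\<^sub>0"
  have v\<^sub>0: "v\<^sub>0 \<in> VC" "v\<^sub>0 \<in> V" using d\<^sub>0 CE tgt_in by (auto simp: v\<^sub>0_def VC_def)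
  define Q where "Q = (Vin \<union> (VC - {v\<^sub>0})) <+> Fin"
  define A where "A = (\<lambda>q d. case q of Inl v \<Rightarrow> of_bool (tgt d = v) - of_bool (src d = v) | Inr f \<Rightarrow> pot d f - pot d (lf e\<^sub>0))"
  have "card (Vin \<union> (VC - {v\<^sub>0})) = card Vin + (card C - 1)"
    using fin v\<^sub>0 VC by (subst card_Un_disjoint) (auto simp: Vin_def)
  then have "card Q = card Vin + (card C - 1) + card Fin"
    using fin by (simp add: Q_def card_Plus)
  moreover have "card (Ein \<union> C) = card Ein + card C"
    using fin \<open>finite C\<close> by (intro card_Un_disjoint) (auto simp: Ein_def)
  moreover have "0 < card C" using C(2) \<open>finite C\<close> by (auto simp: card_gt_0_iff)
  ultimately have "card Q < card (Ein \<union> C)" using counts by linarith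
  moreover have "finite Q" using fin by (auto simp: Q_def)
  ultimately obtain g where g: "\<exists>e\<in>Ein \<union> C. g e \<noteq> 0" "\<And>e. e \<notin> Ein \<union> C \<Longrightarrow> g e = 0"
      and eqs: "\<And>q. q \<in> Q \<Longrightarrow> (\<Sum>e\<in>Ein \<union> C. A q e * g e) = 0"
    using underdetermined_system[of Q "Ein \<union> C" A] fin \<open>finite C\<close> by blast
  have sub: "Ein \<union> C \<subseteq> E" using CE by (auto simp: Ein_def)
  have eqs': "(\<Sum>e\<in>E. A q e * g e) = 0" if "q \<in> Q" for q
    using sum.mono_neutral_left[OF finite_E sub, of "\<lambda>e. A q e * g e"] eqs[OF that] g(2) by simp
  have "excess g v = 0" if "v \<in> V - {v\<^sub>0}" for v
  proof (cases "v \<in> Vin \<union> VC")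
    case True
    then have "Inl v \<in> Q" using that by (auto simp: Q_def)
    from eqs'[OF this] show ?thesis by (simp add: A_def excess_eq)
  next
    case False
    then have "g e = 0" if "e \<in> E" "tgt e = v \<or> src e = v" for e
      using that \<open>v \<in> V - {v\<^sub>0}\<close> VC(3) by (intro g(2)) (auto simp: Vin_def VC_def)
    then show ?thesis by (rule excess_off)
  qed
  then have flow: "excess g v = 0" if "v \<in> V" for v
    using excess_all_but_one[OF v\<^sub>0(2)] that by blast
  have pot_Fin: "potential g f = potential g (lf e\<^sub>0)" if "f \<in> Fin" for f
  proof -
    have "Inr f \<in> Q" using that by (auto simp: Q_def)
    from eqs'[OF this] show ?thesis by (simp add: A_def potential_def algebra_simps sum_subtractf)
  qed
  have g_off: "g e = 0" if "e \<in> E - C" for e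
  proof (cases "e \<in> Ein")
    case True
    then have "lf e \<in> Fin" "rt e \<in> Fin"
      using J[of e] lf_in rt_in by (auto simp: Ein_def Fin_def)
    then show ?thesis using potential_diff[OF flow, of e] pot_Fin that by simp
  qed (use g(2) that in auto)
  \<comment> \<open>the edges of \<open>C\<close> with a common value of \<open>g\<close> again form a cycle, so minimality makes \<open>g\<close> constant\<close>
  define Y where "Y = {e \<in> C. g e = g d\<^sub>0}"
  have same: "g d = g d'" if "d \<in> C" "d' \<in> C" "tgt d = src d'" for d d'
  proof -
    have "excess g (tgt d) = g d - g d'"
      using that g_off by (intro excess_C) simp_all
    moreover have "tgt d \<in> V" using that CE tgt_in by blast
    ultimately show ?thesis using flow by simp
  qed
  have "src ` Y = tgt ` Y"
  proof (intro equalityI subsetI)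
    fix v assume "v \<in> src ` Y"
    then obtain d' where d': "d' \<in> Y" "v = src d'" by auto
    then obtain d where "d \<in> C" "tgt d = v" using C(3) unfolding Y_def by (metis (no_types, lifting) imageE imageI mem_Collect_eq)
    then have "d \<in> Y" using same[of d d'] d' by (auto simp: Y_def)
    then show "v \<in> tgt ` Y" using \<open>tgt d = v\<close> by blast
  next
    fix v assume "v \<in> tgt ` Y"
    then obtain d' where d': "d' \<in> Y" "v = tgt d'" by auto
    then obtain d where "d \<in> C" "src d = v" using C(3) unfolding Y_def by (metis (no_types, lifting) imageE imageI mem_Collect_eq)
    then have "d \<in> Y" using same[of d' d] d' by (auto simp: Y_def)
    then show "v \<in> src ` Y" using \<open>src d = v\<close> by blast
  qed
  moreover have "Y \<subseteq> C" "Y \<noteq> {}" using d\<^sub>0 by (auto simp: Y_def)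
  ultimately have "Y = C"
    using minimal[of Y] C(1) \<open>finite C\<close> by (metis card_seteq order_trans)
  then have g_eq: "g e = g d\<^sub>0 * one e" if "e \<in> E" for e
    using g_off[of e] that by (cases "e \<in> C") (auto simp: Y_def one_def)
  have pot_g: "potential g f = g d\<^sub>0 * potential one f" for f
    unfolding potential_def sum_distrib_left by (rule sum.cong) (simp_all add: g_eq)
  have "d\<^sub>0 \<in> E" using d\<^sub>0 CE by auto
  then have "lf d\<^sub>0 \<in> Fin \<or> rt d\<^sub>0 \<in> Fin"
    using J[of d\<^sub>0] d\<^sub>0 lf_in[of d\<^sub>0] rt_in[of d\<^sub>0] by (auto simp: Fin_def)
  then obtain f where f: "f \<in> Fin" "J f \<noteq> 0" by (auto simp: Fin_def)
  then have "g d\<^sub>0 * J f = 0"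
    using pot_Fin[OF f(1)] by (simp add: pot_g J_def algebra_simps)
  with f have "g d\<^sub>0 = 0" by simp
  then show False
    using g(1) g_eq sub by auto
qed

end

section \<open>The circle around a vertex\<close>

context plane_graph
begin

abbreviation disk :: "complex \<Rightarrow> complex set" where
  "disk v \<equiv> ball v (\<rho> v)"

abbreviation circle :: "complex \<Rightarrow> complex set" where
  "circle v \<equiv> sphere v (\<rho> v)"

text \<open>
  The definite descriptions in \<open>cr\<close> and \<open>exit_point\<close> pick the two times at which the edge crosses
  the circles.
\<close>

lemma crossing_times:
  assumes "e \<in> arcs G"
  obtains a b where "0 < a" "a < b" "b < 1"
    and "exit_point e = \<gamma> e a" "cr e = \<gamma> e b"
    and "\<gamma> e a \<in> circle (tail G e)" "\<gamma> e b \<in> circle (head G e)"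
    and "\<And>s. s \<in> {0..<a} \<Longrightarrow> \<gamma> e s \<in> disk (tail G e)"
    and "\<And>s. s \<in> {b<..1} \<Longrightarrow> \<gamma> e s \<in> disk (head G e)"
    and "\<And>s v. s \<in> {a<..<b} \<Longrightarrow> v \<in> verts G \<Longrightarrow> \<gamma> e s \<notin> cball v (\<rho> v)"
proof -
  obtain a b where ab: "0 < a" "a < b" "b < 1"
      "\<And>s. s \<in> {0..<a} \<Longrightarrow> \<gamma> e s \<in> disk (tail G e)"
      "\<gamma> e a \<in> circle (tail G e)"
      "\<And>s v. s \<in> {a<..<b} \<Longrightarrow> v \<in> verts G \<Longrightarrow> \<gamma> e s \<notin> cball v (\<rho> v)"
      "\<gamma> e b \<in> circle (head G e)"
      "\<And>s. s \<in> {b<..1} \<Longrightarrow> \<gamma> e s \<in> disk (head G e)"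
    using circle_crossings [OF assms] by metis
  have "exit_point e = \<gamma> e a"
  proof -
    have "(THE a. 0 < a \<and> a < 1 \<and> \<gamma> e a \<in> circle (tail G e) \<and>
        (\<forall>s\<in>{0..<a}. \<gamma> e s \<in> disk (tail G e))) = a"
    proof (rule the_equality)
      fix a' assume a': "0 < a' \<and> a' < 1 \<and> \<gamma> e a' \<in> circle (tail G e) \<and>
        (\<forall>s\<in>{0..<a'}. \<gamma> e s \<in> disk (tail G e))"
      show "a' = a"
      proof (rule linorder_cases[of a' a])
        assume "a' < a"
        with ab(4)[of a'] a' show ?thesis by auto
      next
        assume "a < a'"
        then have "\<gamma> e a \<in> disk (tail G e)" using a' ab(1) by simp
        with ab(5) show ?thesis by auto
      qed
    qed (use ab in auto)
    then show ?thesis by (simp add: exit_point_def)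
  qed
  moreover have "cr e = \<gamma> e b"
  proof -
    have "(THE b. 0 < b \<and> b < 1 \<and> \<gamma> e b \<in> circle (head G e) \<and>
        (\<forall>s\<in>{b<..1}. \<gamma> e s \<in> disk (head G e))) = b"
    proof (rule the_equality)
      fix b' assume b': "0 < b' \<and> b' < 1 \<and> \<gamma> e b' \<in> circle (head G e) \<and>
        (\<forall>s\<in>{b'<..1}. \<gamma> e s \<in> disk (head G e))"
      show "b' = b"
      proof (rule linorder_cases[of b' b])
        assume "b < b'"
        with ab(8)[of b'] b' show ?thesis by auto
      next
        assume "b' < b"
        then have "\<gamma> e b \<in> disk (head G e)" using b' ab(3) by simp
        with ab(7) show ?thesis by auto
      qed
    qed (use ab in auto)
    then show ?thesis by (simp add: cr_def)
  qed
  ultimately show ?thesis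
    using ab that by blast
qed

lemma in_two_disks:
  assumes "u \<in> verts G" "v \<in> verts G" "x \<in> cball u (\<rho> u)" "x \<in> cball v (\<rho> v)"
  shows "u = v"
  using disjoint_disks assms by (auto simp: pairwise_def disjnt_iff)

lemma path_edge: "e \<in> arcs G \<Longrightarrow> path (\<gamma> e)"
  using simple simple_path_imp_path by blast

lemma edge_ends_eq: "e \<in> arcs G \<Longrightarrow> \<gamma> e 0 = tail G e" "e \<in> arcs G \<Longrightarrow> \<gamma> e 1 = head G e"
  using start finish by (auto simp: pathstart_def pathfinish_def)

lemma path_image_edge:
  assumes "e \<in> arcs G"
  shows "path_image (\<gamma> e) = edge_interior e \<union> {tail G e, head G e}"
proof -
  have "{0..1::real} = {0<..<1} \<union> {0, 1}" by auto
  then have "path_image (\<gamma> e) = \<gamma> e ` {0<..<1} \<union> \<gamma> e ` {0, 1}"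
    unfolding path_image_def by (metis image_Un)
  then show ?thesis using edge_ends_eq[OF assms] by (auto simp: edge_interior_def)
qed

lemma compact_support: "compact support"
  unfolding support_def
  by (intro compact_Un compact_UN finite_imp_compact finite_verts finite_arcs compact_path_image path_edge)

lemma closed_support: "closed support"
  using compact_support by (rule compact_imp_closed)

lemma regular_region:
  assumes "R \<in> regular_regions"
  shows "open R" "connected R" "R \<noteq> {}" "R \<inter> support = {}"
proof -
  have R: "R \<in> components (- support)" using assms by (simp add: regular_regions_def)
  show "open R" using open_components[OF open_Compl[OF closed_support] R] .
  show "connected R" by (rule in_components_connected[OF R])
  show "R \<noteq> {}" by (rule in_components_nonempty[OF R])
  show "R \<inter> support = {}" using in_components_subset[OF R] by blast
qed

lemma regions_disjoint:
  assumes "R \<in> regular_regions" "R' \<in> regular_regions" "x \<in> R" "x \<in> R'"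
  shows "R = R'"
  using components_nonoverlap[of R "- support" R'] assms by (auto simp: regular_regions_def)

lemma region_superset:
  assumes "connected S" "S \<noteq> {}" "S \<inter> support = {}"
  obtains R where "R \<in> regular_regions" "S \<subseteq> R"
proof -
  have "S \<subseteq> - support" using assms(3) by blast
  then show ?thesis
    using exists_component_superset[of S "- support"] assms that by (auto simp: regular_regions_def)
qed

lemma end_point_sphere:
  assumes "p \<in> edge_ends v"
  shows "end_point p \<in> circle v" "v \<in> verts G" "end_point p \<in> support"
proof -
  have "end_point p \<in> circle v \<and> v \<in> verts G \<and> end_point p \<in> support"
  proof (cases p)
    case (Incoming e)
    then have e: "e \<in> arcs G" "head G e = v" using assms by (auto simp: edge_ends_def)
    obtain a b where "0 < a" "a < b" "b < 1" "cr e = \<gamma> e b" "\<gamma> e b \<in> circle (head G e)"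
      using crossing_times[OF e(1)] by metis
    moreover from this have "\<gamma> e b \<in> path_image (\<gamma> e)" by (simp add: path_image_def)
    ultimately show ?thesis using e Incoming by (auto simp: support_def)
  next
    case (Outgoing e)
    then have e: "e \<in> arcs G" "tail G e = v" using assms by (auto simp: edge_ends_def)
    obtain a b where "0 < a" "a < b" "b < 1" "exit_point e = \<gamma> e a" "\<gamma> e a \<in> circle (tail G e)"
      using crossing_times[OF e(1)] by metis
    moreover from this have "\<gamma> e a \<in> path_image (\<gamma> e)" by (simp add: path_image_def)
    ultimately show ?thesis using e Outgoing by (auto simp: support_def)
  qed
  then show "end_point p \<in> circle v" "v \<in> verts G" "end_point p \<in> support" by blast+
qed

lemma finite_edge_ends: "finite (edge_ends v)"
  by (auto simp: edge_ends_def)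

lemma support_on_circle:
  assumes v: "v \<in> verts G"
  shows "support \<inter> circle v = end_point ` edge_ends v"
proof (intro equalityI subsetI)
  fix x assume x: "x \<in> support \<inter> circle v"
  have "x \<notin> verts G"
  proof
    assume "x \<in> verts G"
    then have "x = v"
      using in_two_disks[of x v x] radius_pos[of x] v x by auto
    then show False using x radius_pos[OF v] by auto
  qed
  then obtain e s where es: "e \<in> arcs G" "s \<in> {0..1}" "x = \<gamma> e s"
    using x by (auto simp: support_def path_image_def)
  then obtain a b where ab: "0 < a" "a < b" "b < 1"
    and cr: "exit_point e = \<gamma> e a" "cr e = \<gamma> e b"
    and on: "\<gamma> e a \<in> circle (tail G e)" "\<gamma> e b \<in> circle (head G e)"
    and tail: "\<And>s. s \<in> {0..<a} \<Longrightarrow> \<gamma> e s \<in> disk (tail G e)"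
    and head: "\<And>s. s \<in> {b<..1} \<Longrightarrow> \<gamma> e s \<in> disk (head G e)"
    and mid: "\<And>s v. s \<in> {a<..<b} \<Longrightarrow> v \<in> verts G \<Longrightarrow> \<gamma> e s \<notin> cball v (\<rho> v)"
    using crossing_times[OF es(1)] by blast
  have xv: "x \<in> cball v (\<rho> v)" "x \<notin> disk v" using x by auto
  consider "s < a" | "s = a" | "a < s" "s < b" | "s = b" | "b < s" by linarith
  then show "x \<in> end_point ` edge_ends v"
  proof cases
    case 1
    then have "x \<in> disk (tail G e)" using tail[of s] es by auto
    then show ?thesis using in_two_disks[of "tail G e" v x] es v xv by auto
  next
    case 2
    then have "tail G e = v" using in_two_disks[of "tail G e" v x] es v xv on by auto
    then have "Outgoing e \<in> edge_ends v" using es by (auto simp: edge_ends_def)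
    then show ?thesis using 2 es cr by (intro image_eqI[of _ _ "Outgoing e"]) auto
  next
    case 3
    then show ?thesis using mid[of s v] v es xv by auto
  next
    case 4
    then have "head G e = v" using in_two_disks[of "head G e" v x] es v xv on by auto
    then have "Incoming e \<in> edge_ends v" using es by (auto simp: edge_ends_def)
    then show ?thesis using 4 es cr by (intro image_eqI[of _ _ "Incoming e"]) auto
  next
    case 5
    then have "x \<in> disk (head G e)" using head[of s] es by auto
    then show ?thesis using in_two_disks[of "head G e" v x] es v xv by auto
  qed
next
  fix x assume "x \<in> end_point ` edge_ends v"
  then show "x \<in> support \<inter> circle v" using end_point_sphere by blast
qed

lemma end_point_interior:
  assumes "p \<in> edge_ends v"
  obtains e s where "e \<in> arcs G" "p = Incoming e \<or> p = Outgoing e" "0 < s" "s < 1" "end_point p = \<gamma> e s"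
proof (cases p)
  case (Incoming e)
  then have e: "e \<in> arcs G" using assms by (auto simp: edge_ends_def)
  obtain a b where "0 < a" "a < b" "b < 1" "cr e = \<gamma> e b" using crossing_times[OF e] by metis
  then show ?thesis using e Incoming by (intro that[of e b]) auto
next
  case (Outgoing e)
  then have e: "e \<in> arcs G" using assms by (auto simp: edge_ends_def)
  obtain a b where "0 < a" "a < b" "b < 1" "exit_point e = \<gamma> e a" using crossing_times[OF e] by metis
  then show ?thesis using e Outgoing by (intro that[of e a]) auto
qed

lemma inj_on_end_point: "inj_on end_point (edge_ends v)"
proof (rule inj_onI)
  fix p q assume pq: "p \<in> edge_ends v" "q \<in> edge_ends v" "end_point p = end_point q"
  obtain e s where e: "e \<in> arcs G" "p = Incoming e \<or> p = Outgoing e" "0 < s" "s < 1" "end_point p = \<gamma> e s"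
    using end_point_interior[OF pq(1)] .
  obtain f t where f: "f \<in> arcs G" "q = Incoming f \<or> q = Outgoing f" "0 < t" "t < 1" "end_point q = \<gamma> f t"
    using end_point_interior[OF pq(2)] .
  have "e = f"
  proof (rule ccontr)
    assume "e \<noteq> f"
    moreover have "\<gamma> e s \<in> edge_interior e" "\<gamma> e s \<in> edge_interior f"
      using e(3,4) f(3,4) e(5) f(5) pq(3) unfolding edge_interior_def
      by (metis greaterThanLessThan_iff imageI)+
    ultimately show False using disjoint_edges[OF e(1) f(1)] by blast
  qed
  moreover have "exit_point e \<noteq> cr e"
  proof -
    obtain a b where ab: "0 < a" "a < b" "b < 1" "exit_point e = \<gamma> e a" "cr e = \<gamma> e b"
      using crossing_times[OF e(1)] by metis
    have "loop_free (\<gamma> e)" using simple[OF e(1)] by (simp add: simple_path_def)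
    moreover have "a \<in> {0..1}" "b \<in> {0..1}" using ab by auto
    ultimately have "\<gamma> e a = \<gamma> e b \<longrightarrow> a = b \<or> a = 0 \<and> b = 1 \<or> a = 1 \<and> b = 0"
      unfolding loop_free_def by blast
    then show ?thesis using ab by auto
  qed
  ultimately show "p = q"
    using e(2) f(2) pq(3) by auto
qed

text \<open>
  The region met next to the point \<open>q\<close> on the circle around \<open>v\<close>, going counter-clockwise for
  \<open>\<sigma> = 1\<close> and clockwise for \<open>\<sigma> = - 1\<close>. At the end of an incoming edge these are its east and its west
  region, respectively.
\<close>

definition side_of :: "real \<Rightarrow> complex \<Rightarrow> complex \<Rightarrow> complex set" where
  "side_of \<sigma> v q = (THE R. R \<in> regular_regions \<and> (\<forall>\<^sub>F \<eta> in at_right 0. v + cis (\<sigma> * \<eta>) * (q - v) \<in> R))"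

abbreviation "ccw_side \<equiv> side_of 1"
abbreviation "cw_side \<equiv> side_of (- 1)"

lemma west_region_side: "west_region e = cw_side (head G e) (cr e)"
  and east_region_side: "east_region e = ccw_side (head G e) (cr e)"
  by (simp_all add: west_region_def east_region_def side_of_def)

lemma side_ofI:
  assumes R: "R \<in> regular_regions" "\<forall>\<^sub>F \<eta> in at_right 0. v + cis (\<sigma> * \<eta>) * (q - v) \<in> R"
  shows "side_of \<sigma> v q = R"
  unfolding side_of_def
proof (rule the_equality)
  fix R' assume R': "R' \<in> regular_regions \<and> (\<forall>\<^sub>F \<eta> in at_right 0. v + cis (\<sigma> * \<eta>) * (q - v) \<in> R')"
  then have "\<forall>\<^sub>F \<eta> in at_right 0. v + cis (\<sigma> * \<eta>) * (q - v) \<in> R \<and> v + cis (\<sigma> * \<eta>) * (q - v) \<in> R'"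
    using R by (auto intro: eventually_conj)
  then obtain \<eta> where "v + cis (\<sigma> * \<eta>) * (q - v) \<in> R" "v + cis (\<sigma> * \<eta>) * (q - v) \<in> R'"
    using eventually_happens'[OF trivial_limit_at_right_real[of 0]] by blast
  then show "R' = R" using regions_disjoint R R' by metis
qed (use R in blast)

lemma arc_in_region:
  assumes "0 < \<eta>\<^sub>0" "\<And>\<eta>. 0 < \<eta> \<Longrightarrow> \<eta> < \<eta>\<^sub>0 \<Longrightarrow> v + cis (\<sigma> * \<eta>) * c \<notin> support"
  obtains R where "R \<in> regular_regions" "\<And>\<eta>. 0 < \<eta> \<Longrightarrow> \<eta> < \<eta>\<^sub>0 \<Longrightarrow> v + cis (\<sigma> * \<eta>) * c \<in> R"
proof -
  let ?f = "\<lambda>\<eta>. v + cis (\<sigma> * \<eta>) * c"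
  have "connected (?f ` {0<..<\<eta>\<^sub>0})"
    by (intro connected_continuous_image continuous_intros) auto
  moreover have "?f ` {0<..<\<eta>\<^sub>0} \<noteq> {}" using assms(1) by auto
  moreover have "?f ` {0<..<\<eta>\<^sub>0} \<inter> support = {}" using assms(2) by auto
  ultimately obtain R where "R \<in> regular_regions" "?f ` {0<..<\<eta>\<^sub>0} \<subseteq> R"
    using region_superset by blast
  then show ?thesis using that[of R] by (auto simp: image_subset_iff)
qed

text \<open>
  The graph meets the circle only in the finitely many points \<open>end_point p\<close>.
\<close>

lemma eventually_off_support:
  assumes "p \<in> edge_ends v" "\<sigma> = 1 \<or> \<sigma> = - 1"
  shows "\<forall>\<^sub>F \<eta> in at_right 0. v + cis (\<sigma> * \<eta>) * (end_point p - v) \<notin> support"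
proof -
  let ?q = "end_point p"
  let ?f = "\<lambda>\<eta>. v + cis (\<sigma> * \<eta>) * (?q - v)"
  have q: "?q \<in> circle v" "v \<in> verts G" using end_point_sphere[OF assms(1)] by auto
  have "?q \<noteq> v" using q radius_pos[OF q(2)] by auto
  have lim: "(?f \<longlongrightarrow> ?q) (at_right 0)"
    by (rule tendsto_eq_intros | simp)+
  have "\<forall>\<^sub>F \<eta> in at_right 0. ?f \<eta> \<noteq> x" for x
  proof (cases "x = ?q")
    case False
    then show ?thesis using lim tendsto_imp_eventually_ne by metis
  next
    case True
    have "\<forall>\<^sub>F \<eta> in at_right 0. \<eta> \<in> {0<..<pi}"
      by (rule eventually_at_right_real[OF pi_gt_zero])
    then show ?thesis
    proof eventually_elim
      case (elim \<eta>)
      then have "sin \<eta> \<noteq> 0" using sin_gt_zero[of \<eta>] by auto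
      then have "cis (\<sigma> * \<eta>) \<noteq> 1" using assms(2) by (auto simp: complex_eq_iff)
      then have "cis (\<sigma> * \<eta>) * (?q - v) \<noteq> 1 * (?q - v)"
        unfolding mult_right_cancel[of "?q - v"] using \<open>?q \<noteq> v\<close> by simp
      then show ?case unfolding True by (metis add_diff_cancel_left' mult_1)
    qed
  qed
  then have "\<forall>\<^sub>F \<eta> in at_right 0. \<forall>x\<in>end_point ` edge_ends v. ?f \<eta> \<noteq> x"
    using finite_edge_ends by (intro eventually_ball_finite) auto
  then show ?thesis
  proof eventually_elim
    case (elim \<eta>)
    have "?f \<eta> \<in> circle v" using q(1) by (auto simp: dist_norm norm_mult norm_minus_commute)
    then show ?case using elim support_on_circle[OF q(2)] by blast
  qed
qed

lemma side_of_end: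
  assumes "p \<in> edge_ends v" "\<sigma> = 1 \<or> \<sigma> = - 1"
  shows "side_of \<sigma> v (end_point p) \<in> regular_regions"
    and "\<forall>\<^sub>F \<eta> in at_right 0. v + cis (\<sigma> * \<eta>) * (end_point p - v) \<in> side_of \<sigma> v (end_point p)"
proof -
  obtain \<eta>\<^sub>0 where "0 < \<eta>\<^sub>0" "\<And>\<eta>. 0 < \<eta> \<Longrightarrow> \<eta> < \<eta>\<^sub>0 \<Longrightarrow> v + cis (\<sigma> * \<eta>) * (end_point p - v) \<notin> support"
    using eventually_off_support[OF assms] by (auto simp: eventually_at_right_field)
  then obtain R where R: "R \<in> regular_regions"
      "\<And>\<eta>. 0 < \<eta> \<Longrightarrow> \<eta> < \<eta>\<^sub>0 \<Longrightarrow> v + cis (\<sigma> * \<eta>) * (end_point p - v) \<in> R"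
    using arc_in_region by metis
  have ev: "\<forall>\<^sub>F \<eta> in at_right 0. v + cis (\<sigma> * \<eta>) * (end_point p - v) \<in> R"
    unfolding eventually_at_right_field using R(2) \<open>0 < \<eta>\<^sub>0\<close> by blast
  have eq: "side_of \<sigma> v (end_point p) = R" by (rule side_ofI[OF R(1) ev])
  show "side_of \<sigma> v (end_point p) \<in> regular_regions"
    and "\<forall>\<^sub>F \<eta> in at_right 0. v + cis (\<sigma> * \<eta>) * (end_point p - v) \<in> side_of \<sigma> v (end_point p)"
    unfolding eq using R(1) ev by auto
qed


lemma ccw_angle_bounds: "0 \<le> ccw_angle v p q" "ccw_angle v p q < 2 * pi"
  by (auto simp: ccw_angle_def Arg2pi_ge_0 Arg2pi_lt_2pi)

lemma end_point_ccw_angle: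
  assumes "p \<in> edge_ends v" "q \<in> edge_ends v"
  shows "end_point q = v + cis (ccw_angle v p q) * (end_point p - v)"
proof -
  have sph: "end_point p \<in> circle v" "end_point q \<in> circle v" "0 < \<rho> v"
    using end_point_sphere assms radius_pos by auto
  then have ne: "end_point p - v \<noteq> 0" by auto
  have "cmod ((end_point q - v) / (end_point p - v)) = 1"
    using sph by (auto simp: norm_divide dist_norm norm_minus_commute)
  then have "(end_point q - v) / (end_point p - v) = cis (ccw_angle v p q)"
    using Arg2pi_eq[of "(end_point q - v) / (end_point p - v)"] by (simp add: ccw_angle_def cis_conv_exp)
  then show ?thesis using ne by (simp add: field_simps)
qed

lemma ccw_angle_eqI:
  assumes "p \<in> edge_ends v" "end_point q = v + cis \<theta> * (end_point p - v)" "0 \<le> \<theta>" "\<theta> < 2 * pi"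
  shows "ccw_angle v p q = \<theta>"
proof -
  have "end_point p - v \<noteq> 0"
    using end_point_sphere[OF assms(1)] radius_pos[of v] by auto
  then have "(end_point q - v) / (end_point p - v) = cis \<theta>"
    using assms(2) by simp
  then show ?thesis
    unfolding ccw_angle_def using assms(3,4) by (intro Arg2pi_unique[of 1]) (auto simp: cis_conv_exp)
qed

lemma ccw_angle_self [simp]: "p \<in> edge_ends v \<Longrightarrow> ccw_angle v p p = 0"
  by (rule ccw_angle_eqI) auto

lemma ccw_angle_inj:
  assumes "p \<in> edge_ends v" "q \<in> edge_ends v" "q' \<in> edge_ends v" "ccw_angle v p q = ccw_angle v p q'"
  shows "q = q'"
  using inj_onD[OF inj_on_end_point, of q q' v] end_point_ccw_angle[OF assms(1,2)]
    end_point_ccw_angle[OF assms(1,3)] assms by simp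

lemma ccw_angle_pos: "p \<in> edge_ends v \<Longrightarrow> q \<in> edge_ends v \<Longrightarrow> p \<noteq> q \<Longrightarrow> 0 < ccw_angle v p q"
  using ccw_angle_inj[of p v p q] ccw_angle_bounds(1)[of v p q] by fastforce

lemma ccw_angle_change_base:
  assumes "b \<in> edge_ends v" "p \<in> edge_ends v" "q \<in> edge_ends v"
  shows "ccw_angle v p q = ccw_angle v b q - ccw_angle v b p +
    (if ccw_angle v b p \<le> ccw_angle v b q then 0 else 2 * pi)"
proof (rule ccw_angle_eqI[OF assms(2)])
  let ?\<alpha> = "ccw_angle v b"
  have "end_point q - v = cis (?\<alpha> q - ?\<alpha> p) * (end_point p - v)"
    using end_point_ccw_angle[OF assms(1,3)] end_point_ccw_angle[OF assms(1,2)]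
    by (simp add: cis_mult mult.assoc[symmetric])
  moreover have "cis (?\<alpha> q - ?\<alpha> p + 2 * pi) = cis (?\<alpha> q - ?\<alpha> p)"
    by (simp add: complex_eq_iff)
  ultimately show "end_point q = v + cis (?\<alpha> q - ?\<alpha> p + (if ?\<alpha> p \<le> ?\<alpha> q then 0 else 2 * pi)) * (end_point p - v)"
    by (auto simp: algebra_simps)
  show "0 \<le> ?\<alpha> q - ?\<alpha> p + (if ?\<alpha> p \<le> ?\<alpha> q then 0 else 2 * pi)"
    "?\<alpha> q - ?\<alpha> p + (if ?\<alpha> p \<le> ?\<alpha> q then 0 else 2 * pi) < 2 * pi"
    using ccw_angle_bounds[of v b p] ccw_angle_bounds[of v b q] by auto
qed

text \<open>
  The open arc of the circle between two successive ends misses the graph.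
\<close>

lemma ccw_next_region:
  assumes "p \<in> edge_ends v" "ccw_next v p q"
  shows "ccw_side v (end_point p) = cw_side v (end_point q)"
proof -
  have q: "q \<in> edge_ends v" "q \<noteq> p" and least: "\<And>q'. q' \<in> edge_ends v - {p} \<Longrightarrow> ccw_angle v p q \<le> ccw_angle v p q'"
    using assms(2) by (auto simp: ccw_next_def)
  define \<theta> where "\<theta> = ccw_angle v p q"
  have \<theta>: "0 < \<theta>" "\<theta> < 2 * pi"
    using ccw_angle_pos assms q ccw_angle_bounds by (auto simp: \<theta>_def)
  have sph: "end_point p \<in> circle v" "v \<in> verts G" using end_point_sphere[OF assms(1)] by auto
  have off: "v + cis (1 * \<eta>) * (end_point p - v) \<notin> support" if "0 < \<eta>" "\<eta> < \<theta>" for \<eta>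
  proof
    assume "v + cis (1 * \<eta>) * (end_point p - v) \<in> support"
    moreover have "v + cis \<eta> * (end_point p - v) \<in> circle v"
      using sph by (auto simp: dist_norm norm_mult norm_minus_commute)
    ultimately obtain q' where q': "q' \<in> edge_ends v" "end_point q' = v + cis \<eta> * (end_point p - v)"
      using support_on_circle[OF sph(2)] by (metis IntI imageE mult_1)
    then have "ccw_angle v p q' = \<eta>"
      using that \<theta> assms(1) by (intro ccw_angle_eqI) auto
    then show False
      using least[of q'] q' that assms(1) by (cases "q' = p") (auto simp: \<theta>_def)
  qed
  obtain R where R: "R \<in> regular_regions" "\<And>\<eta>. 0 < \<eta> \<Longrightarrow> \<eta> < \<theta> \<Longrightarrow> v + cis (1 * \<eta>) * (end_point p - v) \<in> R"
    using arc_in_region[OF \<theta>(1) off] by metis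
  have "ccw_side v (end_point p) = R"
    by (rule side_ofI[OF R(1)]) (use R(2) \<theta>(1) in \<open>auto simp: eventually_at_right_field\<close>)
  moreover have "cw_side v (end_point q) = R"
  proof (rule side_ofI[OF R(1)])
    have "v + cis (- 1 * \<eta>) * (end_point q - v) \<in> R" if "0 < \<eta>" "\<eta> < \<theta>" for \<eta>
    proof -
      have "v + cis (- 1 * \<eta>) * (end_point q - v) = v + cis (1 * (\<theta> - \<eta>)) * (end_point p - v)"
        using end_point_ccw_angle[OF assms(1) q(1)] by (simp add: \<theta>_def mult.assoc[symmetric] cis_mult)
      then show ?thesis using R(2)[of "\<theta> - \<eta>"] that by simp
    qed
    then show "\<forall>\<^sub>F \<eta> in at_right 0. v + cis (- 1 * \<eta>) * (end_point q - v) \<in> R"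
      using \<theta>(1) unfolding eventually_at_right_field by blast
  qed
  ultimately show ?thesis by simp
qed

text \<open>
  Measure all angles from the end \<open>b\<close>. The predecessor of \<open>p\<close> is the end with the largest angle below
  that of \<open>p\<close>: seen from this end, the ends with a smaller angle are reached only after passing \<open>b\<close>.
\<close>

lemma ccw_predecessor:
  assumes b: "b \<in> edge_ends v" and p: "p \<in> edge_ends v" "p \<noteq> b"
  obtains p' where "p' \<in> edge_ends v" "ccw_next v p' p" "ccw_angle v b p' < ccw_angle v b p"
    and "\<And>x. x \<in> edge_ends v \<Longrightarrow> ccw_angle v b x < ccw_angle v b p \<Longrightarrow> ccw_angle v b x \<le> ccw_angle v b p'"
proof -
  let ?\<alpha> = "ccw_angle v b"
  define S where "S = {x \<in> edge_ends v. ?\<alpha> x < ?\<alpha> p}"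
  have "finite S" using finite_edge_ends by (auto simp: S_def)
  moreover have "b \<in> S" using assms ccw_angle_pos[of b v p] by (auto simp: S_def)
  ultimately obtain p' where p': "p' \<in> S" "\<And>x. x \<in> S \<Longrightarrow> ?\<alpha> x \<le> ?\<alpha> p'"
  proof -
    have "Max (?\<alpha> ` S) \<in> ?\<alpha> ` S" using \<open>finite S\<close> \<open>b \<in> S\<close> by (intro Max_in) auto
    then obtain p' where p': "p' \<in> S" "Max (?\<alpha> ` S) = ?\<alpha> p'" by auto
    then have "?\<alpha> x \<le> ?\<alpha> p'" if "x \<in> S" for x
      using Max_ge[of "?\<alpha> ` S" "?\<alpha> x"] \<open>finite S\<close> that by simp
    then show thesis using that[of p'] p' by blast
  qed
  have p'E: "p' \<in> edge_ends v" "?\<alpha> p' < ?\<alpha> p" using p' by (auto simp: S_def)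
  have "ccw_next v p' p"
    unfolding ccw_next_def
  proof (intro conjI ballI)
    show "p \<in> edge_ends v - {p'}" using p p'E by auto
    fix q assume q: "q \<in> edge_ends v - {p'}"
    have "?\<alpha> q \<noteq> ?\<alpha> p'" using ccw_angle_inj[OF b, of q p'] q p'E by auto
    show "ccw_angle v p' p \<le> ccw_angle v p' q"
    proof (cases "?\<alpha> p' \<le> ?\<alpha> q")
      case True
      then have "q \<notin> S" using p'(2)[of q] \<open>?\<alpha> q \<noteq> ?\<alpha> p'\<close> by auto
      then have "?\<alpha> p \<le> ?\<alpha> q" using q by (auto simp: S_def)
      then show ?thesis
        using True p'E q ccw_angle_change_base[OF b p'E(1) p(1)] ccw_angle_change_base[OF b p'E(1), of q] by auto
    next
      case False
      then show ?thesis
        using p'E q ccw_angle_change_base[OF b p'E(1) p(1)] ccw_angle_change_base[OF b p'E(1), of q]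
          ccw_angle_bounds[of v b p] ccw_angle_bounds[of v b q] by auto
    qed
  qed
  then show ?thesis using that[of p'] p'E p'(2) by (auto simp: S_def)
qed

lemma ccw_next_unique:
  assumes "p \<in> edge_ends v" "ccw_next v p q" "ccw_next v p q'"
  shows "q = q'"
  using assms ccw_angle_inj[of p v q q'] unfolding ccw_next_def by (metis Diff_iff order_antisym)

text \<open>
  Passing to the next end permutes the ends, and the counter-clockwise side of an end is the
  clockwise side of the next one. A single end has no successor in the sense of \<open>ccw_next\<close>.
\<close>

lemma rotation_ends:
  assumes "card (edge_ends v) \<noteq> 1"
  shows "(\<Sum>p\<in>edge_ends v. h (ccw_side v (end_point p))) = (\<Sum>p\<in>edge_ends v. h (cw_side v (end_point p)))"
proof -
  define P where "P = (\<lambda>p q. p \<in> edge_ends v \<and> ccw_next v p q)"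
  have ex: "\<exists>p. P p q" if q: "q \<in> edge_ends v" for q
  proof -
    have "edge_ends v \<noteq> {q}" using assms by auto
    with q have "\<exists>b. b \<in> edge_ends v \<and> q \<noteq> b" by blast
    then obtain b where b: "b \<in> edge_ends v" "q \<noteq> b" by blast
    obtain p where "p \<in> edge_ends v" "ccw_next v p q"
      using ccw_predecessor[OF b(1) q b(2)] by metis
    then show ?thesis by (auto simp: P_def)
  qed
  define prev where "prev q = (SOME p. P p q)" for q
  have prev: "P (prev q) q" if "q \<in> edge_ends v" for q
    unfolding prev_def using someI_ex[OF ex[OF that]] .
  have "inj_on prev (edge_ends v)"
    by (rule inj_onI) (metis P_def ccw_next_unique prev)
  moreover have "prev ` edge_ends v \<subseteq> edge_ends v" using prev by (auto simp: P_def)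
  ultimately have bij: "bij_betw prev (edge_ends v) (edge_ends v)"
    using endo_inj_surj[OF finite_edge_ends] by (simp add: bij_betw_def)
  have "(\<Sum>p\<in>edge_ends v. h (ccw_side v (end_point p))) = (\<Sum>q\<in>edge_ends v. h (ccw_side v (end_point (prev q))))"
    by (rule sum.reindex_bij_betw[OF bij, symmetric])
  also have "\<dots> = (\<Sum>q\<in>edge_ends v. h (cw_side v (end_point q)))"
  proof (rule sum.cong[OF refl])
    fix q assume "q \<in> edge_ends v"
    then show "h (ccw_side v (end_point (prev q))) = h (cw_side v (end_point q))"
      using ccw_next_region[of "prev q" v q] prev[of q] by (simp add: P_def)
  qed
  finally show ?thesis .
qed

lemma constant_around_vertex:
  assumes "\<And>p. p \<in> edge_ends v \<Longrightarrow> h (ccw_side v (end_point p)) = h (cw_side v (end_point p))"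
    and "b \<in> edge_ends v" "p \<in> edge_ends v"
  shows "h (cw_side v (end_point p)) = h (cw_side v (end_point b))"
  using assms(3)
proof (induction "card {x \<in> edge_ends v. ccw_angle v b x < ccw_angle v b p}" arbitrary: p rule: less_induct)
  case less
  show ?case
  proof (cases "p = b")
    case False
    obtain p' where p': "p' \<in> edge_ends v" "ccw_next v p' p" "ccw_angle v b p' < ccw_angle v b p"
      using ccw_predecessor[OF assms(2) less.prems False] by metis
    then have "{x \<in> edge_ends v. ccw_angle v b x < ccw_angle v b p'} \<subset> {x \<in> edge_ends v. ccw_angle v b x < ccw_angle v b p}"
      by auto
    then have "card {x \<in> edge_ends v. ccw_angle v b x < ccw_angle v b p'} < card {x \<in> edge_ends v. ccw_angle v b x < ccw_angle v b p}"
      using finite_edge_ends by (intro psubset_card_mono) auto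
    then have "h (cw_side v (end_point p')) = h (cw_side v (end_point b))"
      using less.hyps p'(1) by blast
    moreover have "h (cw_side v (end_point p)) = h (ccw_side v (end_point p'))"
      using ccw_next_region[OF p'(1,2)] by simp
    ultimately show ?thesis using assms(1)[OF p'(1)] by simp
  qed simp
qed

end

section \<open>Winding numbers and the regions of a plane graph\<close>

context plane_graph
begin

definition flow :: "('e \<Rightarrow> real) \<Rightarrow> bool" where
  "flow g \<longleftrightarrow> (\<forall>v\<in>verts G. (\<Sum>e | e \<in> arcs G \<and> head G e = v. g e) = (\<Sum>e | e \<in> arcs G \<and> tail G e = v. g e))"

text \<open>
  An edge need not be closed, so that its winding number need not be an integer; its real part is
  the total change of the argument, in turns.
\<close>

definition winding :: "('e \<Rightarrow> real) \<Rightarrow> complex \<Rightarrow> real" where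
  "winding g z = (\<Sum>e\<in>arcs G. g e * Re (winding_number (\<gamma> e) z))"

text \<open>
  The choice of the point in \<open>R\<close> matters for a single edge, but not for the sum over a flow.
\<close>

definition region_winding :: "'e \<Rightarrow> complex set \<Rightarrow> real" where
  "region_winding e R = Re (winding_number (\<gamma> e) (SOME z. z \<in> R))"

abbreviation flow_potential :: "('e \<Rightarrow> real) \<Rightarrow> complex set \<Rightarrow> real" where
  "flow_potential g R \<equiv> \<Sum>d\<in>arcs G. g d * region_winding d R"

lemma path_image_support: "e \<in> arcs G \<Longrightarrow> path_image (\<gamma> e) \<subseteq> support"
  by (auto simp: support_def)

lemma flow_vertex_sum:
  assumes "flow g"
  fixes \<phi> :: "complex \<Rightarrow> real"
  shows "(\<Sum>e\<in>arcs G. g e * (\<phi> (head G e) - \<phi> (tail G e))) = 0"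
proof -
  have "(\<Sum>e\<in>arcs G. g e * \<phi> (f e)) = (\<Sum>v\<in>verts G. \<phi> v * (\<Sum>e | e \<in> arcs G \<and> f e = v. g e))"
    if "f ` arcs G \<subseteq> verts G" for f
    using sum.group[of "arcs G" "verts G" f "\<lambda>e. g e * \<phi> (f e)"] that
    by (simp add: sum_distrib_left mult.commute)
  moreover have "head G ` arcs G \<subseteq> verts G" "tail G ` arcs G \<subseteq> verts G" by auto
  ultimately show ?thesis
    using assms by (simp add: flow_def right_diff_distrib sum_subtractf)
qed

text \<open>
  By \<open>winding_number_shift\<close> the winding number of each edge changes by a difference of values of one
  function \<open>\<phi>\<close> at its head and its tail, and these differences cancel in a flow.
\<close>

lemma winding_shift:
  assumes "flow g" "closed_segment z z' \<inter> support = {}"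
  shows "winding g z' = winding g z"
proof -
  define \<phi> where "\<phi> q = Re (Ln ((q - z') / (q - z)) / (2 * of_real pi * \<i>))" for q
  have "Re (winding_number (\<gamma> e) z') = Re (winding_number (\<gamma> e) z) + (\<phi> (head G e) - \<phi> (tail G e))"
    if "e \<in> arcs G" for e
  proof -
    have "closed_segment z z' \<inter> path_image (\<gamma> e) = {}"
      using assms(2) path_image_support[OF that] by blast
    from winding_number_shift[OF path_edge[OF that] this]
    have "winding_number (\<gamma> e) z' = winding_number (\<gamma> e) z +
        (Ln ((head G e - z') / (head G e - z)) / (2 * of_real pi * \<i>) - Ln ((tail G e - z') / (tail G e - z)) / (2 * of_real pi * \<i>))"
      using start[OF that] finish[OF that] by (simp add: diff_divide_distrib algebra_simps)
    then show ?thesis unfolding \<phi>_def by (metis minus_complex.sel(1) plus_complex.sel(1))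
  qed
  then have "winding g z' = winding g z + (\<Sum>e\<in>arcs G. g e * (\<phi> (head G e) - \<phi> (tail G e)))"
    by (simp add: winding_def distrib_left sum.distrib)
  then show ?thesis using flow_vertex_sum[OF assms(1)] by simp
qed

lemma winding_region:
  assumes "flow g" "R \<in> regular_regions" "z \<in> R"
  shows "(\<Sum>e\<in>arcs G. g e * region_winding e R) = winding g z"
proof -
  note R = regular_region[OF assms(2)]
  have "winding g x = winding g y" if "x \<in> R" "y \<in> R" for x y
  proof (rule connected_local_const[OF R(2) that], rule ballI)
    fix a assume "a \<in> R"
    then obtain \<epsilon> where \<epsilon>: "0 < \<epsilon>" "ball a \<epsilon> \<subseteq> R" using R(1) openE by blast
    have "winding g a = winding g b" if "b \<in> ball a \<epsilon>" for b
    proof -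
      have "closed_segment a b \<subseteq> ball a \<epsilon>"
        using \<epsilon>(1) that by (intro closed_segment_subset) auto
      then show ?thesis
        using winding_shift[OF assms(1), of a b] \<epsilon>(2) R(4) by fastforce
    qed
    then have "\<forall>\<^sub>F b in nhds a. winding g a = winding g b"
      unfolding eventually_nhds using \<epsilon>(1) by (intro exI[of _ "ball a \<epsilon>"]) auto
    then show "\<forall>\<^sub>F b in at a within R. winding g a = winding g b"
      unfolding eventually_at_filter by (rule eventually_mono) blast
  qed
  moreover have "(SOME z. z \<in> R) \<in> R" using assms(3) by (rule someI)
  ultimately have "winding g (SOME z. z \<in> R) = winding g z"
    using assms(3) by blast
  then show ?thesis
    by (simp only: winding_def region_winding_def)
qed

lemma edge_interior_isolated:
  assumes "e \<in> arcs G" "x \<in> edge_interior e"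
  shows "x \<notin> verts G" "d \<in> arcs G \<Longrightarrow> d \<noteq> e \<Longrightarrow> x \<notin> path_image (\<gamma> d)"
proof -
  show v: "x \<notin> verts G" using avoids_verts assms by blast
  show "x \<notin> path_image (\<gamma> d)" if "d \<in> arcs G" "d \<noteq> e"
    using disjoint_edges[OF that(1) assms(1) that(2)] assms(2) v that(1) path_image_edge[OF that(1)] by auto
qed

text \<open>
  Only the winding number of the edge that carries the end \<open>p\<close> is discontinuous at the point of
  \<open>p\<close>.
\<close>

lemma winding_jump:
  assumes e: "e \<in> arcs G" and p: "p \<in> edge_ends v" "end_point p \<in> edge_interior e"
    and "flow g"
    and jump: "((\<lambda>\<eta>. winding_number (\<gamma> e) (v + cis (- \<eta>) * (end_point p - v))
                - winding_number (\<gamma> e) (v + cis \<eta> * (end_point p - v))) \<longlongrightarrow> of_real c) (at_right 0)"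
  shows "flow_potential g (cw_side v (end_point p))
         - flow_potential g (ccw_side v (end_point p)) = g e * c"
proof -
  let ?q = "end_point p"
  define W E where "W = (\<lambda>\<eta>. v + cis (- \<eta>) * (?q - v))" and "E = (\<lambda>\<eta>. v + cis \<eta> * (?q - v))"
  have limW: "(W \<longlongrightarrow> ?q) (at_right 0)" and limE: "(E \<longlongrightarrow> ?q) (at_right 0)"
    unfolding W_def E_def by (rule tendsto_eq_intros | simp)+
  have "((\<lambda>\<eta>. g d * (Re (winding_number (\<gamma> d) (W \<eta>)) - Re (winding_number (\<gamma> d) (E \<eta>)))) \<longlongrightarrow>
      (if d = e then g e * c else 0)) (at_right 0)" if d: "d \<in> arcs G" for d
  proof (cases "d = e")
    case True
    have "((\<lambda>\<eta>. Re (winding_number (\<gamma> e) (W \<eta>) - winding_number (\<gamma> e) (E \<eta>))) \<longlongrightarrow> Re (of_real c)) (at_right 0)"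
      using jump unfolding W_def E_def by (rule tendsto_Re)
    with True show ?thesis by (auto intro!: tendsto_mult)
  next
    case False
    then have "?q \<notin> path_image (\<gamma> d)" using edge_interior_isolated[OF e p(2)] d by blast
    then have cont: "isCont (winding_number (\<gamma> d)) ?q"
      by (rule continuous_at_winding_number[OF path_edge[OF d]])
    from isCont_tendsto_compose[OF cont limW] isCont_tendsto_compose[OF cont limE]
    have "((\<lambda>\<eta>. g d * (Re (winding_number (\<gamma> d) (W \<eta>)) - Re (winding_number (\<gamma> d) (E \<eta>)))) \<longlongrightarrow>
        g d * (Re (winding_number (\<gamma> d) ?q) - Re (winding_number (\<gamma> d) ?q))) (at_right 0)"
      by (intro tendsto_intros)
    then show ?thesis using False by simp
  qed
  then have "((\<lambda>\<eta>. \<Sum>d\<in>arcs G. g d * (Re (winding_number (\<gamma> d) (W \<eta>)) - Re (winding_number (\<gamma> d) (E \<eta>)))) \<longlongrightarrow>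
      (\<Sum>d\<in>arcs G. if d = e then g e * c else 0)) (at_right 0)"
    by (rule tendsto_sum)
  then have lim: "((\<lambda>\<eta>. winding g (W \<eta>) - winding g (E \<eta>)) \<longlongrightarrow> g e * c) (at_right 0)"
    using e by (simp add: winding_def right_diff_distrib sum_subtractf)
  have "\<forall>\<^sub>F \<eta> in at_right 0. W \<eta> \<in> cw_side v ?q" "\<forall>\<^sub>F \<eta> in at_right 0. E \<eta> \<in> ccw_side v ?q"
    using side_of_end(2)[OF p(1), of "- 1"] side_of_end(2)[OF p(1), of 1] by (simp_all add: W_def E_def)
  then have "\<forall>\<^sub>F \<eta> in at_right 0. winding g (W \<eta>) - winding g (E \<eta>) =
      flow_potential g (cw_side v ?q) - flow_potential g (ccw_side v ?q)"
    by eventually_elim (use winding_region[OF \<open>flow g\<close>] side_of_end(1)[OF p(1)] in simp)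
  then have "((\<lambda>\<eta>. winding g (W \<eta>) - winding g (E \<eta>)) \<longlongrightarrow>
      flow_potential g (cw_side v ?q) - flow_potential g (ccw_side v ?q)) (at_right 0)"
    by (rule tendsto_eventually)
  then show ?thesis
    using tendsto_unique[OF trivial_limit_at_right_real lim] by simp
qed

lemma winding_jump_in:
  assumes e: "e \<in> arcs G" and "flow g"
  shows "flow_potential g (cw_side (head G e) (cr e))
         - flow_potential g (ccw_side (head G e) (cr e)) = g e"
proof -
  obtain a b where ab: "0 < a" "a < b" "b < 1" and cr: "cr e = \<gamma> e b"
    and on: "\<gamma> e a \<in> circle (tail G e)" "\<gamma> e b \<in> circle (head G e)"
    and inner: "\<And>s. s \<in> {b<..1} \<Longrightarrow> \<gamma> e s \<in> disk (head G e)"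
    and mid: "\<And>s v. s \<in> {a<..<b} \<Longrightarrow> v \<in> verts G \<Longrightarrow> \<gamma> e s \<notin> cball v (\<rho> v)"
    using crossing_times[OF e] by metis
  have p: "Incoming e \<in> edge_ends (head G e)" using e by (simp add: edge_ends_def)
  have int: "cr e \<in> edge_interior e" using ab cr by (auto simp: edge_interior_def)
  have "((\<lambda>\<eta>. winding_number (\<gamma> e) (head G e + cis (- \<eta>) * (\<gamma> e b - head G e))
      - winding_number (\<gamma> e) (head G e + cis \<eta> * (\<gamma> e b - head G e))) \<longlongrightarrow> 1) (at_right 0)"
  proof (rule winding_number_jump[OF path_edge[OF e] finish[OF e] _ ab(2,3) on(2) inner])
    show "0 \<le> a" using ab by simp
    show "\<gamma> e s \<notin> disk (head G e)" if s: "s \<in> {a..b}" for s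
    proof -
      consider "s = a" | "s \<in> {a<..<b}" | "s = b" using s by force
      then show ?thesis
      proof cases
        case 1
        then show ?thesis using on(1) in_two_disks[of "tail G e" "head G e" "\<gamma> e a"] e by auto
      qed (use mid[of s "head G e"] on e in auto)
    qed
    show "\<gamma> e s \<noteq> \<gamma> e b" if "s \<in> {0..a}" for s
      using simple_path_interior_inj[OF simple[OF e], of b s] ab that by auto
    show "\<forall>\<^sub>F \<eta> in at_right 0. head G e + cis (- \<eta>) * (\<gamma> e b - head G e) \<notin> path_image (\<gamma> e)"
      using eventually_off_support[OF p, of "- 1"] path_image_support[OF e]
      by (auto simp: cr elim: eventually_mono)
    show "\<forall>\<^sub>F \<eta> in at_right 0. head G e + cis \<eta> * (\<gamma> e b - head G e) \<notin> path_image (\<gamma> e)"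
      using eventually_off_support[OF p, of 1] path_image_support[OF e]
      by (auto simp: cr elim: eventually_mono)
  qed
  then show ?thesis
    using winding_jump[OF e p _ \<open>flow g\<close>, of 1] int by (simp add: cr)
qed

text \<open>
  An edge traversed backwards enters the disk around its tail, with the opposite winding number.
\<close>

lemma winding_jump_out:
  assumes e: "e \<in> arcs G" and "flow g"
  shows "flow_potential g (ccw_side (tail G e) (exit_point e))
         - flow_potential g (cw_side (tail G e) (exit_point e)) = g e"
proof -
  obtain a b where ab: "0 < a" "a < b" "b < 1" and cr: "exit_point e = \<gamma> e a"
    and on: "\<gamma> e a \<in> circle (tail G e)" "\<gamma> e b \<in> circle (head G e)"
    and inner: "\<And>s. s \<in> {0..<a} \<Longrightarrow> \<gamma> e s \<in> disk (tail G e)"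
    and mid: "\<And>s v. s \<in> {a<..<b} \<Longrightarrow> v \<in> verts G \<Longrightarrow> \<gamma> e s \<notin> cball v (\<rho> v)"
    using crossing_times[OF e] by metis
  have p: "Outgoing e \<in> edge_ends (tail G e)" using e by (simp add: edge_ends_def)
  have int: "exit_point e \<in> edge_interior e" using ab cr by (auto simp: edge_interior_def)
  let ?p = "reversepath (\<gamma> e)"
  have rev: "?p s = \<gamma> e (1 - s)" for s by (simp add: reversepath_def)
  have off: "\<forall>\<^sub>F \<eta> in at_right 0. tail G e + cis (- \<eta>) * (?p (1 - a) - tail G e) \<notin> path_image (\<gamma> e)"
    "\<forall>\<^sub>F \<eta> in at_right 0. tail G e + cis \<eta> * (?p (1 - a) - tail G e) \<notin> path_image (\<gamma> e)"
    using eventually_off_support[OF p, of "- 1"] eventually_off_support[OF p, of 1] path_image_support[OF e]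
    by (auto simp: cr rev elim: eventually_mono)
  have "((\<lambda>\<eta>. winding_number ?p (tail G e + cis (- \<eta>) * (?p (1 - a) - tail G e))
      - winding_number ?p (tail G e + cis \<eta> * (?p (1 - a) - tail G e))) \<longlongrightarrow> 1) (at_right 0)"
  proof (rule winding_number_jump[of _ _ "1 - b" _ "\<rho> (tail G e)"])
    show "path ?p" "pathfinish ?p = tail G e" using path_edge[OF e] start[OF e] by auto
    show "0 \<le> 1 - b" "1 - b < 1 - a" "1 - a < 1" using ab by auto
    show "?p (1 - a) \<in> circle (tail G e)" using on by (simp add: rev)
    show "?p s \<in> disk (tail G e)" if "s \<in> {1 - a<..1}" for s
      using inner[of "1 - s"] that by (simp add: rev)
    show "?p s \<notin> disk (tail G e)" if s: "s \<in> {1 - b..1 - a}" for s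
    proof -
      consider "1 - s = b" | "1 - s \<in> {a<..<b}" | "1 - s = a" using s by force
      then show ?thesis
      proof cases
        case 1
        then show ?thesis using on(2) in_two_disks[of "tail G e" "head G e" "\<gamma> e b"] e by (auto simp: rev)
      qed (use mid[of "1 - s" "tail G e"] on e in \<open>auto simp: rev\<close>)
    qed
    show "?p s \<noteq> ?p (1 - a)" if "s \<in> {0..1 - b}" for s
      using simple_path_interior_inj[OF simple[OF e], of a "1 - s"] ab that by (auto simp: rev)
  qed (use off in simp_all)
  then have "((\<lambda>\<eta>. - (winding_number ?p (tail G e + cis (- \<eta>) * (?p (1 - a) - tail G e))
      - winding_number ?p (tail G e + cis \<eta> * (?p (1 - a) - tail G e)))) \<longlongrightarrow> - 1) (at_right 0)"
    by (rule tendsto_minus)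
  moreover have "\<forall>\<^sub>F \<eta> in at_right 0. - (winding_number ?p (tail G e + cis (- \<eta>) * (?p (1 - a) - tail G e))
      - winding_number ?p (tail G e + cis \<eta> * (?p (1 - a) - tail G e))) =
      winding_number (\<gamma> e) (tail G e + cis (- \<eta>) * (?p (1 - a) - tail G e))
      - winding_number (\<gamma> e) (tail G e + cis \<eta> * (?p (1 - a) - tail G e))"
    using off by eventually_elim (simp add: winding_number_reversepath[OF path_edge[OF e]])
  ultimately have "((\<lambda>\<eta>. winding_number (\<gamma> e) (tail G e + cis (- \<eta>) * (?p (1 - a) - tail G e))
      - winding_number (\<gamma> e) (tail G e + cis \<eta> * (?p (1 - a) - tail G e))) \<longlongrightarrow> of_real (- 1)) (at_right 0)"
    using tendsto_cong by force
  then show ?thesis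
    using winding_jump[OF e p _ \<open>flow g\<close>, of "- 1"] int by (simp add: cr rev)
qed

text \<open>
  The graph without the open arc \<open>e\<close>, in the form needed for \<open>frontier_contains_open_arc\<close> and
  \<open>at_most_two_sides\<close>.
\<close>

lemma rest_of_graph:
  assumes "e \<in> arcs G"
  defines "X \<equiv> verts G \<union> (\<Union>d\<in>arcs G - {e}. path_image (\<gamma> d))"
  shows "compact X" "support = X \<union> path_image (\<gamma> e)" "pathstart (\<gamma> e) \<in> X" "pathfinish (\<gamma> e) \<in> X"
    "\<gamma> e ` {0<..<1} \<inter> X = {}"
proof -
  show "compact X"
    unfolding X_def using path_edge
    by (intro compact_Un compact_UN finite_imp_compact compact_path_image) auto
  show "support = X \<union> path_image (\<gamma> e)" using assms(1) by (auto simp: support_def X_def)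
  show "pathstart (\<gamma> e) \<in> X" "pathfinish (\<gamma> e) \<in> X"
    using start finish assms(1) by (auto simp: X_def)
  show "\<gamma> e ` {0<..<1} \<inter> X = {}"
    using edge_interior_isolated[OF assms(1)] unfolding X_def edge_interior_def by blast
qed

lemma frontier_edge_interior:
  assumes "e \<in> arcs G" "R \<in> regular_regions" "frontier R \<inter> edge_interior e \<noteq> {}"
  shows "edge_interior e \<subseteq> frontier R"
  using frontier_contains_open_arc[OF compact_imp_closed[OF rest_of_graph(1)[OF assms(1)]] simple[OF assms(1)]
      rest_of_graph(3-5)[OF assms(1)], of R] assms rest_of_graph(2)[OF assms(1)]
  by (simp add: regular_regions_def edge_interior_def)

lemma two_sides:
  assumes "e \<in> arcs G" "A \<in> regular_regions" "B \<in> regular_regions" "D \<in> regular_regions"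
    and "edge_interior e \<subseteq> frontier A" "edge_interior e \<subseteq> frontier B" "edge_interior e \<subseteq> frontier D"
    and "A \<noteq> B" "A \<noteq> D"
  shows "B = D"
  using at_most_two_sides[OF rest_of_graph(1)[OF assms(1)] simple[OF assms(1)] rest_of_graph(3-5)[OF assms(1)], of A B D]
    assms rest_of_graph(2)[OF assms(1)]
  by (simp add: regular_regions_def edge_interior_def)

lemma side_frontier:
  assumes "e \<in> arcs G" "p \<in> edge_ends v" "end_point p \<in> edge_interior e" "\<sigma> = 1 \<or> \<sigma> = - 1"
  shows "edge_interior e \<subseteq> frontier (side_of \<sigma> v (end_point p))"
proof (rule frontier_edge_interior[OF assms(1) side_of_end(1)[OF assms(2,4)]])
  let ?R = "side_of \<sigma> v (end_point p)"
  note R = regular_region[OF side_of_end(1)[OF assms(2,4)]]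
  have "((\<lambda>\<eta>. v + cis (\<sigma> * \<eta>) * (end_point p - v)) \<longlongrightarrow> end_point p) (at_right 0)"
    by (rule tendsto_eq_intros | simp)+
  then have "end_point p \<in> closure ?R"
  proof (intro Lim_in_closed_set[OF closed_closure _ trivial_limit_at_right_real])
    show "\<forall>\<^sub>F \<eta> in at_right 0. v + cis (\<sigma> * \<eta>) * (end_point p - v) \<in> closure ?R"
      using side_of_end(2)[OF assms(2,4)] by (rule eventually_mono) (rule closure_subset[THEN subsetD])
  qed
  moreover have "end_point p \<notin> ?R" using end_point_sphere(3)[OF assms(2)] R(4) by blast
  ultimately show "frontier ?R \<inter> edge_interior e \<noteq> {}"
    using assms(3) R(1) by (auto simp: frontier_def interior_open)
qed

lemma edge_ends_split:
  "(\<Sum>p\<in>edge_ends v. h p) =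
    (\<Sum>e | e \<in> arcs G \<and> head G e = v. h (Incoming e)) + (\<Sum>e | e \<in> arcs G \<and> tail G e = v. h (Outgoing e))"
proof -
  have "(\<Sum>p\<in>edge_ends v. h p) = (\<Sum>p\<in>Incoming ` in_arcs G v. h p) + (\<Sum>p\<in>Outgoing ` out_arcs G v. h p)"
    unfolding edge_ends_def by (intro sum.union_disjoint) auto
  also have "\<dots> = (\<Sum>e\<in>in_arcs G v. h (Incoming e)) + (\<Sum>e\<in>out_arcs G v. h (Outgoing e))"
    by (simp add: sum.reindex inj_on_def)
  finally show ?thesis by (simp add: in_arcs_def out_arcs_def)
qed

end

context balanced_transverse_plane_graph
begin

lemma unit_flow: "flow (\<lambda>_. 1)"
  using balanced by (auto simp: flow_def in_degree_def out_degree_def in_arcs_def out_arcs_def)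

text \<open>
  The winding number of the whole graph, the edges of which form a flow because the graph is
  balanced.
\<close>

definition alexander_numbering :: "complex set \<Rightarrow> real" where
  "alexander_numbering R = (\<Sum>d\<in>arcs G. region_winding d R)"

lemma numbering_in:
  "e \<in> arcs G \<Longrightarrow> alexander_numbering (cw_side (head G e) (cr e)) = alexander_numbering (ccw_side (head G e) (cr e)) + 1"
  using winding_jump_in[OF _ unit_flow, of e] by (simp add: alexander_numbering_def)

lemma numbering_out:
  "e \<in> arcs G \<Longrightarrow>
    alexander_numbering (ccw_side (tail G e) (exit_point e)) = alexander_numbering (cw_side (tail G e) (exit_point e)) + 1"
  using winding_jump_out[OF _ unit_flow, of e] by (simp add: alexander_numbering_def)

lemma ends_of_edge:
  assumes "e \<in> arcs G"
  shows "Incoming e \<in> edge_ends (head G e)" "Outgoing e \<in> edge_ends (tail G e)"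
    "cr e \<in> edge_interior e" "exit_point e \<in> edge_interior e"
proof -
  obtain a b where "0 < a" "a < b" "b < 1" "exit_point e = \<gamma> e a" "cr e = \<gamma> e b"
    using crossing_times[OF assms] by metis
  then show "cr e \<in> edge_interior e" "exit_point e \<in> edge_interior e"
    by (auto simp: edge_interior_def)
qed (use assms in \<open>auto simp: edge_ends_def\<close>)

lemma west_east_regions:
  assumes "e \<in> arcs G"
  shows "west_region e \<in> regular_regions" "east_region e \<in> regular_regions"
    "edge_interior e \<subseteq> frontier (west_region e)" "edge_interior e \<subseteq> frontier (east_region e)"
    "alexander_numbering (west_region e) = alexander_numbering (east_region e) + 1"
    "west_region e \<noteq> east_region e"
proof -
  note ends = ends_of_edge[OF assms]
  show "west_region e \<in> regular_regions" "east_region e \<in> regular_regions"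
    using side_of_end(1)[OF ends(1)] by (auto simp: west_region_side east_region_side)
  show "edge_interior e \<subseteq> frontier (west_region e)" "edge_interior e \<subseteq> frontier (east_region e)"
    using side_frontier[OF assms ends(1)] ends(3) by (auto simp: west_region_side east_region_side)
  show num: "alexander_numbering (west_region e) = alexander_numbering (east_region e) + 1"
    using numbering_in[OF assms] by (simp add: west_region_side east_region_side)
  then show "west_region e \<noteq> east_region e" by auto
qed

lemma region_beside_edge:
  assumes "e \<in> arcs G" "R \<in> regular_regions" "frontier R \<inter> edge_interior e \<noteq> {}"
  shows "R = west_region e \<or> R = east_region e"
  using two_sides[OF assms(1) west_east_regions(1)[OF assms(1)] west_east_regions(2)[OF assms(1)] assms(2)]
    frontier_edge_interior[OF assms] west_east_regions[OF assms(1)] by blast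

lemma adjacent_regions_edge:
  assumes "e \<in> arcs G" "\<delta> \<in> edge_interior e"
  shows "adjacent_regions \<delta> = {west_region e, east_region e}"
  using region_beside_edge[OF assms(1)] west_east_regions[OF assms(1)] assms(2)
  unfolding adjacent_regions_def by blast

text \<open>
  Topologically, only the unordered pair of regions along \<open>e\<close> is the same at both ends; the numbering
  tells which of them is on the left.
\<close>

lemma sides_at_tail:
  assumes "e \<in> arcs G"
  shows "ccw_side (tail G e) (exit_point e) = west_region e" "cw_side (tail G e) (exit_point e) = east_region e"
proof -
  note ends = ends_of_edge[OF assms]
  have "side_of \<sigma> (tail G e) (exit_point e) = west_region e \<or> side_of \<sigma> (tail G e) (exit_point e) = east_region e"
    if "\<sigma> = 1 \<or> \<sigma> = - 1" for \<sigma>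
  proof (rule region_beside_edge[OF assms])
    show "side_of \<sigma> (tail G e) (exit_point e) \<in> regular_regions"
      using side_of_end(1)[OF ends(2) that] by simp
    show "frontier (side_of \<sigma> (tail G e) (exit_point e)) \<inter> edge_interior e \<noteq> {}"
      using side_frontier[OF assms ends(2) _ that] ends(4) by auto
  qed
  from this[of 1] this[of "- 1"] show
    "ccw_side (tail G e) (exit_point e) = west_region e" "cw_side (tail G e) (exit_point e) = east_region e"
    using numbering_out[OF assms] west_east_regions(5)[OF assms] by auto
qed

text \<open>
  Let \<open>W\<close> be the component containing \<open>x\<close> after \<open>e\<close> is erased. A region inside \<open>W\<close> has frontier
  points in \<open>W\<close>, which must be on \<open>e\<close>, so it is one of the two regions beside \<open>e\<close>.
\<close>

lemma edge_neighbourhood: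
  assumes "e \<in> arcs G" "x \<in> edge_interior e"
  obtains W where "open W" "x \<in> W" "W \<subseteq> edge_interior e \<union> west_region e \<union> east_region e"
proof -
  define X where "X = verts G \<union> (\<Union>d\<in>arcs G - {e}. path_image (\<gamma> d))"
  note X = rest_of_graph[OF assms(1), folded X_def]
  define W where "W = connected_component_set (- X) x"
  have "open (- X)" using X(1) compact_imp_closed by blast
  then have "open W" unfolding W_def by (rule open_connected_component)
  have "connected W" unfolding W_def by (rule connected_connected_component)
  have WX: "W \<subseteq> - X" unfolding W_def by (rule connected_component_subset)
  have "x \<in> - X" using X(5) assms(2) by (auto simp: edge_interior_def)
  then have "x \<in> W" by (simp add: W_def connected_component_refl)
  have WS: "W \<inter> support \<subseteq> edge_interior e"
    using WX X(2) path_image_edge[OF assms(1)] assms(1) by (auto simp: X_def)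
  have "W \<subseteq> edge_interior e \<union> west_region e \<union> east_region e"
  proof
    fix y assume "y \<in> W"
    show "y \<in> edge_interior e \<union> west_region e \<union> east_region e"
    proof (cases "y \<in> support")
      case True
      then show ?thesis using WS \<open>y \<in> W\<close> by auto
    next
      case False
      then obtain R where R: "R \<in> regular_regions" "y \<in> R"
        using region_superset[of "{y}"] by auto
      have "x \<in> support"
        using assms path_image_edge[OF assms(1)] path_image_support[OF assms(1)] by auto
      then have "frontier R \<inter> (W \<inter> support) \<noteq> {}"
        using component_meets_frontier[OF \<open>open W\<close> \<open>connected W\<close>, of R support] R \<open>y \<in> W\<close> \<open>x \<in> W\<close> closed_support
        by (auto simp: regular_regions_def)
      then have "frontier R \<inter> edge_interior e \<noteq> {}" using WS by blast
      then show ?thesis using region_beside_edge[OF assms(1) R(1)] R(2) by auto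
    qed
  qed
  then show ?thesis using that \<open>open W\<close> \<open>x \<in> W\<close> by blast
qed

text \<open>
  The plane without the vertices is connected, and it would be covered by two disjoint open sets:
  the regions in \<open>Y\<close> with the edges between them, and the other regions with theirs.
\<close>

lemma regions_connected_across_edges:
  assumes "Y \<noteq> {}" "Y \<subset> regular_regions"
  shows "\<exists>e\<in>arcs G. (west_region e \<in> Y) \<noteq> (east_region e \<in> Y)"
proof (rule ccontr)
  assume "\<not> ?thesis"
  then have same: "west_region e \<in> Y \<longleftrightarrow> east_region e \<in> Y" if "e \<in> arcs G" for e using that by blast
  define U where "U Z = \<Union>Z \<union> (\<Union>e\<in>{e \<in> arcs G. west_region e \<in> Z}. edge_interior e)" for Z
  have open_U: "open (U Z)"
    if Z: "Z \<subseteq> regular_regions" "\<And>e. e \<in> arcs G \<Longrightarrow> west_region e \<in> Z \<Longrightarrow> east_region e \<in> Z" for Z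
  proof (subst open_subopen, intro ballI)
    fix x assume "x \<in> U Z"
    then consider R where "R \<in> Z" "x \<in> R" | e where "e \<in> arcs G" "west_region e \<in> Z" "x \<in> edge_interior e"
      by (auto simp: U_def)
    then show "\<exists>T. open T \<and> x \<in> T \<and> T \<subseteq> U Z"
    proof cases
      case 1
      then show ?thesis using Z(1) regular_region(1) by (intro exI[of _ R]) (auto simp: U_def)
    next
      case 2
      obtain W where "open W" "x \<in> W" "W \<subseteq> edge_interior e \<union> west_region e \<union> east_region e"
        using edge_neighbourhood[OF 2(1,3)] .
      then show ?thesis using 2 Z(2)[OF 2(1,2)] by (intro exI[of _ W]) (auto simp: U_def)
    qed
  qed
  have "open (U Y)" "open (U (regular_regions - Y))"
    using assms(2) same west_east_regions by (auto intro!: open_U)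
  moreover have "connected (- verts G)"
  proof -
    have "countable (verts G)" by (simp add: countable_finite)
    then show ?thesis
      using path_connected_complement_countable[of "verts G"] path_connected_imp_connected by auto
  qed
  moreover have "- verts G \<subseteq> U Y \<union> U (regular_regions - Y)"
  proof
    fix x assume x: "x \<in> - verts G"
    show "x \<in> U Y \<union> U (regular_regions - Y)"
    proof (cases "x \<in> support")
      case True
      then obtain e where "e \<in> arcs G" "x \<in> edge_interior e"
        using x path_image_edge by (auto simp: support_def)
      then show ?thesis using west_east_regions(1) by (auto simp: U_def)
    next
      case False
      then obtain R where "R \<in> regular_regions" "x \<in> R"
        using region_superset[of "{x}"] by auto
      then show ?thesis by (auto simp: U_def)
    qed
  qed
  moreover have "U Y \<inter> U (regular_regions - Y) \<inter> - verts G = {}"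
  proof -
    have int: "edge_interior e \<subseteq> support" if "e \<in> arcs G" for e
      using path_image_edge[OF that] path_image_support[OF that] by auto
    have mixed: "R \<inter> edge_interior e = {}" if "R \<in> regular_regions" "e \<in> arcs G" for R e
      using int[OF that(2)] regular_region(4)[OF that(1)] by blast
    have edges: "edge_interior e \<inter> edge_interior d = {}"
      if "e \<in> arcs G" "d \<in> arcs G" "west_region e \<in> Y" "west_region d \<notin> Y" for e d
      using disjoint_edges[OF that(1,2)] that(3,4) by metis
    have regs: "R \<inter> R' = {}" if "R \<in> Y" "R' \<in> regular_regions - Y" for R R'
      using regions_disjoint[of R R'] that assms(2) by blast
    have "\<Union>Y \<inter> \<Union>(regular_regions - Y) = {}" using regs by blast
    moreover have "\<Union>Y \<inter> edge_interior e = {}" "\<Union>(regular_regions - Y) \<inter> edge_interior e = {}" if "e \<in> arcs G" for e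
      using mixed[OF _ that] assms(2) by blast+
    ultimately have "U Y \<inter> U (regular_regions - Y) = {}"
      using edges unfolding U_def by blast
    then show ?thesis by blast
  qed
  moreover have "U Y \<inter> - verts G \<noteq> {}" "U (regular_regions - Y) \<inter> - verts G \<noteq> {}"
  proof -
    have "U Z \<inter> - verts G \<noteq> {}" if Z: "Z \<noteq> {}" "Z \<subseteq> regular_regions" for Z
    proof -
      have "\<exists>R. R \<in> Z" using Z(1) by auto
      then obtain R where R: "R \<in> Z" "R \<in> regular_regions" using Z(2) by blast
      then obtain x where "x \<in> R" "x \<notin> support" using regular_region(3,4)[OF R(2)] by blast
      then show ?thesis using R(1) by (auto simp: U_def support_def)
    qed
    then show "U Y \<inter> - verts G \<noteq> {}" "U (regular_regions - Y) \<inter> - verts G \<noteq> {}"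
      using assms by auto
  qed
  ultimately show False
    using connectedD[of "- verts G" "U Y" "U (regular_regions - Y)"] by blast
qed

lemma regular_regions_eq:
  assumes "arcs G \<noteq> {}"
  shows "regular_regions = west_region ` arcs G \<union> east_region ` arcs G"
proof (rule ccontr)
  assume "regular_regions \<noteq> west_region ` arcs G \<union> east_region ` arcs G"
  moreover have "west_region ` arcs G \<union> east_region ` arcs G \<subseteq> regular_regions"
    using west_east_regions(1,2) by auto
  ultimately have "west_region ` arcs G \<union> east_region ` arcs G \<subset> regular_regions"
    by (simp add: psubset_eq)
  then show False
    using regions_connected_across_edges[of "west_region ` arcs G \<union> east_region ` arcs G"] assms by auto
qed

lemma balanced_edge_ends: "card (edge_ends v) \<noteq> 1"
proof (cases "v \<in> verts G")
  case True
  have "card (edge_ends v) = card (Incoming ` in_arcs G v) + card (Outgoing ` out_arcs G v)"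
    unfolding edge_ends_def by (intro card_Un_disjoint) auto
  also have "\<dots> = 2 * in_degree G v"
    using balanced[OF True] by (simp add: card_image inj_on_def in_degree_def out_degree_def)
  finally show ?thesis by presburger
next
  case False
  then have "edge_ends v = {}" by (auto simp: edge_ends_def)
  then show ?thesis by simp
qed

text \<open>
  Going counter-clockwise, one meets the east region after an incoming end but the west region after
  an outgoing one; so in the sum over one turn the two kinds of edges have opposite signs.
\<close>

lemma planar_map_regions:
  assumes "arcs G \<noteq> {}"
  shows "planar_map (verts G) (arcs G) regular_regions (tail G) (head G) west_region east_region region_winding"
proof
  show "finite regular_regions" using regular_regions_eq[OF assms] by simp
  show "card {e \<in> arcs G. head G e = v} = card {e \<in> arcs G. tail G e = v}" if "v \<in> verts G" for v
    using balanced[OF that] by (simp add: in_degree_def out_degree_def in_arcs_def out_arcs_def)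
  show "flow_potential g (west_region e) - flow_potential g (east_region e) = g e"
    if "\<And>v. v \<in> verts G \<Longrightarrow> (\<Sum>e | e \<in> arcs G \<and> head G e = v. g e) = (\<Sum>e | e \<in> arcs G \<and> tail G e = v. g e)"
      "e \<in> arcs G" for g e
    using winding_jump_in[OF that(2), of g] that(1) by (simp add: flow_def west_region_side east_region_side)
  show "(\<Sum>e | e \<in> arcs G \<and> head G e = v. J (west_region e) - J (east_region e)) =
      (\<Sum>e | e \<in> arcs G \<and> tail G e = v. J (west_region e) - J (east_region e))" for v and J :: "complex set \<Rightarrow> real"
  proof -
    have "(\<Sum>p\<in>edge_ends v. J (ccw_side v (end_point p)) - J (cw_side v (end_point p))) = 0"
      using rotation_ends[OF balanced_edge_ends, of J v] by (simp add: sum_subtractf)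
    moreover have "(\<Sum>p\<in>edge_ends v. J (ccw_side v (end_point p)) - J (cw_side v (end_point p))) =
        (\<Sum>e | e \<in> arcs G \<and> head G e = v. J (east_region e) - J (west_region e)) +
        (\<Sum>e | e \<in> arcs G \<and> tail G e = v. J (west_region e) - J (east_region e))"
      unfolding edge_ends_split
      by (intro arg_cong2[where f="(+)"] sum.cong) (auto simp: west_region_side east_region_side sides_at_tail[unfolded west_region_side east_region_side])
    ultimately show ?thesis by (simp add: sum_subtractf)
  qed
  show "J (west_region e) = J (west_region e')"
    if v: "v \<in> verts G" and J: "\<And>e. e \<in> arcs G \<Longrightarrow> head G e = v \<or> tail G e = v \<Longrightarrow> J (west_region e) = J (east_region e)"
      and e: "e \<in> arcs G" "head G e = v \<or> tail G e = v" and e': "e' \<in> arcs G" "head G e' = v \<or> tail G e' = v"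
    for v e e' and J :: "complex set \<Rightarrow> real"
  proof -
    have "J (ccw_side v (end_point p)) = J (cw_side v (end_point p))" if "p \<in> edge_ends v" for p
      using that J by (cases p) (auto simp: edge_ends_def west_region_side[symmetric] east_region_side[symmetric] sides_at_tail)
    then have const: "J (cw_side v (end_point p)) = J (cw_side v (end_point b))"
      if "p \<in> edge_ends v" "b \<in> edge_ends v" for p b
      using constant_around_vertex[of v J b p] that by blast
    have "\<exists>p\<in>edge_ends v. J (west_region d) = J (cw_side v (end_point p))"
      if "d \<in> arcs G" "head G d = v \<or> tail G d = v" for d
      using that(2)
    proof
      assume "head G d = v"
      then show ?thesis using ends_of_edge(1)[OF that(1)]
        by (intro bexI[of _ "Incoming d"]) (simp_all add: west_region_side)
    next
      assume "tail G d = v"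
      then show ?thesis
        using ends_of_edge(2)[OF that(1)] sides_at_tail(2)[OF that(1)] J[OF that] by (auto intro!: bexI[of _ "Outgoing d"])
    qed
    from this[OF e] this[OF e'] show ?thesis using const by metis
  qed
  show "\<exists>e\<in>arcs G. (west_region e \<in> Y) \<noteq> (east_region e \<in> Y)" if "Y \<noteq> {}" "Y \<subset> regular_regions" for Y
    using regions_connected_across_edges[OF that] .
qed (use west_east_regions in auto)

end

section \<open>States, lattice points and trees\<close>

lemma bij_betw_hits: "bij_betw f A B \<Longrightarrow> y \<in> B \<Longrightarrow> \<exists>x\<in>A. f x = y"
  by (auto simp: bij_betw_def)

lemma bij_betw_rank:
  fixes f :: "'a \<Rightarrow> 'b::linorder"
  assumes "finite A" "inj_on f A"
  shows "bij_betw (\<lambda>x. card {y \<in> A. f y \<le> f x}) A {1..card A}"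
proof -
  let ?r = "\<lambda>x. card {y \<in> A. f y \<le> f x}"
  have less: "?r x < ?r y" if "x \<in> A" "y \<in> A" "f x < f y" for x y
  proof (rule psubset_card_mono)
    show "{z \<in> A. f z \<le> f x} \<subset> {z \<in> A. f z \<le> f y}"
    proof
      show "{z \<in> A. f z \<le> f x} \<subseteq> {z \<in> A. f z \<le> f y}" using that(3) by auto
      have "y \<notin> {z \<in> A. f z \<le> f x}" "y \<in> {z \<in> A. f z \<le> f y}" using that(2,3) by auto
      then show "{z \<in> A. f z \<le> f x} \<noteq> {z \<in> A. f z \<le> f y}" by blast
    qed
  qed (use \<open>finite A\<close> in simp)
  have "inj_on ?r A"
  proof (rule inj_onI, rule ccontr)
    fix x y assume xy: "x \<in> A" "y \<in> A" "?r x = ?r y" "x \<noteq> y"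
    then have "f x < f y \<or> f y < f x"
      using inj_onD[OF assms(2)] by (metis linorder_neqE)
    then show False using less[of x y] less[of y x] xy by auto
  qed
  moreover have "?r ` A \<subseteq> {1..card A}"
  proof
    fix k assume "k \<in> ?r ` A"
    then obtain x where x: "x \<in> A" "k = ?r x" by auto
    have "0 < ?r x" using x(1) \<open>finite A\<close> by (auto simp: card_gt_0_iff)
    moreover have "?r x \<le> card A" using \<open>finite A\<close> by (intro card_mono) auto
    ultimately show "k \<in> {1..card A}" using x(2) by simp
  qed
  moreover have "card (?r ` A) = card {1..card A}"
    using card_image[OF \<open>inj_on ?r A\<close>] by simp
  ultimately show ?thesis
    unfolding bij_betw_def using card_subset_eq[OF finite_atLeastAtMost, of "?r ` A" 1 "card A"] by simp
qed

lemma (in pre_digraph) cas_tails_heads: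
  "cas u p v \<Longrightarrow> insert u (head G ` set p) = insert v (tail G ` set p)"
  by (induction p arbitrary: u) (auto simp: insert_commute)

text \<open>
  If every tail in \<open>C\<close> is also a head in \<open>C\<close>, walks can be extended backwards without end, and a walk
  longer than the number of vertices contains a cycle.
\<close>

lemma (in fin_digraph) cycle_iff_arc_set:
  "(\<exists>p. cycle p) \<longleftrightarrow> (\<exists>C\<subseteq>arcs G. C \<noteq> {} \<and> tail G ` C = head G ` C)"
proof
  assume "\<exists>p. cycle p"
  then obtain p u where p: "awalk u p u" "p \<noteq> []" by (auto simp: cycle_def)
  then obtain e es where p_eq: "p = e # es" by (cases p) auto
  have "tail G e = u" "cas (head G e) es u" using p p_eq by (auto simp: awalk_def)
  then have "tail G ` set p = head G ` set p"
    using cas_tails_heads[of "head G e" es u] by (simp add: p_eq)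
  then show "\<exists>C\<subseteq>arcs G. C \<noteq> {} \<and> tail G ` C = head G ` C"
    using p by (intro exI[of _ "set p"]) (auto simp: awalk_def)
next
  assume "\<exists>C\<subseteq>arcs G. C \<noteq> {} \<and> tail G ` C = head G ` C"
  then obtain C where C: "C \<subseteq> arcs G" "C \<noteq> {}" "tail G ` C = head G ` C" by auto
  have "\<exists>p u v. awalk u p v \<and> length p = n \<and> u \<in> head G ` C" for n
  proof (induction n)
    case 0
    obtain e where "e \<in> C" using C by auto
    then have "awalk (head G e) [] (head G e)" "head G e \<in> head G ` C" using C by (auto simp: awalk_Nil_iff)
    then show ?case by (intro exI[of _ "[]"] exI[of _ "head G e"]) simp
  next
    case (Suc n)
    then obtain p u v where p: "awalk u p v" "length p = n" "u \<in> head G ` C" by blast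
    then obtain e where e: "e \<in> C" "head G e = u" by auto
    have "awalk (tail G e) (e # p) v" using e p C by (auto simp: awalk_Cons_iff)
    moreover have "tail G e \<in> head G ` C" using e C(3) by blast
    moreover have "length (e # p) = Suc n" using p(2) by simp
    ultimately show ?case by blast
  qed
  then obtain p u v where p: "awalk u p v" "length p = card (verts G)" by blast
  have "\<not> distinct (awalk_verts u p)"
  proof
    assume "distinct (awalk_verts u p)"
    then have "card (set (awalk_verts u p)) = Suc (length p)"
      by (simp add: distinct_card length_awalk_verts)
    moreover have "set (awalk_verts u p) \<subseteq> verts G" using awalkE'[OF p(1)] p(1) awalk_conv by blast
    ultimately show False using p(2) card_mono[OF finite_verts, of "set (awalk_verts u p)"] by simp
  qed
  then obtain r w where "awalk w r w" "0 < length r"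
    using awalk_not_distinct_decomp[OF p(1)] by blast
  then have "closed_w r" by (auto simp: closed_w_def)
  then show "\<exists>p. cycle p" by (rule closed_w_imp_cycle)
qed

lemma prod_fls_X_intpow:
  "finite A \<Longrightarrow> (\<Prod>a\<in>A. fls_X_intpow (k a) :: 'b::comm_semiring_1 fls) = fls_X_intpow (\<Sum>a\<in>A. k a)"
proof (induction A rule: finite_induct)
  case (insert a A)
  have "(\<Prod>a\<in>insert a A. fls_X_intpow (k a) :: 'b fls) = fls_X_intpow (k a) * fls_X_intpow (\<Sum>a\<in>A. k a)"
    using insert by simp
  also have "\<dots> = fls_X_intpow (k a + (\<Sum>a\<in>A. k a))" by (rule fls_X_intpow_times_fls_X_intpow)
  finally show ?case using insert by simp
qed simp

context balanced_transverse_plane_graph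
begin

text \<open>
  The incoming end from which the consecutive incoming ends are counted is the only one whose
  predecessor is an outgoing end.
\<close>

lemma leftmost_in:
  assumes v: "v \<in> verts G" and ne: "in_arcs G v \<noteq> {}"
  shows "leftmost_in v \<in> in_arcs G v"
    and "e \<in> in_arcs G v \<Longrightarrow> f \<in> out_arcs G v \<Longrightarrow>
      ccw_angle v (Incoming (leftmost_in v)) (Incoming e) < ccw_angle v (Incoming (leftmost_in v)) (Outgoing f)"
proof -
  obtain e\<^sub>1 where e\<^sub>1: "e\<^sub>1 \<in> in_arcs G v"
    and first: "\<And>q q'. q \<in> Incoming ` in_arcs G v \<Longrightarrow> q' \<in> edge_ends v - Incoming ` in_arcs G v \<Longrightarrow>
      ccw_angle v (Incoming e\<^sub>1) q < ccw_angle v (Incoming e\<^sub>1) q'"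
    using transverse_in[OF v] ne unfolding consecutive_ends_def by blast
  have inE: "Incoming e \<in> edge_ends v" if "e \<in> in_arcs G v" for e using that by (simp add: edge_ends_def)
  have outE: "Outgoing f \<in> edge_ends v" if "f \<in> out_arcs G v" for f using that by (simp add: edge_ends_def)
  have less: "ccw_angle v (Incoming e\<^sub>1) (Incoming e) < ccw_angle v (Incoming e\<^sub>1) (Outgoing f)"
    if "e \<in> in_arcs G v" "f \<in> out_arcs G v" for e f
    using first[of "Incoming e" "Outgoing f"] that outE by auto
  have "card (in_arcs G v) \<noteq> 0" using ne finite_in_arcs by (metis card_0_eq)
  then have "out_arcs G v \<noteq> {}"
    using balanced[OF v] by (metis card.empty in_degree_def out_degree_def)
  then obtain f\<^sub>0 where f\<^sub>0: "f\<^sub>0 \<in> out_arcs G v" by blast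
  let ?b = "Incoming e\<^sub>1"
  have eq: "leftmost_in v = e\<^sub>1"
    unfolding leftmost_in_def
  proof (rule the_equality)
    obtain p where p: "p \<in> edge_ends v" "ccw_next v p ?b"
      using ccw_predecessor[OF outE[OF f\<^sub>0] inE[OF e\<^sub>1]] by blast
    have "p \<notin> Incoming ` in_arcs G v"
    proof
      assume pin: "p \<in> Incoming ` in_arcs G v"
      have "p \<noteq> ?b" using p(2) by (auto simp: ccw_next_def)
      then have "0 < ccw_angle v ?b p" using ccw_angle_pos inE[OF e\<^sub>1] p(1) by blast
      moreover have "ccw_angle v ?b p < ccw_angle v ?b (Outgoing f\<^sub>0)"
        using first[OF pin, of "Outgoing f\<^sub>0"] outE[OF f\<^sub>0] by auto
      moreover have "ccw_angle v p ?b \<le> ccw_angle v p (Outgoing f\<^sub>0)"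
        using p(2) outE[OF f\<^sub>0] pin unfolding ccw_next_def by auto
      ultimately show False
        using ccw_angle_change_base[OF inE[OF e\<^sub>1] p(1) inE[OF e\<^sub>1]]
          ccw_angle_change_base[OF inE[OF e\<^sub>1] p(1) outE[OF f\<^sub>0]]
          ccw_angle_self[OF inE[OF e\<^sub>1]] ccw_angle_bounds(2)[of v ?b "Outgoing f\<^sub>0"] by simp
    qed
    then obtain f where "p = Outgoing f" "f \<in> out_arcs G v" using p(1) by (auto simp: edge_ends_def)
    then show "e\<^sub>1 \<in> in_arcs G v \<and> (\<exists>f\<in>out_arcs G v. ccw_next v (Outgoing f) (Incoming e\<^sub>1))"
      using e\<^sub>1 p(2) by blast
  next
    fix e assume e: "e \<in> in_arcs G v \<and> (\<exists>f\<in>out_arcs G v. ccw_next v (Outgoing f) (Incoming e))"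
    then obtain f where f: "f \<in> out_arcs G v" "ccw_next v (Outgoing f) (Incoming e)" by blast
    show "e = e\<^sub>1"
    proof (rule ccontr)
      assume "e \<noteq> e\<^sub>1"
      then have "0 < ccw_angle v ?b (Incoming e)" using ccw_angle_pos[OF inE[OF e\<^sub>1] inE[of e]] e by auto
      moreover have "ccw_angle v (Outgoing f) (Incoming e) \<le> ccw_angle v (Outgoing f) ?b"
        using f(2) inE[OF e\<^sub>1] unfolding ccw_next_def by auto
      ultimately show False
        using ccw_angle_change_base[OF inE[OF e\<^sub>1] outE[OF f(1)] inE[OF e\<^sub>1]] less[of e f] e f(1)
          ccw_angle_change_base[OF inE[OF e\<^sub>1] outE[OF f(1)] inE[of e]] ccw_angle_self[OF inE[OF e\<^sub>1]]
          less[OF e\<^sub>1 f(1)] by auto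
    qed
  qed
  show "leftmost_in v \<in> in_arcs G v" using e\<^sub>1 eq by simp
  show "e \<in> in_arcs G v \<Longrightarrow> f \<in> out_arcs G v \<Longrightarrow>
      ccw_angle v (Incoming (leftmost_in v)) (Incoming e) < ccw_angle v (Incoming (leftmost_in v)) (Outgoing f)"
    unfolding eq by (rule less)
qed

lemma inj_on_angle_in:
  assumes "v \<in> verts G"
  shows "inj_on (\<lambda>e. ccw_angle v (Incoming (leftmost_in v)) (Incoming e)) (in_arcs G v)"
proof (rule inj_onI)
  fix e e' assume ee': "e \<in> in_arcs G v" "e' \<in> in_arcs G v"
    "ccw_angle v (Incoming (leftmost_in v)) (Incoming e) = ccw_angle v (Incoming (leftmost_in v)) (Incoming e')"
  have "leftmost_in v \<in> in_arcs G v" using leftmost_in(1)[OF assms] ee'(1) by blast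
  then have "Incoming e = Incoming e'"
    using ee' by (intro ccw_angle_inj[of "Incoming (leftmost_in v)" v]) (auto simp: edge_ends_def)
  then show "e = e'" by simp
qed

lemma bij_in_position:
  assumes "v \<in> verts G"
  shows "bij_betw (in_position v) (in_arcs G v) {1..in_degree G v}"
  using bij_betw_rank[OF finite_in_arcs inj_on_angle_in[OF assms]]
  by (simp add: in_position_def[abs_def] in_degree_def)

lemma in_edge:
  assumes "v \<in> verts G"
  shows "j \<in> {1..in_degree G v} \<Longrightarrow> in_edge v j \<in> in_arcs G v \<and> in_position v (in_edge v j) = j"
    and "e \<in> in_arcs G v \<Longrightarrow> in_edge v (in_position v e) = e"
proof -
  note bij = bij_in_position[OF assms]
  show eq: "in_edge v (in_position v e) = e" if "e \<in> in_arcs G v" for e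
    unfolding in_edge_def
  proof (rule the_equality)
    show "e' = e" if e': "e' \<in> in_arcs G v \<and> in_position v e' = in_position v e" for e'
      using inj_onD[OF bij_betw_imp_inj_on[OF bij], of e' e] e' \<open>e \<in> in_arcs G v\<close> by blast
  qed (use that in simp)
  show "in_edge v j \<in> in_arcs G v \<and> in_position v (in_edge v j) = j" if "j \<in> {1..in_degree G v}"
  proof -
    obtain e where "e \<in> in_arcs G v" "j = in_position v e"
      using bij_betw_hits[OF bij \<open>j \<in> _\<close>] by blast
    then show ?thesis using eq[of e] by simp
  qed
qed

text \<open>
  The incoming end before \<open>e\<close> belongs to an edge whose east region is the west region of \<open>e\<close>, and the
  numbering drops by one from the west to the east of an edge.
\<close>

lemma numbering_in_position:
  assumes v: "v \<in> verts G" and e: "e \<in> in_arcs G v"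
  shows "alexander_numbering (west_region e) =
    alexander_numbering (west_region (leftmost_in v)) + 1 - real (in_position v e)"
  using e
proof (induction "in_position v e" arbitrary: e rule: less_induct)
  case less
  define l where "l = leftmost_in v"
  let ?\<alpha> = "\<lambda>e. ccw_angle v (Incoming l) (Incoming e)"
  have l: "l \<in> in_arcs G v" unfolding l_def using leftmost_in(1)[OF v] less.prems by blast
  have inE: "Incoming e \<in> edge_ends v" if "e \<in> in_arcs G v" for e using that by (simp add: edge_ends_def)
  have pos: "in_position v e = card {f \<in> in_arcs G v. ?\<alpha> f \<le> ?\<alpha> e}" for e
    by (simp add: in_position_def l_def)
  have inj: "f = f'" if "f \<in> in_arcs G v" "f' \<in> in_arcs G v" "?\<alpha> f = ?\<alpha> f'" for f f'
    using inj_onD[OF inj_on_angle_in[OF v]] that unfolding l_def by blast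
  show ?case
  proof (cases "e = l")
    case True
    have "{f \<in> in_arcs G v. ?\<alpha> f \<le> ?\<alpha> l} = {l}"
      using inj[OF _ l] l ccw_angle_self[OF inE[OF l]] ccw_angle_bounds(1)[of v "Incoming l"]
      by (auto simp del: in_in_arcs_conv intro: antisym)
    then show ?thesis using True pos[of e] by (simp add: l_def)
  next
    case False
    then obtain p where p: "p \<in> edge_ends v" "ccw_next v p (Incoming e)"
        "ccw_angle v (Incoming l) p < ?\<alpha> e"
      and nearest: "\<And>x. x \<in> edge_ends v \<Longrightarrow> ccw_angle v (Incoming l) x < ?\<alpha> e \<Longrightarrow>
        ccw_angle v (Incoming l) x \<le> ccw_angle v (Incoming l) p"
      using ccw_predecessor[OF inE[OF l] inE[OF less.prems]] by (metis edge_end.inject(1))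
    have "\<exists>e'\<in>in_arcs G v. p = Incoming e'"
    proof (rule ccontr)
      assume "\<not> ?thesis"
      then obtain f where "f \<in> out_arcs G v" "p = Outgoing f" using p(1) by (auto simp: edge_ends_def)
      then show False using leftmost_in(2)[OF v _ less.prems] less.prems p(3) by (fastforce simp: l_def)
    qed
    then obtain e' where e': "e' \<in> in_arcs G v" "p = Incoming e'" by blast
    have "{f \<in> in_arcs G v. ?\<alpha> f \<le> ?\<alpha> e} = insert e {f \<in> in_arcs G v. ?\<alpha> f \<le> ?\<alpha> e'}"
    proof (intro equalityI subsetI)
      fix f assume f: "f \<in> {f \<in> in_arcs G v. ?\<alpha> f \<le> ?\<alpha> e}"
      show "f \<in> insert e {f \<in> in_arcs G v. ?\<alpha> f \<le> ?\<alpha> e'}"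
      proof (cases "?\<alpha> f = ?\<alpha> e")
        case True
        then show ?thesis using inj[of f e] f less.prems by auto
      next
        case False
        then show ?thesis using nearest[OF inE[of f]] f e' by auto
      qed
    qed (use less.prems p(3) e' in auto)
    moreover have "e \<notin> {f \<in> in_arcs G v. ?\<alpha> f \<le> ?\<alpha> e'}" using p(3) e' by auto
    ultimately have step: "in_position v e = in_position v e' + 1"
      unfolding pos by simp
    have "west_region e = east_region e'"
      using ccw_next_region[OF p(1,2)] e' less.prems by (simp add: west_region_side east_region_side)
    moreover have "alexander_numbering (west_region e') = alexander_numbering (east_region e') + 1"
      using west_east_regions(5) e' by simp
    ultimately show ?thesis
      using less.hyps[OF _ e'(1)] step by simp
  qed
qed

abbreviation rooted :: "'a \<Rightarrow> 'a set \<Rightarrow> bool" where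
  "rooted \<equiv> rooted_planar_map (verts G) (arcs G) regular_regions (tail G) (head G) west_region east_region region_winding"

abbreviation matches :: "'a \<Rightarrow> 'a set \<Rightarrow> ('a \<Rightarrow> complex set) \<Rightarrow> bool" where
  "matches \<equiv> rooted_planar_map.matching (arcs G) regular_regions west_region east_region"

abbreviation cycle_free_arcs :: "'a set \<Rightarrow> bool" where
  "cycle_free_arcs \<equiv> rooted_planar_map.cycle_free (tail G) (head G)"

lemma rootedI:
  assumes "e\<^sub>0 \<in> arcs G" "T \<subseteq> arcs G - {e\<^sub>0}" "\<And>v. v \<in> verts G - {head G e\<^sub>0} \<Longrightarrow> \<exists>e\<in>T. head G e = v"
    and "inj_on (head G) T" "\<And>e. e \<in> T \<Longrightarrow> head G e \<noteq> head G e\<^sub>0"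
  shows "rooted e\<^sub>0 T"
  unfolding rooted_planar_map_def rooted_planar_map_axioms_def using planar_map_regions assms by blast

lemma rootedD:
  assumes "rooted e\<^sub>0 T"
  shows "e\<^sub>0 \<in> arcs G" "T \<subseteq> arcs G - {e\<^sub>0}" "bij_betw (head G) T (verts G - {head G e\<^sub>0})"
proof -
  note T = assms[unfolded rooted_planar_map_def rooted_planar_map_axioms_def]
  show e: "e\<^sub>0 \<in> arcs G" "T \<subseteq> arcs G - {e\<^sub>0}" using T by blast+
  have "head G ` T = verts G - {head G e\<^sub>0}"
  proof
    show "head G ` T \<subseteq> verts G - {head G e\<^sub>0}" using T e by (auto dest: head_in_verts)
    show "verts G - {head G e\<^sub>0} \<subseteq> head G ` T" using T by (metis imageI subsetI)
  qed
  then show "bij_betw (head G) T (verts G - {head G e\<^sub>0})" using T by (simp add: bij_betw_def)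
qed

definition north_edges :: "'a \<Rightarrow> ('a \<Rightarrow> corner) \<Rightarrow> 'a set" where
  "north_edges e\<^sub>0 s = {e \<in> arcs G - {e\<^sub>0}. s e = North}"

definition chosen_region :: "('a \<Rightarrow> corner) \<Rightarrow> 'a \<Rightarrow> complex set" where
  "chosen_region s e = (if s e = West then west_region e else east_region e)"

abbreviation far_regions :: "'a \<Rightarrow> complex set set" where
  "far_regions e\<^sub>0 \<equiv> regular_regions - {west_region e\<^sub>0, east_region e\<^sub>0}"

lemma target_regions:
  assumes "e\<^sub>0 \<in> arcs G" "\<delta> \<in> edge_interior e\<^sub>0"
  shows "regions - Regular ` adjacent_regions \<delta> =
    Regular ` far_regions e\<^sub>0 \<union> Circle ` verts G"
  unfolding adjacent_regions_edge[OF assms] regions_def by auto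

text \<open>
  The circle regions are hit by north corners only, each once; the regular regions are hit by the
  remaining edges.
\<close>

lemma state_north:
  assumes "e\<^sub>0 \<in> arcs G" "\<delta> \<in> edge_interior e\<^sub>0" and s: "s \<in> kauffman_states \<delta>"
  shows "s e\<^sub>0 = North" "rooted e\<^sub>0 (north_edges e\<^sub>0 s)" "matches e\<^sub>0 (north_edges e\<^sub>0 s) (chosen_region s)"
proof -
  let ?c = "\<lambda>e. corner_region e (s e)" and ?T = "north_edges e\<^sub>0 s"
  have bij: "bij_betw ?c (arcs G)
      (Regular ` far_regions e\<^sub>0 \<union> Circle ` verts G)"
    using s target_regions[OF assms(1,2)] by (simp add: kauffman_states_def)
  have range: "?c e \<in> Regular ` far_regions e\<^sub>0 \<union> Circle ` verts G"
    if "e \<in> arcs G" for e using bij_betw_apply[OF bij that] .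
  have inj: "e = e'" if "e \<in> arcs G" "e' \<in> arcs G" "?c e = ?c e'" for e e'
    using bij that unfolding bij_betw_def inj_on_def by blast
  show north0: "s e\<^sub>0 = North"
    using range[OF assms(1)] by (cases "s e\<^sub>0") auto
  have circle: "\<exists>e\<in>arcs G. s e = North \<and> head G e = v" if "v \<in> verts G" for v
  proof -
    have "\<exists>e\<in>arcs G. ?c e = Circle v"
      using that by (intro bij_betw_hits[OF bij]) auto
    then obtain e where "e \<in> arcs G" "?c e = Circle v" by blast
    then show ?thesis by (cases "s e") auto
  qed
  show rooted: "rooted e\<^sub>0 ?T"
  proof (rule rootedI[OF assms(1)])
    show "?T \<subseteq> arcs G - {e\<^sub>0}" by (auto simp: north_edges_def)
    show "\<exists>e\<in>?T. head G e = v" if "v \<in> verts G - {head G e\<^sub>0}" for v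
      using circle[of v] that by (auto simp: north_edges_def)
    show "inj_on (head G) ?T"
      by (rule inj_onI, rule inj) (auto simp: north_edges_def)
    show "head G e \<noteq> head G e\<^sub>0" if "e \<in> ?T" for e
      using inj[of e e\<^sub>0] that north0 assms(1) by (auto simp: north_edges_def)
  qed
  have free: "e \<in> arcs G - ?T - {e\<^sub>0} \<Longrightarrow> e \<in> arcs G \<and> ?c e = Regular (chosen_region s e)" for e
    by (cases "s e") (auto simp: north_edges_def chosen_region_def)
  have "bij_betw (chosen_region s) (arcs G - ?T - {e\<^sub>0}) (far_regions e\<^sub>0)"
    unfolding bij_betw_def
  proof (intro conjI equalityI subsetI)
    show "inj_on (chosen_region s) (arcs G - ?T - {e\<^sub>0})"
      by (rule inj_onI) (metis free inj)
    show "R \<in> far_regions e\<^sub>0"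
      if R: "R \<in> chosen_region s ` (arcs G - ?T - {e\<^sub>0})" for R
    proof -
      obtain e where "R = chosen_region s e" "e \<in> arcs G - ?T - {e\<^sub>0}" using R by blast
      then show ?thesis using free[of e] range[of e] by auto
    qed
    show "R \<in> chosen_region s ` (arcs G - ?T - {e\<^sub>0})"
      if R: "R \<in> far_regions e\<^sub>0" for R
    proof -
      have "\<exists>e\<in>arcs G. ?c e = Regular R"
        using R by (intro bij_betw_hits[OF bij]) auto
      then obtain e where e: "e \<in> arcs G" "?c e = Regular R" by blast
      then have "e \<in> arcs G - ?T - {e\<^sub>0}" using north0 by (auto simp: north_edges_def)
      then show ?thesis using free[of e] e by auto
    qed
  qed
  then show "matches e\<^sub>0 ?T (chosen_region s)"
    unfolding rooted_planar_map.matching_def[OF rooted] rooted_planar_map.free_edges_def[OF rooted]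
      rooted_planar_map.free_faces_def[OF rooted]
    by (auto simp: chosen_region_def)
qed

lemma state_of_matching:
  assumes "\<delta> \<in> edge_interior e\<^sub>0" and T: "rooted e\<^sub>0 T" and m: "matches e\<^sub>0 T m"
  shows "\<exists>s\<in>kauffman_states \<delta>. north_edges e\<^sub>0 s = T"
proof -
  note T' = rootedD[OF T]
  note m' = m[unfolded rooted_planar_map.matching_def[OF T] rooted_planar_map.free_edges_def[OF T]
      rooted_planar_map.free_faces_def[OF T]]
  define s where "s = (\<lambda>e\<in>arcs G. if e \<in> insert e\<^sub>0 T then North else if m e = west_region e then West else East)"
  have circle: "corner_region e (s e) = Circle (head G e)" if "e \<in> insert e\<^sub>0 T" for e
    using that T'(1,2) by (auto simp: s_def)
  have regular: "corner_region e (s e) = Regular (m e)" if "e \<in> arcs G - T - {e\<^sub>0}" for e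
    using that m' by (auto simp: s_def)
  have "bij_betw (\<lambda>e. corner_region e (s e)) (arcs G - T - {e\<^sub>0}) (Regular ` far_regions e\<^sub>0)"
  proof -
    have "bij_betw (Regular \<circ> m) (arcs G - T - {e\<^sub>0}) (Regular ` far_regions e\<^sub>0)"
      using m' by (intro bij_betw_trans[of m]) (auto simp: bij_betw_def inj_on_def)
    then show ?thesis by (rule bij_betw_cong[THEN iffD1, rotated]) (simp add: regular)
  qed
  moreover have "bij_betw (\<lambda>e. corner_region e (s e)) (insert e\<^sub>0 T) (Circle ` verts G)"
  proof -
    have "bij_betw (head G) (insert e\<^sub>0 T) (insert (head G e\<^sub>0) (verts G - {head G e\<^sub>0}))"
      using notIn_Un_bij_betw[OF _ _ T'(3), of e\<^sub>0] T'(2) by auto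
    moreover have "insert (head G e\<^sub>0) (verts G - {head G e\<^sub>0}) = verts G" using T'(1) by auto
    ultimately have "bij_betw (Circle \<circ> head G) (insert e\<^sub>0 T) (Circle ` verts G)"
      by (intro bij_betw_trans[of "head G"]) (auto simp: bij_betw_def inj_on_def)
    then show ?thesis by (rule bij_betw_cong[THEN iffD1, rotated]) (simp add: circle)
  qed
  ultimately have "bij_betw (\<lambda>e. corner_region e (s e)) ((arcs G - T - {e\<^sub>0}) \<union> insert e\<^sub>0 T)
      (Regular ` far_regions e\<^sub>0 \<union> Circle ` verts G)"
    by (rule bij_betw_combine) auto
  moreover have "(arcs G - T - {e\<^sub>0}) \<union> insert e\<^sub>0 T = arcs G" using T' by auto
  ultimately have "s \<in> kauffman_states \<delta>"
    using target_regions[OF T'(1) assms(1)] by (simp add: kauffman_states_def s_def)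
  moreover have "north_edges e\<^sub>0 s = T"
    using T'(1,2) by (auto simp: north_edges_def s_def split: if_splits)
  ultimately show ?thesis by blast
qed

text \<open>
  The existence of a state already forces the north edges to be free of cycles, so that the matching
  is unique.
\<close>

lemma states_eqI:
  assumes "e\<^sub>0 \<in> arcs G" "\<delta> \<in> edge_interior e\<^sub>0" "s \<in> kauffman_states \<delta>" "s' \<in> kauffman_states \<delta>"
    and T: "north_edges e\<^sub>0 s = north_edges e\<^sub>0 s'"
  shows "s = s'"
proof (rule extensionalityI[of _ "arcs G"])
  show "s \<in> extensional (arcs G)" "s' \<in> extensional (arcs G)"
    using assms(3,4) by (auto simp: kauffman_states_def)
  note st = state_north[OF assms(1,2,3)] and st' = state_north[OF assms(1,2,4), folded T]
  have "cycle_free_arcs (north_edges e\<^sub>0 s)"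
    using rooted_planar_map.no_matching[OF st(2) _ st(3)] by blast
  note same = rooted_planar_map.matching_unique[OF st(2) this st(3) st'(3),
      unfolded rooted_planar_map.free_edges_def[OF st(2)]]
  fix e assume e: "e \<in> arcs G"
  consider "e = e\<^sub>0" | "e \<in> north_edges e\<^sub>0 s" | "e \<in> arcs G - north_edges e\<^sub>0 s - {e\<^sub>0}" using e by blast
  then show "s e = s' e"
  proof cases
    case 1
    then show ?thesis using st(1) st'(1) by simp
  next
    case 2
    then have "e \<in> north_edges e\<^sub>0 s'" using T by simp
    with 2 show ?thesis by (simp add: north_edges_def)
  next
    case 3
    then have "chosen_region s e = chosen_region s' e" by (rule same)
    moreover have "s e \<noteq> North" "s' e \<noteq> North"
      using 3 T by (auto simp: north_edges_def)
    ultimately show ?thesis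
      using west_east_regions(6)[OF e] by (cases "s e"; cases "s' e") (auto simp: chosen_region_def)
  qed
qed

lemma represented_rooted:
  assumes "e\<^sub>0 \<in> arcs G" "distinct vs" "set vs = verts G - {head G e\<^sub>0}" and x: "lattice_point vs x"
  shows "rooted e\<^sub>0 (arcs (represented_subgraph vs x))"
    and "i < length vs \<Longrightarrow> in_edge (vs ! i) (x ! i) \<in> in_arcs G (vs ! i)"
    and "i < length vs \<Longrightarrow> in_position (vs ! i) (in_edge (vs ! i) (x ! i)) = x ! i"
proof -
  have mem: "vs ! i \<in> verts G - {head G e\<^sub>0}" if "i < length vs" for i
    using that assms(3) nth_mem by blast
  have edge: "in_edge (vs ! i) (x ! i) \<in> in_arcs G (vs ! i) \<and> in_position (vs ! i) (in_edge (vs ! i) (x ! i)) = x ! i"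
    if "i < length vs" for i
    using in_edge(1)[of "vs ! i" "x ! i"] mem[OF that] x that by (simp add: lattice_point_def)
  then show "i < length vs \<Longrightarrow> in_edge (vs ! i) (x ! i) \<in> in_arcs G (vs ! i)"
    "i < length vs \<Longrightarrow> in_position (vs ! i) (in_edge (vs ! i) (x ! i)) = x ! i" by blast+
  show "rooted e\<^sub>0 (arcs (represented_subgraph vs x))"
  proof (rule rootedI[OF assms(1)])
    show "arcs (represented_subgraph vs x) \<subseteq> arcs G - {e\<^sub>0}"
      using edge mem by (fastforce simp: represented_subgraph_def)
    show "\<exists>e\<in>arcs (represented_subgraph vs x). head G e = v" if "v \<in> verts G - {head G e\<^sub>0}" for v
    proof -
      have "v \<in> set vs" using that assms(3) by simp
      then obtain i where i: "i < length vs" "v = vs ! i" by (auto simp: in_set_conv_nth)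
      then have "in_edge (vs ! i) (x ! i) \<in> arcs (represented_subgraph vs x)"
        by (auto simp: represented_subgraph_def)
      then show ?thesis using edge[of i] i by (intro bexI) auto
    qed
    show "inj_on (head G) (arcs (represented_subgraph vs x))"
    proof (rule inj_onI)
      fix e e' assume "e \<in> arcs (represented_subgraph vs x)" "e' \<in> arcs (represented_subgraph vs x)"
        and eq: "head G e = head G e'"
      then obtain i j where ij: "i < length vs" "e = in_edge (vs ! i) (x ! i)" "j < length vs" "e' = in_edge (vs ! j) (x ! j)"
        by (auto simp: represented_subgraph_def)
      then have "vs ! i = vs ! j" using edge[of i] edge[of j] eq by simp
      then have "i = j" using ij assms(2) by (simp add: nth_eq_iff_index_eq)
      then show "e = e'" using ij by simp
    qed
    show "head G e \<noteq> head G e\<^sub>0" if "e \<in> arcs (represented_subgraph vs x)" for e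
      using that edge mem by (fastforce simp: represented_subgraph_def)
  qed
qed

text \<open>
  The inverse of the passage from a lattice point to its set of edges.
\<close>

definition coordinates :: "complex list \<Rightarrow> 'a set \<Rightarrow> nat list" where
  "coordinates vs T = map (\<lambda>v. in_position v (THE e. e \<in> T \<and> head G e = v)) vs"

lemma unique_in_edge:
  assumes "rooted e\<^sub>0 T" "e \<in> T"
  shows "(THE d. d \<in> T \<and> head G d = head G e) = e"
  using rootedD(3)[OF assms(1)] assms(2) by (intro the_equality) (auto simp: bij_betw_def dest: inj_onD)

lemma coordinates_represented:
  assumes "e\<^sub>0 \<in> arcs G" "distinct vs" "set vs = verts G - {head G e\<^sub>0}" "lattice_point vs x"
  shows "coordinates vs (arcs (represented_subgraph vs x)) = x"
proof (rule nth_equalityI)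
  show "length (coordinates vs (arcs (represented_subgraph vs x))) = length x"
    using assms(4) by (simp add: coordinates_def lattice_point_def)
  fix i assume "i < length (coordinates vs (arcs (represented_subgraph vs x)))"
  then have i: "i < length vs" by (simp add: coordinates_def)
  have "(THE e. e \<in> arcs (represented_subgraph vs x) \<and> head G e = vs ! i) = in_edge (vs ! i) (x ! i)"
    using unique_in_edge[OF represented_rooted(1)[OF assms], of "in_edge (vs ! i) (x ! i)"]
      represented_rooted(2)[OF assms i] i by (auto simp: represented_subgraph_def)
  then show "coordinates vs (arcs (represented_subgraph vs x)) ! i = x ! i"
    using represented_rooted(3)[OF assms i] i by (simp add: coordinates_def)
qed

lemma represented_coordinates:
  assumes T: "rooted e\<^sub>0 T" and vs: "set vs = verts G - {head G e\<^sub>0}"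
  shows "lattice_point vs (coordinates vs T)" "arcs (represented_subgraph vs (coordinates vs T)) = T"
proof -
  note T' = rootedD[OF T]
  define sel where "sel v = (THE e. e \<in> T \<and> head G e = v)" for v
  have sel: "sel v \<in> T \<and> head G (sel v) = v \<and> sel v \<in> in_arcs G v \<and> v \<in> verts G" if "v \<in> set vs" for v
  proof -
    have "\<exists>e\<in>T. head G e = v" using that vs by (intro bij_betw_hits[OF T'(3)]) auto
    then obtain e where "e \<in> T" "head G e = v" by blast
    then show ?thesis using unique_in_edge[OF T, of e] T'(2) by (auto simp: sel_def)
  qed
  have coord: "coordinates vs T ! i = in_position (vs ! i) (sel (vs ! i))" if "i < length vs" for i
    using that by (simp add: coordinates_def sel_def)
  show "lattice_point vs (coordinates vs T)"
    unfolding lattice_point_def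
  proof (intro conjI allI impI)
    fix i assume i: "i < length vs"
    have "in_position (vs ! i) (sel (vs ! i)) \<in> {1..in_degree G (vs ! i)}"
      using bij_betw_apply[OF bij_in_position] sel[OF nth_mem[OF i]] by blast
    then show "1 \<le> coordinates vs T ! i" "coordinates vs T ! i \<le> in_degree G (vs ! i)"
      using coord[OF i] by auto
  qed (simp add: coordinates_def)
  have "in_edge (vs ! i) (coordinates vs T ! i) = sel (vs ! i)" if "i < length vs" for i
  proof -
    have "vs ! i \<in> verts G" "sel (vs ! i) \<in> in_arcs G (vs ! i)" using sel[OF nth_mem[OF that]] by blast+
    from in_edge(2)[OF this] show ?thesis using coord[OF that] by simp
  qed
  then have "arcs (represented_subgraph vs (coordinates vs T)) = {sel (vs ! i) |i. i < length vs}"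
    unfolding represented_subgraph_def by (auto; metis)
  also have "\<dots> = sel ` set vs" by (auto simp: set_conv_nth)
  also have "\<dots> = T"
  proof
    show "sel ` set vs \<subseteq> T" using sel by auto
    show "T \<subseteq> sel ` set vs"
    proof
      fix e assume "e \<in> T"
      then have "sel (head G e) = e" "head G e \<in> set vs"
        using unique_in_edge[OF T] bij_betw_apply[OF T'(3)] vs unfolding sel_def by blast+
      then show "e \<in> sel ` set vs" by (metis imageI)
    qed
  qed
  finally show "arcs (represented_subgraph vs (coordinates vs T)) = T" .
qed

lemma tree_points_iff:
  assumes "e\<^sub>0 \<in> arcs G" "distinct vs" "set vs = verts G - {head G e\<^sub>0}"
  shows "x \<in> tree_points (head G e\<^sub>0) vs \<longleftrightarrow> lattice_point vs x \<and> cycle_free_arcs (arcs (represented_subgraph vs x))"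
proof (cases "lattice_point vs x")
  case True
  define H where "H = represented_subgraph vs x"
  have H: "verts H = verts G" "tail H = tail G" "head H = head G"
    by (auto simp: H_def represented_subgraph_def)
  note T = represented_rooted(1)[OF assms True, folded H_def]
  note T' = rootedD[OF T]
  interpret H: fin_digraph H
    using T'(2) finite_subset by unfold_locales (auto simp: H intro: finite_subset[OF _ finite_arcs])
  have "spanning H G"
    unfolding spanning_def subgraph_def using T'(2)
    by (auto simp: H compatible_def wf_digraph_axioms H.wf_digraph_axioms)
  moreover have "in_degree H v = 1" if "v \<in> verts G - {head G e\<^sub>0}" for v
  proof -
    obtain e where e: "e \<in> arcs H" "head G e = v" using bij_betw_hits[OF T'(3) \<open>v \<in> _\<close>] by blast
    have "in_arcs H v = {e}"
      using e T'(3) by (auto simp: in_arcs_def H bij_betw_def dest: inj_onD)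
    then show ?thesis by (simp add: in_degree_def)
  qed
  moreover have "in_degree H (head G e\<^sub>0) = 0"
  proof -
    have "in_arcs H (head G e\<^sub>0) = {}"
      using T'(3) bij_betw_apply by (fastforce simp: in_arcs_def H)
    then show ?thesis by (simp add: in_degree_def)
  qed
  ultimately have "oriented_spanning_tree (head G e\<^sub>0) H \<longleftrightarrow> (\<nexists>p. H.cycle p)"
    unfolding oriented_spanning_tree_def by blast
  also have "\<dots> \<longleftrightarrow> cycle_free_arcs (arcs H)"
    unfolding H.cycle_iff_arc_set rooted_planar_map.cycle_free_def[OF T] H by blast
  finally show ?thesis
    using True by (simp add: tree_points_def H_def)
qed (simp add: tree_points_def)

lemma bij_states_tree_points:
  assumes "e\<^sub>0 \<in> arcs G" "\<delta> \<in> edge_interior e\<^sub>0" "distinct vs" "set vs = verts G - {head G e\<^sub>0}"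
  shows "bij_betw (\<lambda>s. coordinates vs (north_edges e\<^sub>0 s)) (kauffman_states \<delta>) (tree_points (head G e\<^sub>0) vs)"
  unfolding bij_betw_def
proof (intro conjI equalityI subsetI)
  note north = state_north[OF assms(1,2)]
  show "inj_on (\<lambda>s. coordinates vs (north_edges e\<^sub>0 s)) (kauffman_states \<delta>)"
    by (rule inj_onI, rule states_eqI[OF assms(1,2)])
      (metis north(2) represented_coordinates(2)[OF _ assms(4)])+
  show "x \<in> tree_points (head G e\<^sub>0) vs" if x: "x \<in> (\<lambda>s. coordinates vs (north_edges e\<^sub>0 s)) ` kauffman_states \<delta>" for x
  proof -
    obtain s where s: "s \<in> kauffman_states \<delta>" "x = coordinates vs (north_edges e\<^sub>0 s)" using x by blast
    have "cycle_free_arcs (north_edges e\<^sub>0 s)"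
      using rooted_planar_map.no_matching[OF north(2)[OF s(1)] _ north(3)[OF s(1)]] by blast
    then show ?thesis
      using represented_coordinates[OF north(2)[OF s(1)] assms(4)] s(2) tree_points_iff[OF assms(1,3,4)] by simp
  qed
  show "x \<in> (\<lambda>s. coordinates vs (north_edges e\<^sub>0 s)) ` kauffman_states \<delta>" if x: "x \<in> tree_points (head G e\<^sub>0) vs" for x
  proof -
    have lat: "lattice_point vs x" "cycle_free_arcs (arcs (represented_subgraph vs x))"
      using x tree_points_iff[OF assms(1,3,4)] by auto
    note T = represented_rooted(1)[OF assms(1,3,4) lat(1)]
    obtain m where "matches e\<^sub>0 (arcs (represented_subgraph vs x)) m"
      using rooted_planar_map.matching_exists[OF T lat(2)] by blast
    then obtain s where "s \<in> kauffman_states \<delta>" "north_edges e\<^sub>0 s = arcs (represented_subgraph vs x)"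
      using state_of_matching[OF assms(2) T] by blast
    then show ?thesis
      using coordinates_represented[OF assms(1,3,4) lat(1)] by (intro image_eqI[of _ _ s]) simp_all
  qed
qed

fun corner_exponent :: "corner \<Rightarrow> int" where
  "corner_exponent North = 0" | "corner_exponent West = - 1" | "corner_exponent East = 1"

lemma corner_weight_exponent: "corner_weight c = t_half_pow (corner_exponent c)"
  by (cases c) auto

definition state_exponent :: "'a \<Rightarrow> ('a \<Rightarrow> corner) \<Rightarrow> int" where
  "state_exponent e\<^sub>0 s = (\<Sum>e\<in>arcs G. if e = e\<^sub>0 then 1 else corner_exponent (s e))"

lemma state_weight_exponent: "state_weight e\<^sub>0 s = t_half_pow (state_exponent e\<^sub>0 s)"
proof -
  have "state_weight e\<^sub>0 s = (\<Prod>e\<in>arcs G. t_half_pow (if e = e\<^sub>0 then 1 else corner_exponent (s e)))"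
    unfolding state_weight_def by (rule prod.cong) (auto simp: corner_weight_exponent)
  then show ?thesis
    by (simp only: prod_fls_X_intpow[OF finite_arcs] state_exponent_def)
qed

lemma sum_coordinates:
  assumes T: "rooted e\<^sub>0 T" and vs: "distinct vs" "set vs = verts G - {head G e\<^sub>0}"
  shows "sum_list (coordinates vs T) = (\<Sum>e\<in>T. in_position (head G e) e)"
proof -
  have "sum_list (coordinates vs T) = (\<Sum>v\<in>verts G - {head G e\<^sub>0}. in_position v (THE e. e \<in> T \<and> head G e = v))"
    using vs by (simp add: coordinates_def sum_list_distinct_conv_sum_set)
  also have "\<dots> = (\<Sum>e\<in>T. in_position (head G e) (THE d. d \<in> T \<and> head G d = head G e))"
    by (rule sum.reindex_bij_betw[OF rootedD(3)[OF T], symmetric])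
  also have "\<dots> = (\<Sum>e\<in>T. in_position (head G e) e)"
    using unique_in_edge[OF T] by simp
  finally show ?thesis .
qed

lemma state_exponent_coordinates:
  assumes "e\<^sub>0 \<in> arcs G" "\<delta> \<in> edge_interior e\<^sub>0" "distinct vs" "set vs = verts G - {head G e\<^sub>0}"
  shows "\<exists>c. \<forall>s\<in>kauffman_states \<delta>. real_of_int (state_exponent e\<^sub>0 s) =
    c + 2 * real (sum_list (coordinates vs (north_edges e\<^sub>0 s)))"
proof -
  \<comment> \<open>the summand \<open>1\<close> is the contribution of \<open>e\<^sub>0\<close>\<close>
  define K where "K = 1 + (\<Sum>e\<in>arcs G - {e\<^sub>0}. alexander_numbering (west_region e) + alexander_numbering (east_region e))
    - 2 * (\<Sum>f\<in>far_regions e\<^sub>0. alexander_numbering f)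
    - (\<Sum>v\<in>verts G - {head G e\<^sub>0}. 2 * alexander_numbering (west_region (leftmost_in v)) + 1)"
  have "real_of_int (state_exponent e\<^sub>0 s) = K + 2 * real (sum_list (coordinates vs (north_edges e\<^sub>0 s)))"
    if s: "s \<in> kauffman_states \<delta>" for s
  proof -
    define T where "T = north_edges e\<^sub>0 s"
    note st = state_north[OF assms(1,2) s, folded T_def]
    interpret P: planar_map "verts G" "arcs G" regular_regions "tail G" "head G" west_region east_region region_winding
      using planar_map_regions assms(1) by blast
    have num: "P.numbering = alexander_numbering"
      by (simp add: P.numbering_def P.potential_def alexander_numbering_def fun_eq_iff)
    have free: "rooted_planar_map.free_edges (arcs G) e\<^sub>0 T = arcs G - T - {e\<^sub>0}"
      "rooted_planar_map.free_faces regular_regions west_region east_region e\<^sub>0 = far_regions e\<^sub>0"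
      using rooted_planar_map.free_edges_def[OF st(2)] rooted_planar_map.free_faces_def[OF st(2)] by auto
    have "state_exponent e\<^sub>0 s = 1 + (\<Sum>e\<in>arcs G - {e\<^sub>0}. corner_exponent (s e))"
      unfolding state_exponent_def using assms(1) by (subst sum.remove[of _ e\<^sub>0]) auto
    also have "(\<Sum>e\<in>arcs G - {e\<^sub>0}. corner_exponent (s e)) = (\<Sum>e\<in>arcs G - T - {e\<^sub>0}. corner_exponent (s e))"
      by (rule sum.mono_neutral_right) (auto simp: T_def north_edges_def)
    finally have "real_of_int (state_exponent e\<^sub>0 s) = 1 + (\<Sum>e\<in>arcs G - T - {e\<^sub>0}. real_of_int (corner_exponent (s e)))"
      by simp
    also have "(\<Sum>e\<in>arcs G - T - {e\<^sub>0}. real_of_int (corner_exponent (s e))) =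
        (\<Sum>e\<in>arcs G - T - {e\<^sub>0}. if chosen_region s e = west_region e then - 1 else 1)"
    proof (rule sum.cong[OF refl])
      fix e assume e: "e \<in> arcs G - T - {e\<^sub>0}"
      then have "s e \<noteq> North" "west_region e \<noteq> east_region e"
        using west_east_regions(6)[of e] by (auto simp: T_def north_edges_def)
      then show "real_of_int (corner_exponent (s e)) = (if chosen_region s e = west_region e then - 1 else 1)"
        by (cases "s e") (auto simp: chosen_region_def)
    qed
    also have "\<dots> = (\<Sum>e\<in>arcs G - {e\<^sub>0}. alexander_numbering (west_region e) + alexander_numbering (east_region e))
        - 2 * (\<Sum>f\<in>far_regions e\<^sub>0. alexander_numbering f)
        - (\<Sum>e\<in>T. 2 * alexander_numbering (west_region e) - 1)"
      using rooted_planar_map.sum_corners[OF st(2,3), unfolded free num] .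
    also have "(\<Sum>e\<in>T. 2 * alexander_numbering (west_region e) - 1) =
        (\<Sum>e\<in>T. (2 * alexander_numbering (west_region (leftmost_in (head G e))) + 1) - 2 * real (in_position (head G e) e))"
    proof (rule sum.cong[OF refl])
      fix e assume "e \<in> T"
      then have "e \<in> in_arcs G (head G e)" "head G e \<in> verts G" using rootedD(2)[OF st(2)] by auto
      then show "2 * alexander_numbering (west_region e) - 1 =
          (2 * alexander_numbering (west_region (leftmost_in (head G e))) + 1) - 2 * real (in_position (head G e) e)"
        using numbering_in_position by simp
    qed
    also have "\<dots> = (\<Sum>e\<in>T. 2 * alexander_numbering (west_region (leftmost_in (head G e))) + 1)
        - 2 * real (sum_list (coordinates vs T))"
      unfolding sum_coordinates[OF st(2) assms(3,4)] by (simp add: sum_subtractf sum_distrib_left)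
    also have "(\<Sum>e\<in>T. 2 * alexander_numbering (west_region (leftmost_in (head G e))) + 1) =
        (\<Sum>v\<in>verts G - {head G e\<^sub>0}. 2 * alexander_numbering (west_region (leftmost_in v)) + 1)"
      by (rule sum.reindex_bij_betw[OF rootedD(3)[OF st(2)]])
    finally show ?thesis by (simp add: K_def T_def)
  qed
  then show ?thesis by blast
qed

theorem spanning_tree_model:
  assumes "e\<^sub>0 \<in> arcs G" "\<delta> \<in> edge_interior e\<^sub>0" "distinct vs" "set vs = verts G - {head G e\<^sub>0}"
  shows "alexander_polynomial e\<^sub>0 \<delta> \<doteq> tree_polynomial (head G e\<^sub>0) vs"
proof -
  let ?x = "\<lambda>s. coordinates vs (north_edges e\<^sub>0 s)"
  obtain c where c: "\<And>s. s \<in> kauffman_states \<delta> \<Longrightarrow> real_of_int (state_exponent e\<^sub>0 s) = c + 2 * real (sum_list (?x s))"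
    using state_exponent_coordinates[OF assms] by blast
  \<comment> \<open>the real number \<open>c\<close> is an integer as soon as there is a state\<close>
  define n where "n = \<lfloor>c\<rfloor>"
  have exponent: "state_exponent e\<^sub>0 s = n + 2 * int (sum_list (?x s))" if "s \<in> kauffman_states \<delta>" for s
  proof -
    have "c = real_of_int (state_exponent e\<^sub>0 s - 2 * int (sum_list (?x s)))" using c[OF that] by simp
    then have "n = state_exponent e\<^sub>0 s - 2 * int (sum_list (?x s))" unfolding n_def by (metis floor_of_int)
    then show ?thesis by simp
  qed
  have "alexander_polynomial e\<^sub>0 \<delta> = (\<Sum>s\<in>kauffman_states \<delta>. t_half_pow n * t_half_pow (2 * int (sum_list (?x s))))"
    unfolding alexander_polynomial_def
    by (rule sum.cong[OF refl]) (simp only: state_weight_exponent exponent fls_X_intpow_times_fls_X_intpow)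
  also have "\<dots> = t_half_pow n * (\<Sum>s\<in>kauffman_states \<delta>. t_half_pow (2 * int (sum_list (?x s))))"
    by (simp only: sum_distrib_left)
  also have "(\<Sum>s\<in>kauffman_states \<delta>. t_half_pow (2 * int (sum_list (?x s)))) = tree_polynomial (head G e\<^sub>0) vs"
    unfolding tree_polynomial_def by (rule sum.reindex_bij_betw[OF bij_states_tree_points[OF assms]])
  finally show ?thesis unfolding eq_up_to_t_power_def by blast
qed

end

theorem theorem4p1:
  fixes G :: "(complex, 'e) pre_digraph"
    and \<gamma> :: "'e \<Rightarrow> real \<Rightarrow> complex" and \<rho> :: "complex \<Rightarrow> real"
    and e\<^sub>0 :: 'e and r \<delta> :: complex and vs :: "complex list" and U :: "complex set"
  assumes "balanced_transverse_plane_graph G \<gamma> \<rho>"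
    and "e\<^sub>0 \<in> arcs G" and "r = head G e\<^sub>0"
    and "U \<in> drawing.regular_regions G \<gamma>" and "\<not> bounded U"
    and "path_image (\<gamma> e\<^sub>0) \<subseteq> frontier U"
    and "\<delta> \<in> drawing.edge_interior \<gamma> e\<^sub>0"
    and "distinct vs" and "set vs = verts G - {r}"
  shows "drawing.alexander_polynomial G \<gamma> \<rho> e\<^sub>0 \<delta> \<doteq> drawing.tree_polynomial G \<gamma> \<rho> r vs"
proof -
  interpret balanced_transverse_plane_graph G \<gamma> \<rho> by fact
  show ?thesis
    using spanning_tree_model assms by simp
qed

end
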